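(* Let $D$ be one of $\mathbb{R}^3$, $\mathbb{T}^3$, $\mathbb{T}\times\mathbb{R}^2$, $\mathbb{T}^2\times\mathbb{R}$. If $u\in L^3(0,T;L^3(D))$ is a weak solution of the Euler equations on $[0,T]$ that satisfies $$\lim_{|y|\to0}\frac{1}{|y|}\int_0^T\int_D|u(t,x+y)-u(t,x)|^3\,dx\,dt=0,$$ then energy is conserved on $[0,T]$.
   Context: $T>0$ is fixed, $\mathbb{T}=\mathbb{R}/2\pi\mathbb{Z}$, $y$ ranges over $\mathbb{R}^3\setminus\{0\}$, and addition in periodic directions is understood periodically. $\mathcal{S}(D)$ is the set of $C^\infty$ functions on $D$ with Schwartz decay in the unbounded directions of $D$ (e.g. for $D=\mathbb{T}^2\times\mathbb{R}$: $\sup_x|\partial^\alpha\phi(x)||x_3|^k<\infty$ for all multi-indices $\alpha$ and all $k\ge0$); $\mathcal{D}(D)$ is the set of $C^\infty$ functions with compact support in $D$. $\mathcal{S}_\sigma(D)$ and $\mathcal{D}_\sigma(D)$ are the sets of divergence-free vector fields in $\mathcal{S}(D)$ and $\mathcal{D}(D)$. $H_\sigma=H_\sigma(D)$ is the closure of $\mathcal{D}_\sigma(D)$ (equivalently of $\mathcal{S}_\sigma(D)$) in $L^2(D)$. $C_{\rm w}([0,T];H_\sigma)$ is the set of $u:[0,T]\to H_\sigma$ such that $t\mapsto\langle u(t),\phi\rangle$ is continuous for every $\phi\in L^2(D)$. $\mathcal{S}_\sigma^T:=\{\psi\in C^\infty(D\times[0,T]):\psi(\cdot,t)\in\mathcal{S}_\sigma(D)\text{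 for all }t\in[0,T]\}$. Notation: $\langle f,g\rangle=\int_Df_ig_i\,dx$, $\langle F:G\rangle=\int_DF_{ij}G_{ij}\,dx$ (summation convention). Weak solution: $u\in C_{\rm w}([0,T];H_\sigma)$ is a weak solution of the Euler equations on $[0,T]$, arising from $u(0)\in H_\sigma$, if $$\langle u(t),\psi(t)\rangle-\langle u(0),\psi(0)\rangle-\int_0^t\langle u(\tau),\partial_t\psi(\tau)\rangle\,d\tau=\int_0^t\langle u(\tau)\otimes u(\tau):\nabla\psi(\tau)\rangle\,d\tau$$ for every $t\in[0,T]$ and every $\psi\in\mathcal{S}_\sigma^T$. Energy is conserved on $[0,T]$ means $\|u(t)\|_{L^2(D)}=\|u(0)\|_{L^2(D)}$ for every $t\in[0,T]$. *)

theory Defs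
  imports "HOL-Analysis.Analysis"
begin

text \<open>
  A set \<open>P\<close> of coordinate directions encodes the domain \<open>D\<close> that is a circle of length \<open>2 * pi\<close>
  in the directions of \<open>P\<close> and a line in the others. Functions on \<open>D\<close> are the functions on
  \<open>real ^ 3\<close> that are \<open>2 * pi\<close>-periodic in the directions of \<open>P\<close>; integrals over \<open>D\<close> are
  integrals over the period cell.
\<close>

definition periodic :: "3 set \<Rightarrow> (real^3 \<Rightarrow> 'b) \<Rightarrow> bool" where
  "periodic P f \<longleftrightarrow> (\<forall>i\<in>P. \<forall>x. f (x + axis i (2 * pi)) = f x)"

definition cell :: "3 set \<Rightarrow> (real^3) set" where
  "cell P = {x. \<forall>i\<in>P. 0 \<le> x $ i \<and> x $ i < 2 * pi}"

definition D_measure :: "3 set \<Rightarrow> (real^3) measure" where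
  "D_measure P = lebesgue_on (cell P)"

definition unbounded_part :: "3 set \<Rightarrow> real^3 \<Rightarrow> real^3" where
  "unbounded_part P x = (\<chi> i. if i \<in> P then 0 else x $ i)"


section \<open>Lebesgue spaces\<close>

text \<open>Elements of Lebesgue spaces are represented by functions, not by equivalence classes.\<close>

definition Lp :: "3 set \<Rightarrow> nat \<Rightarrow> (real^3 \<Rightarrow> real^3) set" where
  "Lp P p = {f. periodic P f \<and> f \<in> borel_measurable (D_measure P)
                \<and> integrable (D_measure P) (\<lambda>x. norm (f x) ^ p)}"

definition Lp_norm :: "3 set \<Rightarrow> nat \<Rightarrow> (real^3 \<Rightarrow> real^3) \<Rightarrow> real" where
  "Lp_norm P p f = root p (LINT x|D_measure P. norm (f x) ^ p)"

text \<open>On \<open>real^3^3\<close> the inner product is the sum of the products of all entries, so this covers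
  both pairings, of vector fields and of matrix fields.\<close>

definition pairing :: "3 set \<Rightarrow> (real^3 \<Rightarrow> 'b::real_inner) \<Rightarrow> (real^3 \<Rightarrow> 'b) \<Rightarrow> real" where
  "pairing P f g = (LINT x|D_measure P. f x \<bullet> g x)"

text \<open>The Bochner space of exponent \<open>q\<close> in time with values in \<open>Lp P p\<close>: strong measurability
  (almost everywhere limit of simple functions) and integrability of the norm.\<close>

definition simple_Lp :: "3 set \<Rightarrow> nat \<Rightarrow> real \<Rightarrow> (real \<Rightarrow> real^3 \<Rightarrow> real^3) set" where
  "simple_Lp P p T = {s. \<exists>(n::nat) E f.
      (\<forall>k<n. E k \<in> sets (lebesgue_on {0..T}) \<and> f k \<in> Lp P p)
      \<and> s = (\<lambda>t x. \<Sum>k<n. indicator (E k) t *\<^sub>R f k x)}"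

definition Bochner_Lp :: "3 set \<Rightarrow> nat \<Rightarrow> nat \<Rightarrow> real \<Rightarrow> (real \<Rightarrow> real^3 \<Rightarrow> real^3) set" where
  "Bochner_Lp P q p T = {u.
      (AE t in lebesgue_on {0..T}. u t \<in> Lp P p)
      \<and> (\<exists>s. (\<forall>n. s n \<in> simple_Lp P p T)
             \<and> (AE t in lebesgue_on {0..T}.
                  (\<lambda>n. Lp_norm P p (\<lambda>x. s n t x - u t x)) \<longlonglongrightarrow> 0))
      \<and> integrable (lebesgue_on {0..T}) (\<lambda>t. Lp_norm P p (u t) ^ q)}"


section \<open>Smooth functions\<close>

text \<open>For a convex set \<open>S\<close> with nonempty interior the derivative within \<open>S\<close> is unique; at
  boundary points it is the one-sided derivative.\<close>

primrec Ck_on ::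
  "nat \<Rightarrow> 'a::euclidean_space set \<Rightarrow> ('a \<Rightarrow> 'b::real_normed_vector) \<Rightarrow> bool" where
  "Ck_on 0 S f \<longleftrightarrow> continuous_on S f"
| "Ck_on (Suc k) S f \<longleftrightarrow>
     (\<exists>f'. (\<forall>x\<in>S. (f has_derivative f' x) (at x within S)) \<and> (\<forall>v. Ck_on k S (\<lambda>x. f' x v)))"

definition smooth_on ::
  "'a::euclidean_space set \<Rightarrow> ('a \<Rightarrow> 'b::real_normed_vector) \<Rightarrow> bool" where
  "smooth_on S f \<longleftrightarrow> (\<forall>k. Ck_on k S f)"

definition partial_deriv :: "3 \<Rightarrow> (real^3 \<Rightarrow> 'b::real_normed_vector) \<Rightarrow> real^3 \<Rightarrow> 'b" where
  "partial_deriv i f x = frechet_derivative f (at x) (axis i 1)"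

definition multi_deriv ::
  "nat^3 \<Rightarrow> (real^3 \<Rightarrow> 'b::real_normed_vector) \<Rightarrow> real^3 \<Rightarrow> 'b" where
  "multi_deriv \<alpha> f = (partial_deriv 1 ^^ (\<alpha> $ 1))
     ((partial_deriv 2 ^^ (\<alpha> $ 2)) ((partial_deriv 3 ^^ (\<alpha> $ 3)) f))"

definition gradient :: "(real^3 \<Rightarrow> real^3) \<Rightarrow> real^3 \<Rightarrow> real^3^3" where
  "gradient f x = (\<chi> i j. partial_deriv j f x $ i)"

definition divergence :: "(real^3 \<Rightarrow> real^3) \<Rightarrow> real^3 \<Rightarrow> real" where
  "divergence f x = (\<Sum>i\<in>UNIV. partial_deriv i f x $ i)"

definition tensor :: "real^3 \<Rightarrow> real^3 \<Rightarrow> real^3^3" where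
  "tensor a b = (\<chi> i j. a $ i * b $ j)"


section \<open>Function spaces on the domain\<close>

definition Schwartz :: "3 set \<Rightarrow> (real^3 \<Rightarrow> real^3) set" where
  "Schwartz P = {\<phi>. periodic P \<phi> \<and> smooth_on UNIV \<phi>
     \<and> (\<forall>\<alpha> k. \<exists>C. \<forall>x. norm (multi_deriv \<alpha> \<phi> x) * norm (unbounded_part P x) ^ k \<le> C)}"

text \<open>The periodic directions being compact, compact support in \<open>D\<close> means bounded support in the
  unbounded directions.\<close>

definition test_fields :: "3 set \<Rightarrow> (real^3 \<Rightarrow> real^3) set" where
  "test_fields P = {\<phi>. periodic P \<phi> \<and> smooth_on UNIV \<phi>
     \<and> (\<exists>R. \<forall>x. norm (unbounded_part P x) > R \<longrightarrow> \<phi> x = 0)}"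

definition Schwartz_sigma :: "3 set \<Rightarrow> (real^3 \<Rightarrow> real^3) set" where
  "Schwartz_sigma P = {\<phi> \<in> Schwartz P. \<forall>x. divergence \<phi> x = 0}"

definition test_fields_sigma :: "3 set \<Rightarrow> (real^3 \<Rightarrow> real^3) set" where
  "test_fields_sigma P = {\<phi> \<in> test_fields P. \<forall>x. divergence \<phi> x = 0}"

definition H_sigma :: "3 set \<Rightarrow> (real^3 \<Rightarrow> real^3) set" where
  "H_sigma P = {f \<in> Lp P 2.
     \<forall>\<epsilon>>0. \<exists>\<phi>\<in>test_fields_sigma P. Lp_norm P 2 (\<lambda>x. f x - \<phi> x) < \<epsilon>}"

definition Cw_H_sigma :: "3 set \<Rightarrow> real \<Rightarrow> (real \<Rightarrow> real^3 \<Rightarrow> real^3) set" where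
  "Cw_H_sigma P T = {u. (\<forall>t\<in>{0..T}. u t \<in> H_sigma P)
     \<and> (\<forall>\<phi>\<in>Lp P 2. continuous_on {0..T} (\<lambda>t. pairing P (u t) \<phi>))}"

definition Schwartz_sigma_T :: "3 set \<Rightarrow> real \<Rightarrow> (real \<Rightarrow> real^3 \<Rightarrow> real^3) set" where
  "Schwartz_sigma_T P T = {\<psi>. smooth_on (UNIV \<times> {0..T}) (\<lambda>(x, t). \<psi> t x)
     \<and> (\<forall>t\<in>{0..T}. \<psi> t \<in> Schwartz_sigma P)}"

definition time_deriv ::
  "real \<Rightarrow> (real \<Rightarrow> real^3 \<Rightarrow> real^3) \<Rightarrow> real \<Rightarrow> real^3 \<Rightarrow> real^3" where
  "time_deriv T \<psi> t x = vector_derivative (\<lambda>s. \<psi> s x) (at t within {0..T})"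


section \<open>Weak solutions of the Euler equations\<close>

text \<open>Membership in \<open>Schwartz_sigma_T\<close> imposes no uniformity in time on the decay, so the
  integrals in the weak formulation need not exist for every \<open>\<psi>\<close>. The identity is required whenever
  they do; otherwise it would be about the default value \<open>0\<close> of the integral. (The pairings in space
  that are not mentioned here always exist, since \<open>\<psi> t\<close> is square integrable and has bounded
  gradient.)\<close>

definition weak_terms_exist ::
  "3 set \<Rightarrow> real \<Rightarrow> (real \<Rightarrow> real^3 \<Rightarrow> real^3) \<Rightarrow> (real \<Rightarrow> real^3 \<Rightarrow> real^3) \<Rightarrow> real \<Rightarrow> bool" where
  "weak_terms_exist P T u \<psi> t \<longleftrightarrow>
     (AE \<tau> in lebesgue_on {0..t}. integrable (D_measure P) (\<lambda>x. u \<tau> x \<bullet> time_deriv T \<psi> \<tau> x))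
     \<and> integrable (lebesgue_on {0..t}) (\<lambda>\<tau>. pairing P (u \<tau>) (time_deriv T \<psi> \<tau>))
     \<and> integrable (lebesgue_on {0..t})
         (\<lambda>\<tau>. pairing P (\<lambda>x. tensor (u \<tau> x) (u \<tau> x)) (gradient (\<psi> \<tau>)))"

definition weak_Euler_solution :: "3 set \<Rightarrow> real \<Rightarrow> (real \<Rightarrow> real^3 \<Rightarrow> real^3) \<Rightarrow> bool" where
  "weak_Euler_solution P T u \<longleftrightarrow>
     u \<in> Cw_H_sigma P T
     \<and> (\<forall>t\<in>{0..T}. \<forall>\<psi>\<in>Schwartz_sigma_T P T. weak_terms_exist P T u \<psi> t \<longrightarrow>
          pairing P (u t) (\<psi> t) - pairing P (u 0) (\<psi> 0)
            - (LINT \<tau>|lebesgue_on {0..t}. pairing P (u \<tau>) (time_deriv T \<psi> \<tau>))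
          = (LINT \<tau>|lebesgue_on {0..t}.
               pairing P (\<lambda>x. tensor (u \<tau> x) (u \<tau> x)) (gradient (\<psi> \<tau>))))"

definition energy_conserved :: "3 set \<Rightarrow> real \<Rightarrow> (real \<Rightarrow> real^3 \<Rightarrow> real^3) \<Rightarrow> bool" where
  "energy_conserved P T u \<longleftrightarrow> (\<forall>t\<in>{0..T}. Lp_norm P 2 (u t) = Lp_norm P 2 (u 0))"

end

theory Submission
  imports Defs
begin

text \<open>
  Test the equation with the time-independent fields \<open>J \<phi>\<close>, where \<open>J\<close> is convolution with an even
  mollifier \<open>K\<close>, and pass to the limit \<open>\<phi> \<rightarrow> u s\<close> in \<open>L\<^sup>2\<close>. Since \<open>J\<close> is symmetric, the energy increment
  \<open>\<langle>u b, J (u b)\<rangle> - \<langle>u a, J (u a)\<rangle>\<close> is the integral over \<open>[a, b]\<close> of the flux of \<open>u \<tau>\<close> against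
  \<open>u a\<close> and \<open>u b\<close>; summing over partitions and using weak continuity gives the energy balance with the
  flux of \<open>u \<tau>\<close> against \<open>u \<tau>\<close>. No regularity in time is needed for this. The identity of Duchon and
  Robert bounds that flux by \<open>1/4\<close> of the integral of \<open>|\<nabla>K y|\<close> times the cubic increment
  of \<open>u \<tau>\<close> at \<open>y\<close>. As \<open>|\<nabla>K|\<close> is of order \<open>1/\<epsilon>\<close> times the inverse volume of a ball of
  radius \<open>\<epsilon>\<close>, the hypothesis makes the flux vanish as \<open>\<epsilon> \<rightarrow> 0\<close>.
\<close>


section \<open>Periodic functions and the period cell\<close>

text \<open>This shapes most of the proof. Smearing with a kernel turns weak continuity into
  continuity in time at every point of space; functionals of the smeared fields are then continuous
  in time by dominated convergence, and the same functionals of \<open>u t\<close> are measurable as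
  limits. The dominations rest on a bound of the L^2 norm that is uniform in time, and weak
  continuity gives it through the uniform boundedness principle.

  All kernels live in the unit ball. Since pi > 1, a translate of that ball fits into the period
  cell, so integrals over it are bounded by integrals over the cell, and one argument serves all
  four domains.

  Time need not be mollified because the mollified energy is the diagonal of a symmetric bilinear
  form: its increment from \<open>a\<close> to \<open>b\<close> is the sum of two increments in one
  argument only, with the other argument frozen at \<open>b\<close> and at \<open>a\<close>.\<close>

definition reduce :: "3 set \<Rightarrow> real^3 \<Rightarrow> real^3" where
  "reduce P x = (\<chi> i. if i \<in> P then x $ i - 2 * pi * of_int \<lfloor>x $ i / (2 * pi)\<rfloor> else x $ i)"

text \<open>The Borel counterpart of \<open>D_measure P\<close>. As a density on the whole space it
  can be multiplied with \<open>lborel\<close> and has the Borel sets as its sigma-algebra.\<close>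

definition cell_measure :: "3 set \<Rightarrow> (real^3) measure" where
  "cell_measure P = density lborel (indicator (cell P))"

definition period_lattice :: "3 set \<Rightarrow> (real^3) set" where
  "period_lattice P = range (\<lambda>n::int^3. \<chi> i. if i \<in> P then 2 * pi * of_int (n $ i) else 0)"

lemma sets_cell [measurable]: "cell P \<in> sets borel"
proof -
  have "cell P = (\<Inter>i\<in>P. {x. 0 \<le> x $ i} \<inter> {x. x $ i < 2 * pi})"
    by (auto simp: cell_def)
  moreover have "{x::real^3. 0 \<le> x $ i} \<inter> {x. x $ i < 2 * pi} \<in> sets borel" for i
    by (intro sets.Int borel_closed borel_open closed_Collect_le open_Collect_less continuous_intros)
  ultimately show ?thesis
    using sets.finite_INT[of P "\<lambda>i. {x. 0 \<le> x $ i} \<inter> {x. x $ i < 2 * pi}" "borel :: (real^3) measure"] 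
    by (cases "P = {}") (auto simp: cell_def)
qed

lemma sets_cell_measure [measurable_cong, simp]: "sets (cell_measure P) = sets borel"
  by (simp add: cell_measure_def)

lemma space_cell_measure [simp]: "space (cell_measure P) = UNIV"
  by (simp add: cell_measure_def)

lemma reduce_measurable [measurable]: "reduce P \<in> borel_measurable borel"
proof -
  have "reduce P = (\<lambda>x. \<Sum>i\<in>UNIV. (if i \<in> P then x $ i - 2 * pi * of_int \<lfloor>x $ i / (2 * pi)\<rfloor> else x $ i) *\<^sub>R axis i 1)"
    by (auto simp: reduce_def vec_eq_iff axis_def fun_eq_iff if_distrib[of "\<lambda>z. _ * z"] cong: if_cong)
  moreover have "\<dots> \<in> borel_measurable borel" 
    by measurable
  ultimately show ?thesis by simp
qed

lemma reduce_in_cell: "reduce P x \<in> cell P"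
proof -
  have "0 \<le> x $ i - 2 * pi * of_int \<lfloor>x $ i / (2 * pi)\<rfloor> \<and> x $ i - 2 * pi * of_int \<lfloor>x $ i / (2 * pi)\<rfloor> < 2 * pi" for i
  proof -
    have "of_int \<lfloor>x $ i / (2 * pi)\<rfloor> \<le> x $ i / (2 * pi)" "x $ i / (2 * pi) < of_int \<lfloor>x $ i / (2 * pi)\<rfloor> + 1"
      by linarith+
    then have "2 * pi * of_int \<lfloor>x $ i / (2 * pi)\<rfloor> \<le> 2 * pi * (x $ i / (2 * pi))"
      "2 * pi * (x $ i / (2 * pi)) < 2 * pi * (of_int \<lfloor>x $ i / (2 * pi)\<rfloor> + 1)"
      by (intro mult_left_mono mult_strict_left_mono; simp)+
    then show ?thesis by (simp add: algebra_simps)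
  qed
  then show ?thesis by (auto simp: cell_def reduce_def)
qed

text \<open>This is the tiling of space by lattice translates of the cell, in the form needed to sum
  indicator functions over the lattice.\<close>

lemma reduce_eq_iff: "x - l \<in> cell P \<and> l \<in> period_lattice P \<longleftrightarrow> l = x - reduce P x"
proof
  assume *: "x - l \<in> cell P \<and> l \<in> period_lattice P"
  then obtain n :: "int^3" where l: "l = (\<chi> i. if i \<in> P then 2 * pi * of_int (n $ i) else 0)"
    by (auto simp: period_lattice_def)
  have "\<lfloor>x $ i / (2 * pi)\<rfloor> = n $ i" if "i \<in> P" for i
  proof -
    have "0 \<le> x $ i - 2 * pi * of_int (n $ i)" "x $ i - 2 * pi * of_int (n $ i) < 2 * pi"
      using * that by (auto simp: cell_def l)
    then show ?thesis by (intro floor_unique) (auto simp: field_simps)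
  qed
  then show "l = x - reduce P x" by (auto simp: l reduce_def vec_eq_iff)
next
  assume "l = x - reduce P x"
  moreover have "x - reduce P x \<in> period_lattice P"
    unfolding period_lattice_def 
    by (rule image_eqI[where x="\<chi> i. \<lfloor>x $ i / (2 * pi)\<rfloor>"]) (auto simp: reduce_def vec_eq_iff)
  ultimately show "x - l \<in> cell P \<and> l \<in> period_lattice P"
    using reduce_in_cell by simp
qed

lemma periodic_add_lattice:
  assumes "periodic P f" "l \<in> period_lattice P"
  shows "f (x + l) = f x"
proof -
  have nat: "f (x + axis i (2 * pi * real n)) = f x" if "i \<in> P" for i n x
  proof (induction n arbitrary: x)
    case 0 show ?case by (simp add: axis_def vec_eq_iff flip: zero_vec_def) 
  next
    case (Suc n)
    have "axis i (2 * pi * real (Suc n)) = axis i (2 * pi) + axis i (2 * pi * real n)"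
      by (auto simp: axis_def vec_eq_iff algebra_simps)
    then show ?case using Suc[of "x + axis i (2 * pi)"] assms(1) that
      by (simp add: periodic_def add.assoc)
  qed
  have int: "f (x + axis i (2 * pi * of_int n)) = f x" if "i \<in> P" for i n x
  proof (cases "n \<ge> 0")
    case True then show ?thesis using nat[OF that, of x "nat n"] by simp
  next
    case False
    have "x + axis i (2 * pi * of_int n) + axis i (2 * pi * real (nat (-n))) = x"
      using False by (auto simp: axis_def vec_eq_iff)
    then show ?thesis using nat[OF that, of "x + axis i (2 * pi * of_int n)" "nat (-n)"] by metis
  qed
  obtain n :: "int^3" where l: "l = (\<chi> i. if i \<in> P then 2 * pi * of_int (n $ i) else 0)"
    using assms(2) by (auto simp: period_lattice_def)
  have "f (x + (\<Sum>i\<in>Q. axis i (2 * pi * of_int (n $ i)))) = f x" if "finite Q" "Q \<subseteq> P" for Q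
    using that
  proof (induction Q arbitrary: x)
    case (insert i Q)
    then show ?case using int[of i "x + (\<Sum>i\<in>Q. axis i (2 * pi * of_int (n $ i)))" "n $ i"]
      by (simp add: ac_simps)
  qed simp
  moreover have "l = (\<Sum>i\<in>P. axis i (2 * pi * of_int (n $ i)))"
  proof -
    have "finite P" by simp
    then show ?thesis by (auto simp: l vec_eq_iff axis_def if_distrib sum.delta' cong: if_cong)
  qed
  ultimately show ?thesis by simp
qed

lemma periodic_reduce: "periodic P f \<Longrightarrow> f (reduce P x) = f x"
  using periodic_add_lattice[of P f "x - reduce P x" "reduce P x"] reduce_eq_iff[of x "x - reduce P x" P] by simp

lemma periodic_comp_reduce: "periodic P (\<lambda>x. f (reduce P x))"
proof -
  have "reduce P (x + axis i (2 * pi)) = reduce P x" if "i \<in> P" for i x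
  proof -
    have "\<lfloor>(x $ i + 2 * pi) / (2 * pi)\<rfloor> = \<lfloor>x $ i / (2 * pi)\<rfloor> + 1"
      by (simp add: add_divide_distrib)
    then show ?thesis using that by (auto simp: reduce_def vec_eq_iff axis_def algebra_simps)
  qed
  then show ?thesis by (simp add: periodic_def)
qed

lemma periodic_shift: "periodic P f \<Longrightarrow> periodic P (\<lambda>x. f (x + y))"
  by (simp add: periodic_def add.assoc add.left_commute) (metis add.assoc add.commute)

lemma reduce_idem: "x \<in> cell P \<Longrightarrow> reduce P x = x"
  using reduce_eq_iff[of x 0 P] 
  by (auto simp: period_lattice_def intro!: image_eqI[where x=0] simp: vec_eq_iff)

lemma countable_period_lattice: "countable (period_lattice P)"
proof -
  have "countable (UNIV :: (int^3) set)"
    using countableI_type[where 'a="int"] 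
    by (intro countable_image_inj_on[where f="\<lambda>n. (n$1, n$2, n$3)" for n])
      (auto simp: inj_on_def vec_eq_iff forall_3)
  then show ?thesis unfolding period_lattice_def by simp
qed

lemma nn_integral_lborel_shift:
  fixes f :: "'a::euclidean_space \<Rightarrow> ennreal"
  assumes [measurable]: "f \<in> borel_measurable borel"
  shows "(\<integral>\<^sup>+x. f (x + y) \<partial>lborel) = (\<integral>\<^sup>+x. f x \<partial>lborel)"
proof -
  have "(\<integral>\<^sup>+x. f x \<partial>lborel) = (\<integral>\<^sup>+x. f x \<partial>distr lborel borel ((+) y))"
    by (simp add: lborel_distr_plus)
  also have "\<dots> = (\<integral>\<^sup>+x. f (x + y) \<partial>lborel)"
    by (subst nn_integral_distr) (auto simp: add.commute)
  finally show ?thesis by simp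
qed

text \<open>Unfolding: a translated cell is again a fundamental domain. Insert the sum over the
  lattice of the indicators of translated cells, which is 1, exchange sum and integral, and move
  each piece back by periodicity. What remains is the integral over the cell, weighted with the sum
  of the indicators of the translates of the shifted cell, and this is again 1.\<close>

lemma nn_integral_cell_shift:
  fixes F :: "real^3 \<Rightarrow> ennreal"
  assumes [measurable]: "F \<in> borel_measurable borel" and per: "periodic P F"
  shows "(\<integral>\<^sup>+x. F (x + y) \<partial>cell_measure P) = (\<integral>\<^sup>+x. F x \<partial>cell_measure P)"
proof -
  let ?L = "count_space (period_lattice P)"
  let ?I = "\<lambda>x. indicator (cell P) x :: ennreal"
  have one: "(\<integral>\<^sup>+l. ?I (z - l) \<partial>?L) = 1" for z
  proof -
    have "(\<integral>\<^sup>+l. ?I (z - l) \<partial>?L) = (\<integral>\<^sup>+l. indicator {z - reduce P z} l \<partial>?L)"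
    proof (rule nn_integral_cong)
      fix l assume "l \<in> space ?L"
      then show "?I (z - l) = indicator {z - reduce P z} l"
        using reduce_eq_iff[of z l P] by (auto simp: indicator_def)
    qed
    also have "\<dots> = emeasure ?L {z - reduce P z}"
      using reduce_eq_iff[of z "z - reduce P z" P] by (intro nn_integral_indicator) auto
    also have "\<dots> = 1" using reduce_eq_iff[of z "z - reduce P z" P] by simp
    finally show ?thesis .
  qed
  \<comment> \<open>The same count with the lattice vector negated, as it appears once the pieces
    have been moved back.\<close>
  have one': "(\<integral>\<^sup>+l. ?I (z + l) \<partial>?L) = 1" for z
  proof -
    have neg: "- l \<in> period_lattice P" if "l \<in> period_lattice P" for l
    proof -
      from that obtain n :: "int^3" where "l = (\<chi> i. if i \<in> P then 2 * pi * of_int (n $ i) else 0)"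
        unfolding period_lattice_def by blast
      then show ?thesis unfolding period_lattice_def
        by (intro image_eqI[where x="-n"]) (auto simp: vec_eq_iff)
    qed
    have "bij_betw uminus (period_lattice P) (period_lattice P)"
      by (rule bij_betwI[where g=uminus]) (auto simp: neg)
    from nn_integral_bij_count_space[OF this, of "\<lambda>l. ?I (z - l)"]
    show ?thesis by (simp add: one)
  qed
  have "(\<integral>\<^sup>+x. F (x + y) \<partial>cell_measure P) = (\<integral>\<^sup>+x. ?I x * F (x + y) \<partial>lborel)"
    unfolding cell_measure_def by (subst nn_integral_density) auto
  also have "\<dots> = (\<integral>\<^sup>+x. ?I (x - y) * F x \<partial>lborel)"
    using nn_integral_lborel_shift[of "\<lambda>x. ?I (x - y) * F x" y] by simp
  also have "\<dots> = (\<integral>\<^sup>+x. (\<integral>\<^sup>+l. ?I (x - y) * F x * ?I (x - l) \<partial>?L) \<partial>lborel)"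
    by (subst nn_integral_cmult) (auto simp: one)
  also have "\<dots> = (\<integral>\<^sup>+l. (\<integral>\<^sup>+x. ?I (x - y) * F x * ?I (x - l) \<partial>lborel) \<partial>?L)"
    by (intro nn_integral_count_space_nn_integral countable_period_lattice) auto
  also have "\<dots> = (\<integral>\<^sup>+l. (\<integral>\<^sup>+x. ?I (x - y + l) * F x * ?I x \<partial>lborel) \<partial>?L)"
  proof (rule nn_integral_cong)
    fix l assume "l \<in> space ?L"
    then have "F (x + l) = F x" for x using periodic_add_lattice[OF per] by simp
    then show "(\<integral>\<^sup>+x. ?I (x - y) * F x * ?I (x - l) \<partial>lborel) = (\<integral>\<^sup>+x. ?I (x - y + l) * F x * ?I x \<partial>lborel)"
      using nn_integral_lborel_shift[of "\<lambda>x. ?I (x - y) * F x * ?I (x - l)" l] 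
      by (simp add: algebra_simps)
  qed
  also have "\<dots> = (\<integral>\<^sup>+x. (\<integral>\<^sup>+l. ?I (x - y + l) * F x * ?I x \<partial>?L) \<partial>lborel)"
    by (intro nn_integral_count_space_nn_integral[symmetric] countable_period_lattice) auto
  also have "\<dots> = (\<integral>\<^sup>+x. ?I x * F x \<partial>lborel)"
    by (subst nn_integral_multc, simp, subst nn_integral_multc) (auto simp: one' mult.commute)
  also have "\<dots> = (\<integral>\<^sup>+x. F x \<partial>cell_measure P)"
    unfolding cell_measure_def by (subst nn_integral_density) auto
  finally show ?thesis .
qed

text \<open>Phrased through \<open>distr\<close>, translation invariance passes from nonnegative
  functions to Bochner integrals and to integrability.\<close>

lemma distr_cell_shift: "distr (cell_measure P) borel (\<lambda>x. reduce P (x + y)) = cell_measure P"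
proof (rule measure_eqI)
  fix A assume "A \<in> sets (distr (cell_measure P) borel (\<lambda>x. reduce P (x + y)))"
  then have [measurable]: "A \<in> sets borel" by simp
  let ?F = "\<lambda>x. indicator A (reduce P x) :: ennreal"
  have "emeasure (distr (cell_measure P) borel (\<lambda>x. reduce P (x + y))) A
      = (\<integral>\<^sup>+x. ?F (x + y) \<partial>cell_measure P)"
    by (subst nn_integral_indicator[symmetric], simp, subst nn_integral_distr) auto
  also have "\<dots> = (\<integral>\<^sup>+x. ?F x \<partial>cell_measure P)"
    by (intro nn_integral_cell_shift periodic_comp_reduce) auto
  also have "\<dots> = (\<integral>\<^sup>+x. indicator A x \<partial>cell_measure P)"
    unfolding cell_measure_def 
    by (subst (1 2) nn_integral_density) (auto intro!: nn_integral_cong simp: indicator_def reduce_idem)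
  also have "\<dots> = emeasure (cell_measure P) A" by simp
  finally show "emeasure (distr (cell_measure P) borel (\<lambda>x. reduce P (x + y))) A = emeasure (cell_measure P) A" .
qed simp

lemma
  fixes F :: "real^3 \<Rightarrow> 'b::{second_countable_topology, banach}"
  assumes [measurable]: "F \<in> borel_measurable borel" and per: "periodic P F"
  shows integral_cell_shift: "(\<integral>x. F (x + y) \<partial>cell_measure P) = (\<integral>x. F x \<partial>cell_measure P)"
    and integrable_cell_shift: "integrable (cell_measure P) (\<lambda>x. F (x + y)) \<longleftrightarrow> integrable (cell_measure P) F"
proof -
  have "integral\<^sup>L (distr (cell_measure P) borel (\<lambda>x. reduce P (x + y))) F = (\<integral>x. F (x + y) \<partial>cell_measure P)"
    by (subst integral_distr) (auto simp: periodic_reduce[OF per])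
  then show "(\<integral>x. F (x + y) \<partial>cell_measure P) = (\<integral>x. F x \<partial>cell_measure P)"
    by (simp add: distr_cell_shift)
  have "integrable (distr (cell_measure P) borel (\<lambda>x. reduce P (x + y))) F \<longleftrightarrow> integrable (cell_measure P) (\<lambda>x. F (x + y))"
    by (subst integrable_distr_eq) (auto simp: periodic_reduce[OF per])
  then show "integrable (cell_measure P) (\<lambda>x. F (x + y)) \<longleftrightarrow> integrable (cell_measure P) F"
    by (simp add: distr_cell_shift)
qed

lemma sigma_finite_cell_measure: "sigma_finite_measure (cell_measure P)"
  unfolding cell_measure_def
  by (subst sigma_finite_measure.sigma_finite_iff_density_finite[OF sigma_finite_lborel])
    (auto simp: indicator_def)


section \<open>Square integrable fields on the period cell\<close>

lemma
  fixes f g :: "'a \<Rightarrow> real"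
  assumes [measurable]: "f \<in> borel_measurable M" "g \<in> borel_measurable M"
    and f: "integrable M (\<lambda>x. (f x)\<^sup>2)" and g: "integrable M (\<lambda>x. (g x)\<^sup>2)"
  shows integrable_mult_square: "integrable M (\<lambda>x. f x * g x)"
    and Cauchy_Schwarz_integral:
      "(\<integral>x. \<bar>f x * g x\<bar> \<partial>M) \<le> sqrt (\<integral>x. (f x)\<^sup>2 \<partial>M) * sqrt (\<integral>x. (g x)\<^sup>2 \<partial>M)"
proof -
  have "2 * \<bar>f x * g x\<bar> \<le> (f x)\<^sup>2 + (g x)\<^sup>2" for x
    using sum_squares_ge_zero[of 0 "\<bar>f x\<bar> - \<bar>g x\<bar>"] 
    by (simp add: abs_mult power2_eq_square algebra_simps)
  then have le: "norm (f x * g x) \<le> norm ((f x)\<^sup>2 + (g x)\<^sup>2)" for x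
    by (smt (verit) real_norm_def abs_ge_zero)
  show int: "integrable M (\<lambda>x. f x * g x)"
    by (rule Bochner_Integration.integrable_bound[OF Bochner_Integration.integrable_add[OF f g]])
      (use le in auto)
  have nn: "(\<integral>\<^sup>+x. ennreal \<bar>h x\<bar> ^ 2 \<partial>M) = ennreal (\<integral>x. (h x)\<^sup>2 \<partial>M)" 
    if "integrable M (\<lambda>x. (h x)\<^sup>2)" for h :: "'a \<Rightarrow> real"
    using nn_integral_eq_integral[OF that] by (simp add: ennreal_power)
  have "ennreal ((\<integral>x. \<bar>f x * g x\<bar> \<partial>M)\<^sup>2) = (\<integral>\<^sup>+x. ennreal \<bar>f x\<bar> * ennreal \<bar>g x\<bar> \<partial>M)\<^sup>2"
    using nn_integral_eq_integral[OF integrable_abs[OF int]]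
    by (simp add: ennreal_power abs_mult ennreal_mult)
  also have "\<dots> \<le> (\<integral>\<^sup>+x. ennreal \<bar>f x\<bar> ^ 2 \<partial>M) * (\<integral>\<^sup>+x. ennreal \<bar>g x\<bar> ^ 2 \<partial>M)"
    by (rule Cauchy_Schwarz_nn_integral) auto
  also have "\<dots> = ennreal ((\<integral>x. (f x)\<^sup>2 \<partial>M) * (\<integral>x. (g x)\<^sup>2 \<partial>M))"
    by (simp add: nn f g ennreal_mult)
  finally have "(\<integral>x. \<bar>f x * g x\<bar> \<partial>M)\<^sup>2 \<le> (\<integral>x. (f x)\<^sup>2 \<partial>M) * (\<integral>x. (g x)\<^sup>2 \<partial>M)"
    by (simp add: ennreal_le_iff)
  then show "(\<integral>x. \<bar>f x * g x\<bar> \<partial>M) \<le> sqrt (\<integral>x. (f x)\<^sup>2 \<partial>M) * sqrt (\<integral>x. (g x)\<^sup>2 \<partial>M)"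
    by (metis real_le_rsqrt real_sqrt_mult)
qed

text \<open>Representatives are Borel on all of space, so that shifts and products of them remain
  measurable without completing the measure.\<close>

definition L2_field :: "3 set \<Rightarrow> (real^3 \<Rightarrow> real^3) \<Rightarrow> bool" where
  "L2_field P f \<longleftrightarrow> periodic P f \<and> f \<in> borel_measurable borel
     \<and> integrable (cell_measure P) (\<lambda>x. (norm (f x))\<^sup>2)"

definition sq_norm :: "3 set \<Rightarrow> (real^3 \<Rightarrow> real^3) \<Rightarrow> real" where
  "sq_norm P f = (\<integral>x. (norm (f x))\<^sup>2 \<partial>cell_measure P)"

lemma L2_fieldD:
  assumes "L2_field P f"
  shows "periodic P f" "f \<in> borel_measurable borel" "integrable (cell_measure P) (\<lambda>x. (norm (f x))\<^sup>2)"
  using assms by (auto simp: L2_field_def)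

lemma sq_norm_nonneg [simp]: "0 \<le> sq_norm P f"
  by (simp add: sq_norm_def)

lemma nn_integral_sq_norm:
  "L2_field P f \<Longrightarrow> (\<integral>\<^sup>+x. ennreal ((norm (f x))\<^sup>2) \<partial>cell_measure P) = ennreal (sq_norm P f)"
  unfolding sq_norm_def by (intro nn_integral_eq_integral) (auto simp: L2_field_def)

lemma norm_add_square_le: "(norm (a + b))\<^sup>2 \<le> 2 * (norm a)\<^sup>2 + 2 * (norm (b::'a::real_normed_vector))\<^sup>2"
proof -
  have "(norm (a + b))\<^sup>2 \<le> (norm a + norm b)\<^sup>2"
    by (intro power_mono norm_triangle_ineq norm_ge_zero)
  also have "\<dots> \<le> 2 * (norm a)\<^sup>2 + 2 * (norm b)\<^sup>2"
    using sum_squares_ge_zero[of 0 "norm a - norm b"] by (simp add: power2_eq_square algebra_simps)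
  finally show ?thesis .
qed

lemma
  assumes f: "L2_field P f" and g: "L2_field P g"
  shows L2_field_add: "L2_field P (\<lambda>x. f x + g x)"
    and sq_norm_add_le: "sq_norm P (\<lambda>x. f x + g x) \<le> 2 * sq_norm P f + 2 * sq_norm P g"
proof -
  note [measurable] = L2_fieldD(2)[OF f] L2_fieldD(2)[OF g]
  have int: "integrable (cell_measure P) (\<lambda>x. 2 * (norm (f x))\<^sup>2 + 2 * (norm (g x))\<^sup>2)"
    using L2_fieldD(3)[OF f] L2_fieldD(3)[OF g] by auto
  then have int': "integrable (cell_measure P) (\<lambda>x. (norm (f x + g x))\<^sup>2)"
    by (rule Bochner_Integration.integrable_bound) (auto intro!: AE_I2 norm_add_square_le)
  then show "L2_field P (\<lambda>x. f x + g x)"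
    using f g by (auto simp: L2_field_def periodic_def)
  have "sq_norm P (\<lambda>x. f x + g x) \<le> (\<integral>x. 2 * (norm (f x))\<^sup>2 + 2 * (norm (g x))\<^sup>2 \<partial>cell_measure P)"
    unfolding sq_norm_def by (intro integral_mono int int' norm_add_square_le)
  also have "\<dots> = 2 * sq_norm P f + 2 * sq_norm P g"
    using L2_fieldD(3)[OF f] L2_fieldD(3)[OF g] by (simp add: sq_norm_def)
  finally show "sq_norm P (\<lambda>x. f x + g x) \<le> 2 * sq_norm P f + 2 * sq_norm P g" .
qed

lemma L2_field_minus: "L2_field P f \<Longrightarrow> L2_field P (\<lambda>x. - f x)"
  by (auto simp: L2_field_def periodic_def)

lemma L2_field_diff: "L2_field P f \<Longrightarrow> L2_field P g \<Longrightarrow> L2_field P (\<lambda>x. f x - g x)"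
  using L2_field_add[OF _ L2_field_minus, of P f g] by simp

lemma sq_norm_diff_le:
  "L2_field P f \<Longrightarrow> L2_field P g \<Longrightarrow> sq_norm P (\<lambda>x. f x - g x) \<le> 2 * sq_norm P f + 2 * sq_norm P g"
  using sq_norm_add_le[OF _ L2_field_minus, of P f g] by (simp add: sq_norm_def)

lemma L2_field_scaleR: "L2_field P f \<Longrightarrow> L2_field P (\<lambda>x. c *\<^sub>R f x)"
  by (auto simp: L2_field_def periodic_def power_mult_distrib)

lemma
  assumes f: "L2_field P f"
  shows L2_field_shift: "L2_field P (\<lambda>x. f (x + y))"
    and sq_norm_shift: "sq_norm P (\<lambda>x. f (x + y)) = sq_norm P f"
proof -
  note [measurable] = L2_fieldD(2)[OF f] 
  have per: "periodic P (\<lambda>x. (norm (f x))\<^sup>2)"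
    using L2_fieldD(1)[OF f] by (simp add: periodic_def)
  show "sq_norm P (\<lambda>x. f (x + y)) = sq_norm P f"
    unfolding sq_norm_def by (intro integral_cell_shift[OF _ per]) simp
  show "L2_field P (\<lambda>x. f (x + y))"
    using L2_fieldD[OF f] integrable_cell_shift[OF _ per, of y] by (auto simp: L2_field_def periodic_shift)
qed

lemma
  assumes f: "L2_field P f" and g: "L2_field P g"
  shows L2_field_integrable_norm_mult: "integrable (cell_measure P) (\<lambda>x. norm (f x) * norm (g x))"
    and L2_field_integrable_inner: "integrable (cell_measure P) (\<lambda>x. f x \<bullet> g x)"
    and L2_field_CS_norm: "(\<integral>x. norm (f x) * norm (g x) \<partial>cell_measure P) \<le> sqrt (sq_norm P f) * sqrt (sq_norm P g)"
    and L2_field_CS: "\<bar>\<integral>x. f x \<bullet> g x \<partial>cell_measure P\<bar> \<le> sqrt (sq_norm P f) * sqrt (sq_norm P g)"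
proof -
  note [measurable] = L2_fieldD(2)[OF f] L2_fieldD(2)[OF g]
  show 1: "integrable (cell_measure P) (\<lambda>x. norm (f x) * norm (g x))"
    using f g by (intro integrable_mult_square) (auto simp: L2_field_def)
  then show 2: "integrable (cell_measure P) (\<lambda>x. f x \<bullet> g x)"
    by (rule Bochner_Integration.integrable_bound) (auto intro!: AE_I2 Cauchy_Schwarz_ineq2)
  show 3: "(\<integral>x. norm (f x) * norm (g x) \<partial>cell_measure P) \<le> sqrt (sq_norm P f) * sqrt (sq_norm P g)"
    using Cauchy_Schwarz_integral[of "\<lambda>x. norm (f x)" "cell_measure P" "\<lambda>x. norm (g x)"] f g
    by (auto simp: L2_field_def sq_norm_def)
  have "\<bar>\<integral>x. f x \<bullet> g x \<partial>cell_measure P\<bar> \<le> (\<integral>x. \<bar>f x \<bullet> g x\<bar> \<partial>cell_measure P)"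
    by (rule integral_abs_bound)
  also have "\<dots> \<le> (\<integral>x. norm (f x) * norm (g x) \<partial>cell_measure P)"
    by (intro integral_mono integrable_abs 1 2 Cauchy_Schwarz_ineq2)
  finally show "\<bar>\<integral>x. f x \<bullet> g x \<partial>cell_measure P\<bar> \<le> sqrt (sq_norm P f) * sqrt (sq_norm P g)"
    using 3 by simp
qed

section \<open>Fubini for a base point in the cell and a shift in space\<close>

lemma pair_cell_lborel: "pair_sigma_finite (cell_measure P) (lborel :: (real^3) measure)"
  by (simp add: pair_sigma_finite_def sigma_finite_cell_measure sigma_finite_lborel)

lemma sets_cell_pair [measurable_cong]:
  "sets (cell_measure P \<Otimes>\<^sub>M (lborel :: (real^3) measure)) = sets (borel \<Otimes>\<^sub>M borel)"
  by (intro sets_pair_measure_cong) auto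

text \<open>The majorant treats the two points \<open>x\<close> and \<open>x + y\<close> alike. It
  therefore survives the substitution that exchanges them, and its two halves have equal integrals
  by translation invariance.\<close>

lemma nn_integral_cell_dominating:
  fixes w :: "real^3 \<Rightarrow> real"
  assumes [measurable]: "w \<in> borel_measurable borel" and per: "periodic P w"
    and w: "\<And>x. 0 \<le> w x" "integrable (cell_measure P) w"
  shows "(\<integral>\<^sup>+y. (\<integral>\<^sup>+x. ennreal (indicator (cball 0 1) y * (w x + w (x + y))) \<partial>cell_measure P) \<partial>lborel) < \<infinity>"
proof -
  have shift: "(\<integral>\<^sup>+x. ennreal (w (x + y)) \<partial>cell_measure P) = (\<integral>\<^sup>+x. ennreal (w x) \<partial>cell_measure P)" for y
    by (rule nn_integral_cell_shift[of "\<lambda>x. ennreal (w x)"]) (use per in \<open>auto simp: periodic_def\<close>)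
  have "(\<integral>\<^sup>+y. (\<integral>\<^sup>+x. ennreal (indicator (cball 0 1) y * (w x + w (x + y))) \<partial>cell_measure P) \<partial>lborel)
     = (\<integral>\<^sup>+y. indicator (cball 0 1) y * (2 * (\<integral>\<^sup>+x. ennreal (w x) \<partial>cell_measure P)) \<partial>(lborel :: (real^3) measure))"
    by (intro nn_integral_cong) (auto simp: indicator_def w ennreal_plus nn_integral_add shift mult_2)
  also have "\<dots> = emeasure lborel (cball 0 1 :: (real^3) set) * (2 * (\<integral>\<^sup>+x. ennreal (w x) \<partial>cell_measure P))"
    by (subst nn_integral_multc) (simp_all add: borel_measurable_indicator)
  also have "\<dots> < \<infinity>"
    using emeasure_compact_finite[OF compact_cball, of "0::real^3" 1] w
    by (auto simp: ennreal_mult_eq_top_iff less_top[symmetric] nn_integral_eq_integral)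
  finally show ?thesis .
qed

lemma integrable_cell_pair:
  fixes H :: "(real^3) \<times> (real^3) \<Rightarrow> 'b::{banach, second_countable_topology}" and w :: "real^3 \<Rightarrow> real"
  assumes [measurable]: "H \<in> borel_measurable (borel \<Otimes>\<^sub>M borel)" "w \<in> borel_measurable borel" 
    and per: "periodic P w" and w: "\<And>x. 0 \<le> w x" "integrable (cell_measure P) w"
    and bound: "\<And>x y. norm (H (x, y)) \<le> indicator (cball 0 1) y * (w x + w (x + y))"
  shows "integrable (cell_measure P \<Otimes>\<^sub>M lborel) H"
proof -
  interpret pair_sigma_finite "cell_measure P" "lborel :: (real^3) measure" by (rule pair_cell_lborel)
  have [measurable]: "H \<in> borel_measurable (cell_measure P \<Otimes>\<^sub>M lborel)"
    by measurable
  show ?thesis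
  proof (rule integrableI_bounded)
    have "(\<integral>\<^sup>+z. ennreal (norm (H z)) \<partial>(cell_measure P \<Otimes>\<^sub>M lborel))
        = (\<integral>\<^sup>+y. (\<integral>\<^sup>+x. ennreal (norm (H (x, y))) \<partial>cell_measure P) \<partial>lborel)"
      by (subst nn_integral_snd[symmetric]) auto
    also have "\<dots> \<le> (\<integral>\<^sup>+y. (\<integral>\<^sup>+x. ennreal (indicator (cball 0 1) y * (w x + w (x + y))) \<partial>cell_measure P) \<partial>lborel)"
      by (intro nn_integral_mono ennreal_leI bound)
    also have "\<dots> < \<infinity>"
      by (rule nn_integral_cell_dominating) (use assms in auto)
    finally show "(\<integral>\<^sup>+z. ennreal (norm (H z)) \<partial>(cell_measure P \<Otimes>\<^sub>M lborel)) < \<infinity>" .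
  qed simp
qed

lemma
  fixes H :: "real^3 \<Rightarrow> real^3 \<Rightarrow> 'b::{banach, second_countable_topology}"
  assumes "integrable (cell_measure P \<Otimes>\<^sub>M lborel) (\<lambda>(x, y). H x y)"
  shows cell_Fubini: "(\<integral>x. (\<integral>y. H x y \<partial>lborel) \<partial>cell_measure P) = (\<integral>y. (\<integral>x. H x y \<partial>cell_measure P) \<partial>lborel)"
    and cell_pair_integrable_outer: "integrable (cell_measure P) (\<lambda>x. (\<integral>y. H x y \<partial>lborel))"
proof -
  interpret pair_sigma_finite "cell_measure P" "lborel :: (real^3) measure" by (rule pair_cell_lborel)
  show "(\<integral>x. (\<integral>y. H x y \<partial>lborel) \<partial>cell_measure P) = (\<integral>y. (\<integral>x. H x y \<partial>cell_measure P) \<partial>lborel)"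
    using Fubini_integral[of H] assms by simp
  show "integrable (cell_measure P) (\<lambda>x. (\<integral>y. H x y \<partial>lborel))"
    using integrable_fst[OF assms] .
qed

lemma lborel_integral_uminus:
  fixes f :: "real^3 \<Rightarrow> 'b::{banach, second_countable_topology}"
  assumes [measurable]: "f \<in> borel_measurable borel"
  shows "(\<integral>y. f (- y) \<partial>lborel) = (\<integral>y. f y \<partial>lborel)"
proof -
  have "(lborel :: (real^3) measure) = density (distr lborel borel (\<lambda>x. 0 + (-1) *\<^sub>R x)) (\<lambda>_. \<bar>-1::real\<bar> ^ DIM(real^3))"
    by (rule lborel_affine) simp
  then have "(lborel :: (real^3) measure) = distr lborel borel uminus"
    by (simp add: density_1)
  then have "(\<integral>y. f y \<partial>lborel) = (\<integral>y. f y \<partial>distr lborel borel uminus)"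
    by simp
  also have "\<dots> = (\<integral>y. f (- y) \<partial>lborel)"
    by (subst integral_distr) auto
  finally show ?thesis by simp
qed

text \<open>Reflecting \<open>y\<close> and then translating in \<open>x\<close> exchanges the two
  points \<open>x\<close> and \<open>x + y\<close>. This turns evenness of a kernel into symmetry of
  the operator \<open>smear\<close>, and oddness into cancellation.\<close>

lemma cell_integral_flip:
  fixes H :: "real^3 \<Rightarrow> real^3 \<Rightarrow> 'b::{banach, second_countable_topology}" and w :: "real^3 \<Rightarrow> real"
  assumes [measurable]: "(\<lambda>(x, y). H x y) \<in> borel_measurable (borel \<Otimes>\<^sub>M borel)" "w \<in> borel_measurable borel" 
    and per: "periodic P w" and w: "\<And>x. 0 \<le> w x" "integrable (cell_measure P) w"
    and bound: "\<And>x y. norm (H x y) \<le> indicator (cball 0 1) y * (w x + w (x + y))"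
    and perH: "\<And>y. periodic P (\<lambda>x. H x y)"
  shows "(\<integral>x. (\<integral>y. H x y \<partial>lborel) \<partial>cell_measure P) = (\<integral>x. (\<integral>y. H (x + y) (- y) \<partial>lborel) \<partial>cell_measure P)"
proof -
  have 1: "integrable (cell_measure P \<Otimes>\<^sub>M lborel) (\<lambda>(x, y). H x y)"
    by (rule integrable_cell_pair[OF _ _ per w]) (use bound in auto)
  have 2: "integrable (cell_measure P \<Otimes>\<^sub>M lborel) (\<lambda>(x, y). H (x + y) (- y))"
  proof (rule integrable_cell_pair[OF _ _ per w])
    fix x y
    show "norm (case (x, y) of (x, y) \<Rightarrow> H (x + y) (- y)) \<le> indicator (cball 0 1) y * (w x + w (x + y))"
      using bound[of "x + y" "- y"] by (simp add: indicator_def add.commute)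
  qed measurable
  have "(\<integral>x. (\<integral>y. H x y \<partial>lborel) \<partial>cell_measure P) = (\<integral>y. (\<integral>x. H x y \<partial>cell_measure P) \<partial>lborel)"
    by (rule cell_Fubini[OF 1])
  also have "\<dots> = (\<integral>y. (\<integral>x. H x (- y) \<partial>cell_measure P) \<partial>lborel)"
  proof -
    interpret pair_sigma_finite "cell_measure P" "lborel :: (real^3) measure" by (rule pair_cell_lborel)
    have "(\<lambda>y. \<integral>x. H x y \<partial>cell_measure P) \<in> borel_measurable borel"
    proof -
      have "(\<lambda>(y, x). H x y) \<in> borel_measurable (borel \<Otimes>\<^sub>M cell_measure P)"
        by measurable
      from sigma_finite_measure.borel_measurable_lebesgue_integral[OF sigma_finite_cell_measure this]
      show ?thesis by simp
    qed
    from lborel_integral_uminus[OF this] show ?thesis by simp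
  qed
  also have "\<dots> = (\<integral>y. (\<integral>x. H (x + y) (- y) \<partial>cell_measure P) \<partial>lborel)"
    by (intro Bochner_Integration.integral_cong refl integral_cell_shift[symmetric] perH) measurable
  also have "\<dots> = (\<integral>x. (\<integral>y. H (x + y) (- y) \<partial>lborel) \<partial>cell_measure P)"
    by (rule cell_Fubini[OF 2, symmetric])
  finally show ?thesis .
qed


section \<open>Averages against compactly supported kernels\<close>

lemma sets_cball [measurable]: "cball (x::real^3) r \<in> sets borel"
  by (simp add: borel_closed)

definition bounded_kernel :: "real \<Rightarrow> (real^3 \<Rightarrow> real) \<Rightarrow> bool" where
  "bounded_kernel C k \<longleftrightarrow> k \<in> borel_measurable borel \<and> (\<forall>y. \<bar>k y\<bar> \<le> C * indicator (cball 0 1) y)"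

text \<open>A correlation, with \<open>x + y\<close> in place of \<open>x - y\<close>. It agrees
  with convolution for even kernels, and a derivative that is moved to the kernel brings a minus
  sign.\<close>

definition smear :: "(real^3 \<Rightarrow> real) \<Rightarrow> (real^3 \<Rightarrow> real^3) \<Rightarrow> real^3 \<Rightarrow> real^3" where
  "smear k f x = (\<integral>y. k y *\<^sub>R f (x + y) \<partial>lborel)"

abbreviation unit_vol :: real where
  "unit_vol \<equiv> measure lborel (cball (0::real^3) 1)"

lemma bounded_kernel_measurable: "bounded_kernel C k \<Longrightarrow> k \<in> borel_measurable borel"
  by (simp add: bounded_kernel_def)

lemma bounded_kernel_le: "bounded_kernel C k \<Longrightarrow> \<bar>k y\<bar> \<le> C * indicator (cball 0 1) y"
  by (simp add: bounded_kernel_def)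

lemma bounded_kernel_nonneg: "bounded_kernel C k \<Longrightarrow> 0 \<le> C"
  using bounded_kernel_le[of C k 0] by simp

lemma bounded_kernel_integrable:
  assumes k: "bounded_kernel C k"
  shows "integrable lborel k" "integrable lborel (\<lambda>y. (k y)\<^sup>2)" 
    "(\<integral>y. (k y)\<^sup>2 \<partial>lborel) \<le> C\<^sup>2 * unit_vol"
    "(\<integral>y. \<bar>k y\<bar> \<partial>lborel) \<le> C * unit_vol"
proof -
  note [measurable] = bounded_kernel_measurable[OF k]
  have fin: "emeasure lborel (cball (0::real^3) 1) < \<infinity>"
    by (rule emeasure_compact_finite) simp
  then have ind: "integrable lborel (\<lambda>y. c * indicator (cball (0::real^3) 1) y :: real)" for c
    by (intro integrable_mult_right integrable_real_indicator) auto
  show 1: "integrable lborel k"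
    by (rule Bochner_Integration.integrable_bound[OF ind[of C]])
      (use bounded_kernel_le[OF k] bounded_kernel_nonneg[OF k] in \<open>auto simp: abs_mult\<close>)
  have le: "(k y)\<^sup>2 \<le> C\<^sup>2 * indicator (cball 0 1) y" for y
    using power_mono[OF bounded_kernel_le[OF k, of y] abs_ge_zero, of 2] 
    by (auto simp: indicator_def)
  show 2: "integrable lborel (\<lambda>y. (k y)\<^sup>2)"
    by (rule Bochner_Integration.integrable_bound[OF ind[of "C\<^sup>2"]]) (use le in \<open>auto simp: abs_mult\<close>)
  have "(\<integral>y. (k y)\<^sup>2 \<partial>lborel) \<le> (\<integral>y. C\<^sup>2 * indicator (cball (0::real^3) 1) y \<partial>lborel)"
    by (intro integral_mono 2 ind le)
  then show "(\<integral>y. (k y)\<^sup>2 \<partial>lborel) \<le> C\<^sup>2 * unit_vol" by simp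
  have "(\<integral>y. \<bar>k y\<bar> \<partial>lborel) \<le> (\<integral>y. C * indicator (cball (0::real^3) 1) y \<partial>lborel)"
    by (intro integral_mono integrable_abs 1 ind bounded_kernel_le[OF k])
  then show "(\<integral>y. \<bar>k y\<bar> \<partial>lborel) \<le> C * unit_vol" by simp
qed

text \<open>Here pi > 1 enters: a cube of side \<open>2 * pi\<close> has room for the unit ball
  around its centre.\<close>

lemma unit_ball_shift_in_cell:
  assumes "y \<in> cball 0 1"
  shows "y + (\<chi> i. pi) \<in> cell P"
proof -
  have "\<bar>y $ i\<bar> \<le> 1" for i
    using assms component_le_norm_cart[of y i] by simp
  then have "- 1 \<le> y $ i \<and> y $ i \<le> 1" for i by (metis abs_le_D1 abs_le_D2 minus_le_iff)
  moreover have "1 < pi" using pi_gt3 by linarith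
  ultimately show ?thesis
    by (auto simp: cell_def) (smt (verit))+
qed

text \<open>The ball is translated into the cell, so that local integrals, and with them the values
  of \<open>smear\<close>, are controlled by the norm over one period.\<close>

lemma integral_unit_ball_le:
  assumes f: "L2_field P f"
  shows "integrable lborel (\<lambda>y. indicator (cball 0 1) y * (norm (f (x + y)))\<^sup>2)"
    and "(\<integral>y. indicator (cball 0 1) y * (norm (f (x + y)))\<^sup>2 \<partial>lborel) \<le> sq_norm P f"
proof -
  note [measurable] = L2_fieldD(2)[OF f]
  define c :: "real^3" where "c = (\<chi> i. pi)"
  let ?F = "\<lambda>y. ennreal ((norm (f (x + y)))\<^sup>2)"
  have sub: "y + c \<in> cell P" if "y \<in> cball 0 1" for y
    using unit_ball_shift_in_cell[OF that] by (simp add: c_def)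
  have "(\<integral>\<^sup>+y. ennreal (indicator (cball 0 1) y * (norm (f (x + y)))\<^sup>2) \<partial>lborel)
      \<le> (\<integral>\<^sup>+y. indicator (cell P) (y + c) * ?F y \<partial>lborel)"
    by (intro nn_integral_mono) (auto simp: indicator_def sub)
  also have "\<dots> = (\<integral>\<^sup>+y. indicator (cell P) y * ?F (y - c) \<partial>lborel)"
    using nn_integral_lborel_shift[of "\<lambda>y. indicator (cell P) y * ?F (y - c)" c] by simp
  also have "\<dots> = (\<integral>\<^sup>+y. ennreal ((norm (f (y + (x - c))))\<^sup>2) \<partial>cell_measure P)"
    unfolding cell_measure_def by (subst nn_integral_density) (auto simp: algebra_simps)
  also have "\<dots> = ennreal (sq_norm P f)"
    using nn_integral_sq_norm[OF L2_field_shift[OF f]] sq_norm_shift[OF f] by metis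
  finally have le: "(\<integral>\<^sup>+y. ennreal (indicator (cball 0 1) y * (norm (f (x + y)))\<^sup>2) \<partial>lborel) \<le> ennreal (sq_norm P f)" .
  show int: "integrable lborel (\<lambda>y. indicator (cball 0 1) y * (norm (f (x + y)))\<^sup>2)"
    by (rule integrableI_bounded) (use le in \<open>auto simp: abs_mult intro: le_less_trans\<close>)
  show "(\<integral>y. indicator (cball 0 1) y * (norm (f (x + y)))\<^sup>2 \<partial>lborel) \<le> sq_norm P f"
    using le by (subst (asm) nn_integral_eq_integral[OF int]) auto
qed

lemma
  assumes k: "bounded_kernel C k" and f: "L2_field P f"
  shows smear_integrable: "integrable lborel (\<lambda>y. k y *\<^sub>R f (x + y))"
    and norm_smear_le: "norm (smear k f x) \<le> C * sqrt unit_vol * sqrt (sq_norm P f)"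
proof -
  note [measurable] = L2_fieldD(2)[OF f] bounded_kernel_measurable[OF k]
  let ?h = "\<lambda>y. indicator (cball 0 1) y * norm (f (x + y))"
  have h2: "(?h y)\<^sup>2 = indicator (cball 0 1) y * (norm (f (x + y)))\<^sup>2" for y
    by (auto simp: indicator_def)
  have kh: "\<bar>k y\<bar> * norm (f (x + y)) = \<bar>k y * ?h y\<bar>" for y
    using bounded_kernel_le[OF k, of y] by (auto simp: indicator_def abs_mult split: if_splits)
  have "integrable lborel (\<lambda>y. k y * ?h y)"
    using bounded_kernel_integrable[OF k] integral_unit_ball_le[OF f, of x]
    by (intro integrable_mult_square) (auto simp: h2)
  then have int: "integrable lborel (\<lambda>y. \<bar>k y\<bar> * norm (f (x + y)))"
    unfolding kh by (rule integrable_abs)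
  show int': "integrable lborel (\<lambda>y. k y *\<^sub>R f (x + y))"
    by (rule Bochner_Integration.integrable_bound[OF int]) auto
  have C: "0 \<le> C" using bounded_kernel_nonneg[OF k] .
  have "(\<integral>y. \<bar>k y * ?h y\<bar> \<partial>lborel) \<le> sqrt (\<integral>y. (k y)\<^sup>2 \<partial>lborel) * sqrt (\<integral>y. (?h y)\<^sup>2 \<partial>lborel)"
    using bounded_kernel_integrable[OF k] integral_unit_ball_le[OF f, of x]
    by (intro Cauchy_Schwarz_integral) (auto simp: h2)
  also have "\<dots> \<le> sqrt (C\<^sup>2 * unit_vol) * sqrt (sq_norm P f)"
    using bounded_kernel_integrable[OF k] integral_unit_ball_le[OF f, of x]
    by (intro mult_mono) (auto simp: h2)
  also have "\<dots> = C * sqrt unit_vol * sqrt (sq_norm P f)"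
    using C by (simp add: real_sqrt_mult)
  finally have *: "(\<integral>y. \<bar>k y\<bar> * norm (f (x + y)) \<partial>lborel) \<le> C * sqrt unit_vol * sqrt (sq_norm P f)"
    unfolding kh .
  have "norm (smear k f x) \<le> (\<integral>y. \<bar>k y\<bar> * norm (f (x + y)) \<partial>lborel)"
    using integral_norm_bound[of lborel "\<lambda>y. k y *\<^sub>R f (x + y)"] by (simp add: smear_def)
  with * show "norm (smear k f x) \<le> C * sqrt unit_vol * sqrt (sq_norm P f)" by simp
qed

lemma smear_diff:
  assumes "bounded_kernel C k" "L2_field P f" "L2_field P g"
  shows "smear k (\<lambda>x. f x - g x) x = smear k f x - smear k g x"
  using smear_integrable[OF assms(1,2)] smear_integrable[OF assms(1,3)]
  by (simp add: smear_def scaleR_diff_right)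

lemma smear_periodic: "periodic P f \<Longrightarrow> periodic P (smear k f)"
  unfolding periodic_def smear_def by (auto intro!: Bochner_Integration.integral_cong simp: add.assoc add.left_commute)
     (metis add.assoc add.commute)

lemma smear_measurable:
  assumes [measurable]: "k \<in> borel_measurable borel" "f \<in> borel_measurable borel"
  shows "smear k f \<in> borel_measurable borel"
  unfolding smear_def by measurable

text \<open>Minkowski's inequality for averages, from Cauchy-Schwarz after splitting the kernel into
  two square roots. The bound on \<open>F\<close> is required only where the kernel is nonzero; thus
  the lemma serves both Young's inequality, with \<open>F\<close> a shifted field, and approximation
  by mollifiers, with \<open>F\<close> a small increment.\<close>

lemma sq_norm_average_le:
  fixes F :: "real^3 \<Rightarrow> real^3 \<Rightarrow> real^3"
  assumes k: "bounded_kernel C k" 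
    and [measurable]: "(\<lambda>(x, y). F x y) \<in> borel_measurable (borel \<Otimes>\<^sub>M borel)"
    and B: "\<And>y. norm y \<le> 1 \<Longrightarrow> k y \<noteq> 0 \<Longrightarrow> (\<integral>\<^sup>+x. ennreal ((norm (F x y))\<^sup>2) \<partial>cell_measure P) \<le> ennreal B" and "0 \<le> B"
  shows "(\<integral>\<^sup>+x. ennreal ((norm (\<integral>y. k y *\<^sub>R F x y \<partial>lborel))\<^sup>2) \<partial>cell_measure P) \<le> ennreal ((\<integral>y. \<bar>k y\<bar> \<partial>lborel)\<^sup>2 * B)"
proof -
  interpret pair_sigma_finite "cell_measure P" "lborel :: (real^3) measure" by (rule pair_cell_lborel)
  note [measurable] = bounded_kernel_measurable[OF k]
  let ?I = "\<integral>y. \<bar>k y\<bar> \<partial>lborel"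
  have nnI: "(\<integral>\<^sup>+y. ennreal \<bar>k y\<bar> \<partial>lborel) = ennreal ?I"
    using bounded_kernel_integrable(1)[OF k] by (intro nn_integral_eq_integral) auto
  have "ennreal ((norm (\<integral>y. k y *\<^sub>R F x y \<partial>lborel))\<^sup>2) \<le> ennreal ?I * (\<integral>\<^sup>+y. ennreal (\<bar>k y\<bar> * (norm (F x y))\<^sup>2) \<partial>lborel)" for x
  proof -
    have [measurable]: "F x \<in> borel_measurable borel"
      using measurable_compose[of "Pair x" borel "borel \<Otimes>\<^sub>M borel" "\<lambda>(x, y). F x y" borel] by simp
    \<comment> \<open>If the integrand is not integrable, the integral has the default value 0 and
      the bound holds trivially.\<close>
    have "ennreal (norm (\<integral>y. k y *\<^sub>R F x y \<partial>lborel)) \<le> (\<integral>\<^sup>+y. ennreal (norm (k y *\<^sub>R F x y)) \<partial>lborel)"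
      by (cases "integrable lborel (\<lambda>y. k y *\<^sub>R F x y)")
        (auto simp: integral_norm_bound_ennreal not_integrable_integral_eq simp del: norm_scaleR)
    also have "\<dots> = (\<integral>\<^sup>+y. ennreal (sqrt \<bar>k y\<bar>) * ennreal (sqrt \<bar>k y\<bar> * norm (F x y)) \<partial>lborel)"
      by (intro nn_integral_cong) (simp add: ennreal_mult[symmetric] mult.assoc[symmetric])
    finally have "ennreal (norm (\<integral>y. k y *\<^sub>R F x y \<partial>lborel)) ^ 2
       \<le> (\<integral>\<^sup>+y. ennreal (sqrt \<bar>k y\<bar>) * ennreal (sqrt \<bar>k y\<bar> * norm (F x y)) \<partial>lborel) ^ 2"
      by (intro power_mono) auto
    also have "\<dots> \<le> (\<integral>\<^sup>+y. ennreal (sqrt \<bar>k y\<bar>) ^ 2 \<partial>lborel) * (\<integral>\<^sup>+y. ennreal (sqrt \<bar>k y\<bar> * norm (F x y)) ^ 2 \<partial>lborel)"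
      by (rule Cauchy_Schwarz_nn_integral) auto
    also have "\<dots> = ennreal ?I * (\<integral>\<^sup>+y. ennreal (\<bar>k y\<bar> * (norm (F x y))\<^sup>2) \<partial>lborel)"
      by (simp add: ennreal_power power_mult_distrib nnI)
    finally show ?thesis by (simp add: ennreal_power)
  qed
  then have "(\<integral>\<^sup>+x. ennreal ((norm (\<integral>y. k y *\<^sub>R F x y \<partial>lborel))\<^sup>2) \<partial>cell_measure P) 
      \<le> (\<integral>\<^sup>+x. ennreal ?I * (\<integral>\<^sup>+y. ennreal (\<bar>k y\<bar> * (norm (F x y))\<^sup>2) \<partial>lborel) \<partial>cell_measure P)"
    by (intro nn_integral_mono) auto
  also have "\<dots> = ennreal ?I * (\<integral>\<^sup>+x. (\<integral>\<^sup>+y. ennreal (\<bar>k y\<bar> * (norm (F x y))\<^sup>2) \<partial>lborel) \<partial>cell_measure P)"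
    by (intro nn_integral_cmult) measurable
  also have "\<dots> = ennreal ?I * (\<integral>\<^sup>+y. (\<integral>\<^sup>+x. ennreal (\<bar>k y\<bar> * (norm (F x y))\<^sup>2) \<partial>cell_measure P) \<partial>lborel)"
    by (subst Fubini') (auto simp: split_beta')
  also have "\<dots> \<le> ennreal ?I * (\<integral>\<^sup>+y. ennreal \<bar>k y\<bar> * ennreal B \<partial>lborel)"
  proof (intro mult_left_mono nn_integral_mono)
    fix y :: "real^3"
    have [measurable]: "(\<lambda>x. F x y) \<in> borel_measurable borel"
      using measurable_compose[of "\<lambda>x. (x, y)" borel "borel \<Otimes>\<^sub>M borel" "\<lambda>(x, y). F x y" borel] by simp
    have "(\<integral>\<^sup>+x. ennreal (\<bar>k y\<bar> * (norm (F x y))\<^sup>2) \<partial>cell_measure P) = ennreal \<bar>k y\<bar> * (\<integral>\<^sup>+x. ennreal ((norm (F x y))\<^sup>2) \<partial>cell_measure P)"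
      by (simp add: ennreal_mult nn_integral_cmult)
    also have "\<dots> \<le> ennreal \<bar>k y\<bar> * ennreal B"
    proof (cases "k y = 0")
      case False
      then have "norm y \<le> 1" using bounded_kernel_le[OF k, of y] by (cases "norm y \<le> 1") auto
      with False show ?thesis by (intro mult_left_mono B) auto
    qed simp
    finally show "(\<integral>\<^sup>+x. ennreal (\<bar>k y\<bar> * (norm (F x y))\<^sup>2) \<partial>cell_measure P) \<le> ennreal \<bar>k y\<bar> * ennreal B" .
  qed simp
  also have "\<dots> = ennreal (?I\<^sup>2 * B)"
    using \<open>0 \<le> B\<close> by (subst nn_integral_multc) (auto simp: nnI ennreal_mult[symmetric] power2_eq_square mult.assoc)
  finally show ?thesis .
qed

lemma
  assumes k: "bounded_kernel C k" and f: "L2_field P f"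
  shows L2_field_smear: "L2_field P (smear k f)"
    and sq_norm_smear_le: "sq_norm P (smear k f) \<le> (\<integral>y. \<bar>k y\<bar> \<partial>lborel)\<^sup>2 * sq_norm P f"
proof -
  note [measurable] = L2_fieldD(2)[OF f] bounded_kernel_measurable[OF k]
  have m [measurable]: "smear k f \<in> borel_measurable borel"
    by (rule smear_measurable) measurable
  have le: "(\<integral>\<^sup>+x. ennreal ((norm (smear k f x))\<^sup>2) \<partial>cell_measure P) \<le> ennreal ((\<integral>y. \<bar>k y\<bar> \<partial>lborel)\<^sup>2 * sq_norm P f)"
    unfolding smear_def
    by (rule sq_norm_average_le[OF k])
      (use nn_integral_sq_norm[OF L2_field_shift[OF f]] sq_norm_shift[OF f] in auto)
  then have int: "integrable (cell_measure P) (\<lambda>x. (norm (smear k f x))\<^sup>2)"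
    by (intro integrableI_bounded) (auto intro: le_less_trans)
  with m smear_periodic[OF L2_fieldD(1)[OF f]] show L2: "L2_field P (smear k f)"
    by (simp add: L2_field_def)
  show "sq_norm P (smear k f) \<le> (\<integral>y. \<bar>k y\<bar> \<partial>lborel)\<^sup>2 * sq_norm P f"
    using le unfolding nn_integral_sq_norm[OF L2] by (simp add: ennreal_le_iff)
qed

lemma smear_minus_self_tendsto:
  assumes f: "L2_field P f"
    and cont: "((\<lambda>y. sq_norm P (\<lambda>x. f (x + y) - f x)) \<longlongrightarrow> 0) (at 0)"
    and k: "\<And>n. bounded_kernel (C n) (k n)" "\<And>n y. 0 \<le> k n y" "\<And>n. (\<integral>y. k n y \<partial>lborel) = 1"
    and supp: "\<And>n y. k n y \<noteq> 0 \<Longrightarrow> norm y \<le> \<delta> n" "\<delta> \<longlonglongrightarrow> 0"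
  shows "(\<lambda>n. sq_norm P (\<lambda>x. smear (k n) f x - f x)) \<longlonglongrightarrow> 0"
proof (rule LIMSEQ_I)
  fix r :: real assume "0 < r"
  note [measurable] = L2_fieldD(2)[OF f]
  from LIM_D[OF cont, of "r/2"] \<open>0 < r\<close> obtain s where "s > 0"
    and s: "\<And>y. y \<noteq> 0 \<Longrightarrow> norm y < s \<Longrightarrow> sq_norm P (\<lambda>x. f (x + y) - f x) < r / 2" 
    by auto
  then have s: "norm y < s \<Longrightarrow> sq_norm P (\<lambda>x. f (x + y) - f x) \<le> r / 2" for y
    using \<open>0 < r\<close> by (cases "y = 0") (auto simp: sq_norm_def less_imp_le)
  from LIMSEQ_D[OF supp(2) \<open>s > 0\<close>] obtain N where N: "\<And>n. n \<ge> N \<Longrightarrow> \<bar>\<delta> n\<bar> < s" by auto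
  have "sq_norm P (\<lambda>x. smear (k n) f x - f x) \<le> r / 2" if "n \<ge> N" for n
  proof -
    note [measurable] = bounded_kernel_measurable[OF k(1)]
    have L2: "L2_field P (\<lambda>x. smear (k n) f x - f x)"
      by (intro L2_field_diff L2_field_smear[OF k(1)] f)
    have eq: "smear (k n) f x - f x = (\<integral>y. k n y *\<^sub>R (f (x + y) - f x) \<partial>lborel)" for x
      using smear_integrable[OF k(1) f, of n x] bounded_kernel_integrable(1)[OF k(1), of n] k(3)[of n]
      by (simp add: scaleR_diff_right smear_def)
    have abs: "(\<integral>y. \<bar>k n y\<bar> \<partial>lborel) = 1" using k(2,3)[of n] by simp
    have "(\<integral>\<^sup>+x. ennreal ((norm (\<integral>y. k n y *\<^sub>R (f (x + y) - f x) \<partial>lborel))\<^sup>2) \<partial>cell_measure P)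
       \<le> ennreal ((\<integral>y. \<bar>k n y\<bar> \<partial>lborel)\<^sup>2 * (r / 2))"
    proof (rule sq_norm_average_le[OF k(1)])
      fix y assume "k n y \<noteq> 0"
      then have "norm y < s" using supp(1)[of n y] N[OF that] by linarith
      then have "sq_norm P (\<lambda>x. f (x + y) - f x) \<le> r / 2" by (rule s)
      then show "(\<integral>\<^sup>+x. ennreal ((norm (f (x + y) - f x))\<^sup>2) \<partial>cell_measure P) \<le> ennreal (r / 2)"
        using nn_integral_sq_norm[OF L2_field_diff[OF L2_field_shift[OF f] f]] by (simp add: ennreal_leI)
    qed (use \<open>0 < r\<close> in \<open>auto\<close>)
    then show ?thesis
      using nn_integral_sq_norm[OF L2] \<open>0 < r\<close> by (simp add: eq abs)
  qed
  then show "\<exists>no. \<forall>n\<ge>no. norm (sq_norm P (\<lambda>x. smear (k n) f x - f x) - 0) < r"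
    using \<open>0 < r\<close> by (intro exI[of _ N]) fastforce
qed

lemma smear_symmetric:
  assumes k: "bounded_kernel C k" and even: "\<And>y. k (- y) = k y"
    and f: "L2_field P f" and g: "L2_field P g"
  shows "(\<integral>x. f x \<bullet> smear k g x \<partial>cell_measure P) = (\<integral>x. smear k f x \<bullet> g x \<partial>cell_measure P)"
proof -
  note [measurable] = L2_fieldD(2)[OF f] L2_fieldD(2)[OF g] bounded_kernel_measurable[OF k]
  note per = L2_fieldD(1)[OF f] L2_fieldD(1)[OF g]
  let ?w = "\<lambda>x. C * ((norm (f x))\<^sup>2 + (norm (g x))\<^sup>2)"
  have C: "0 \<le> C" using bounded_kernel_nonneg[OF k] .
  have "(\<integral>x. f x \<bullet> smear k g x \<partial>cell_measure P) = (\<integral>x. (\<integral>y. k y * (f x \<bullet> g (x + y)) \<partial>lborel) \<partial>cell_measure P)"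
    using smear_integrable[OF k g] by (simp add: smear_def flip: integral_inner_right inner_scaleR_right)
  also have "\<dots> = (\<integral>x. (\<integral>y. k (- y) * (f (x + y) \<bullet> g (x + y + - y)) \<partial>lborel) \<partial>cell_measure P)"
  proof (rule cell_integral_flip[where w="?w"])
    show "norm (k y * (f x \<bullet> g (x + y))) \<le> indicator (cball 0 1) y * (?w x + ?w (x + y))" for x y
    proof -
      have "2 * (norm (f x) * norm (g (x + y))) \<le> (norm (f x))\<^sup>2 + (norm (g (x + y)))\<^sup>2"
        using sum_squares_ge_zero[of 0 "norm (f x) - norm (g (x + y))"] by (simp add: power2_eq_square algebra_simps)
      moreover have "0 \<le> norm (f x) * norm (g (x + y))" by simp
      ultimately have "norm (f x) * norm (g (x + y)) \<le> (norm (f x))\<^sup>2 + (norm (g (x + y)))\<^sup>2" by linarith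
      moreover have "\<dots> \<le> ((norm (f x))\<^sup>2 + (norm (g x))\<^sup>2) + ((norm (f (x + y)))\<^sup>2 + (norm (g (x + y)))\<^sup>2)"
        by simp
      ultimately have *: "\<bar>f x \<bullet> g (x + y)\<bar> \<le> ((norm (f x))\<^sup>2 + (norm (g x))\<^sup>2) + ((norm (f (x + y)))\<^sup>2 + (norm (g (x + y)))\<^sup>2)"
        using Cauchy_Schwarz_ineq2[of "f x" "g (x + y)"] by linarith
      have "\<bar>k y\<bar> * \<bar>f x \<bullet> g (x + y)\<bar> \<le> (C * indicator (cball 0 1) y) * (((norm (f x))\<^sup>2 + (norm (g x))\<^sup>2) + ((norm (f (x + y)))\<^sup>2 + (norm (g (x + y)))\<^sup>2))"
        using bounded_kernel_le[OF k] C by (intro mult_mono *) auto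
      then show ?thesis by (simp add: abs_mult algebra_simps)
    qed
    show "integrable (cell_measure P) ?w"
      using L2_fieldD(3)[OF f] L2_fieldD(3)[OF g] by simp
    show "periodic P ?w" using per by (simp add: periodic_def)
    show "periodic P (\<lambda>x. k y * (f x \<bullet> g (x + y)))" for y 
      using per periodic_shift[OF per(2), of y] by (simp add: periodic_def)
  qed (use C in auto)
  also have "\<dots> = (\<integral>x. (\<integral>y. (k y *\<^sub>R f (x + y)) \<bullet> g x \<partial>lborel) \<partial>cell_measure P)"
    by (simp add: even)
  also have "\<dots> = (\<integral>x. smear k f x \<bullet> g x \<partial>cell_measure P)"
    using smear_integrable[OF k f] by (simp add: smear_def flip: integral_inner_left)
  finally show ?thesis .
qed


section \<open>Mollification of test fields\<close>

text \<open>\<open>k\<close> is the gradient of \<open>K\<close>, and one constant bounds both.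
  \<open>K_even\<close> gives the symmetry of the mollified energy form, \<open>k_odd\<close> the
  cancellations in the flux.\<close>

locale mollifier =
  fixes K :: "real^3 \<Rightarrow> real" and k :: "real^3 \<Rightarrow> real^3" and C :: real
  assumes K_deriv: "\<And>y. (K has_derivative (\<lambda>h. k y \<bullet> h)) (at y)"
    and k_cont: "continuous_on UNIV k"
    and K_bound: "\<And>y. \<bar>K y\<bar> \<le> C * indicator (cball 0 1) y"
    and k_bound: "\<And>y. norm (k y) \<le> C * indicator (cball 0 1) y"
    and K_even: "\<And>y. K (- y) = K y"
    and k_odd: "\<And>y. k (- y) = - k y"
begin

lemma K_cont: "continuous_on UNIV K"
  by (meson K_deriv has_derivative_continuous continuous_at_imp_continuous_on)

lemma K_measurable [measurable]: "K \<in> borel_measurable borel"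
  by (intro borel_measurable_continuous_onI K_cont)

lemma k_measurable [measurable]: "k \<in> borel_measurable borel"
  by (intro borel_measurable_continuous_onI k_cont)

lemma kernel_K: "bounded_kernel C K"
  by (simp add: bounded_kernel_def K_bound)

lemma kernel_k: "bounded_kernel (C * norm a) (\<lambda>y. k y \<bullet> a)"
proof -
  have "\<bar>k y \<bullet> a\<bar> \<le> C * norm a * indicator (cball 0 1) y" for y
    using Cauchy_Schwarz_ineq2[of "k y" a] mult_right_mono[OF k_bound[of y] norm_ge_zero[of a]]
    by (simp add: mult_ac)
  then show ?thesis by (simp add: bounded_kernel_def)
qed

end

section \<open>Differentiation of mollified fields\<close>

lemma Ck_on_imp_continuous: "Ck_on k S f \<Longrightarrow> continuous_on S f"
  by (cases k) (auto simp: continuous_on_eq_continuous_within intro: has_derivative_continuous)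

lemma lborel_integral_eq_cbox:
  fixes f :: "'a::euclidean_space \<Rightarrow> 'b::euclidean_space"
  assumes "continuous_on UNIV f" "\<And>x. x \<notin> cbox a b \<Longrightarrow> f x = 0"
  shows "(\<integral>x. f x \<partial>lborel) = integral (cbox a b) f"
proof -
  have eq: "indicator (cbox a b) x *\<^sub>R f x = f x" for x
    using assms(2) by (auto simp: indicator_def)
  have "set_integrable lborel (cbox a b) f"
    unfolding set_integrable_def
    by (intro borel_integrable_compact compact_cbox continuous_on_subset[OF assms(1)]) auto
  from set_borel_integral_eq_integral(2)[OF this] show ?thesis
    by (simp add: set_lebesgue_integral_def eq)
qed

lemma cball_subset_cbox: "norm (y::real^3) \<le> r \<Longrightarrow> y \<in> cbox (\<chi> i. -r) (\<chi> i. r)"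
  using component_le_norm_cart[of y] 
  by (auto simp: mem_box_cart) (metis abs_le_D1 abs_le_D2 minus_le_iff order_trans)+

context mollifier
begin

lemma smear_eq_cbox:
  assumes "continuous_on UNIV \<phi>"
  shows "smear K \<phi> x = integral (cbox (\<chi> i. -1) (\<chi> i. 1)) (\<lambda>y. K y *\<^sub>R \<phi> (x + y))"
  unfolding smear_def
proof (rule lborel_integral_eq_cbox)
  show "continuous_on UNIV (\<lambda>y. K y *\<^sub>R \<phi> (x + y))"
    by (intro continuous_intros K_cont continuous_on_compose2[OF assms]) auto
  show "K y *\<^sub>R \<phi> (x + y) = 0" if "y \<notin> cbox (\<chi> i. -1) (\<chi> i. 1)" for y
    using K_bound[of y] cball_subset_cbox[of y 1] that by (cases "norm y \<le> 1") auto
qed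

lemma smear_continuous:
  assumes "continuous_on UNIV \<phi>"
  shows "continuous_on UNIV (smear K \<phi>)"
proof -
  have "continuous_on UNIV (\<lambda>x. integral (cbox (\<chi> i. -1) (\<chi> i. 1)) (\<lambda>y. K y *\<^sub>R \<phi> (x + y)))"
    by (rule integral_continuous_on_param)
      (auto simp: split_beta' intro!: continuous_intros continuous_on_compose2[OF assms] continuous_on_compose2[OF K_cont])
  then show ?thesis by (simp add: smear_eq_cbox[OF assms])
qed

text \<open>The derivative falls on \<open>\<phi>\<close>, so the step can be iterated to any order
  although \<open>K\<close> is only of class C^1.\<close>

lemma smear_has_derivative:
  assumes \<phi>: "\<And>x. (\<phi> has_derivative \<phi>' x) (at x)" and cont: "\<And>v. continuous_on UNIV (\<lambda>x. \<phi>' x v)"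
  shows "(smear K \<phi> has_derivative (\<lambda>v. smear K (\<lambda>x. \<phi>' x v) x)) (at x)"
proof -
  let ?B = "cbox (\<chi> i. -1) (\<chi> i. 1) :: (real^3) set"
  have lin: "bounded_linear (\<phi>' x)" for x using \<phi> by (rule has_derivative_bounded_linear)
  have c\<phi>: "continuous_on UNIV \<phi>"
    by (meson \<phi> has_derivative_continuous continuous_at_imp_continuous_on)
  \<comment> \<open>\<open>leibniz_rule\<close> expects a continuous family of bounded linear maps;
    in finite dimension continuity in each direction is enough.\<close>
  define D where "D x = Blinfun (\<phi>' x)" for x
  have D: "blinfun_apply (D x) = \<phi>' x" for x
    unfolding D_def by (rule bounded_linear_Blinfun_apply[OF lin])
  have cD: "continuous_on UNIV D"
    by (rule continuous_on_blinfun_componentwise) (simp add: D cont)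
  have "((\<lambda>x. integral ?B (\<lambda>y. K y *\<^sub>R \<phi> (x + y))) has_derivative integral ?B (\<lambda>y. K y *\<^sub>R D (x + y))) (at x within UNIV)"
  proof (rule leibniz_rule)
    fix z y :: "real^3"
    have "((\<lambda>x. x + y) has_derivative (\<lambda>h. h)) (at z)"
      by (auto intro!: derivative_eq_intros)
    from has_derivative_compose[OF this \<phi>[of "z + y"]]
    have "((\<lambda>x. \<phi> (x + y)) has_derivative \<phi>' (z + y)) (at z)" .
    from has_derivative_scaleR_right[OF this, of "K y"]
    show "((\<lambda>x. K y *\<^sub>R \<phi> (x + y)) has_derivative blinfun_apply (K y *\<^sub>R D (z + y))) (at z within UNIV)"
      by (simp add: D scaleR_blinfun.rep_eq)
    show "(\<lambda>y. K y *\<^sub>R \<phi> (z + y)) integrable_on ?B"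
      by (intro integrable_continuous continuous_intros continuous_on_subset[OF K_cont] continuous_on_compose2[OF c\<phi>]) auto
  next
    show "continuous_on (UNIV \<times> ?B) (\<lambda>(x, y). K y *\<^sub>R D (x + y))"
      by (auto simp: split_beta' intro!: continuous_intros continuous_on_compose2[OF cD] continuous_on_compose2[OF K_cont])
  qed auto
  moreover have "blinfun_apply (integral ?B (\<lambda>y. K y *\<^sub>R D (x + y))) v = smear K (\<lambda>x. \<phi>' x v) x" for v
  proof -
    have "(\<lambda>y. K y *\<^sub>R D (x + y)) integrable_on ?B"
      by (intro integrable_continuous continuous_intros continuous_on_subset[OF K_cont] continuous_on_compose2[OF cD]) auto
    then show ?thesis
      by (subst blinfun_apply_integral) (auto simp: smear_eq_cbox[OF cont] D scaleR_blinfun.rep_eq)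
  qed
  then have "blinfun_apply (integral ?B (\<lambda>y. K y *\<^sub>R D (x + y))) = (\<lambda>v. smear K (\<lambda>x. \<phi>' x v) x)" by blast
  moreover have "smear K \<phi> = (\<lambda>x. integral ?B (\<lambda>y. K y *\<^sub>R \<phi> (x + y)))"
    by (rule ext) (rule smear_eq_cbox[OF c\<phi>])
  ultimately show ?thesis by simp
qed

text \<open>Integration by parts: \<open>smear K \<phi>\<close> is differentiated along
  \<open>v\<close> in two ways, with the shift acting on \<open>\<phi>\<close> and with the shift
  moved to the kernel by a change of variables. Uniqueness of the derivative equates the
  results.\<close>

lemma smear_has_derivative_kernel:
  assumes \<phi>: "\<And>x. (\<phi> has_derivative \<phi>' x) (at x)" and cont: "\<And>v. continuous_on UNIV (\<lambda>x. \<phi>' x v)"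
  shows "smear K (\<lambda>x. \<phi>' x v) x = - smear (\<lambda>y. k y \<bullet> v) \<phi> x"
proof -
  \<comment> \<open>For \<open>\<bar>s\<bar> < r\<close> the vector \<open>s *\<^sub>R v\<close>
    stays in the unit ball, so all the shifted kernels are supported in the fixed box
    \<open>?B\<close> of half side 2.\<close>
  define r where "r = 1 / (norm v + 1)"
  have r: "0 < r" by (simp add: r_def add_nonneg_pos)
  have rv: "norm (s *\<^sub>R v) \<le> 1" if "\<bar>s\<bar> < r" for s
  proof -
    have "\<bar>s\<bar> * norm v \<le> r * norm v" using that by (intro mult_right_mono) auto
    also have "\<dots> \<le> 1" by (simp add: r_def divide_simps add_nonneg_pos)
    finally show ?thesis by simp
  qed
  let ?B = "cbox (\<chi> i. -2) (\<chi> i. 2) :: (real^3) set"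
  let ?U = "{-r<..<r}"
  have c\<phi>: "continuous_on UNIV \<phi>"
    by (meson \<phi> has_derivative_continuous continuous_at_imp_continuous_on)
  have m\<phi>[measurable]: "\<phi> \<in> borel_measurable borel" by (intro borel_measurable_continuous_onI c\<phi>)
  have out: "1 < norm (y - s *\<^sub>R v)" if "y \<notin> ?B" "\<bar>s\<bar> < r" for y s
  proof -
    have "2 < norm y" using that(1) cball_subset_cbox[of y 2] by force
    then show ?thesis using rv[OF that(2)] norm_triangle_ineq2[of y "s *\<^sub>R v"] by linarith
  qed
  have K0: "K y = 0" "k y = 0" if "1 < norm y" for y
    using K_bound[of y] k_bound[of y] that by auto
  have eq: "smear K \<phi> (x + s *\<^sub>R v) = integral ?B (\<lambda>y. K (y - s *\<^sub>R v) *\<^sub>R \<phi> (x + y))" if "s \<in> ?U" for s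
  proof -
    have "smear K \<phi> (x + s *\<^sub>R v) = (\<integral>y. K (y - s *\<^sub>R v) *\<^sub>R \<phi> (x + y) \<partial>distr lborel borel ((+) (s *\<^sub>R v)))"
      unfolding smear_def by (subst integral_distr) (auto simp: algebra_simps)
    also have "\<dots> = (\<integral>y. K (y - s *\<^sub>R v) *\<^sub>R \<phi> (x + y) \<partial>lborel)"
      by (simp add: lborel_distr_plus)
    also have "\<dots> = integral ?B (\<lambda>y. K (y - s *\<^sub>R v) *\<^sub>R \<phi> (x + y))"
      using that K0 out[of _ s]
      by (intro lborel_integral_eq_cbox continuous_intros continuous_on_compose2[OF K_cont] continuous_on_compose2[OF c\<phi>])
        (auto simp: abs_less_iff)
    finally show ?thesis .
  qed
  have "((\<lambda>s. integral ?B (\<lambda>y. K (y - s *\<^sub>R v) *\<^sub>R \<phi> (x + y))) has_vector_derivative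
      integral ?B (\<lambda>y. - (k (y - 0 *\<^sub>R v) \<bullet> v) *\<^sub>R \<phi> (x + y))) (at 0 within ?U)"
  proof (rule leibniz_rule_vector_derivative)
    fix s :: real and y :: "real^3"
    have "((\<lambda>s. K (y - s *\<^sub>R v)) has_derivative (\<lambda>h. k (y - s *\<^sub>R v) \<bullet> (- (h *\<^sub>R v)))) (at s)"
      by (rule has_derivative_compose[where g=K and f="\<lambda>s. y - s *\<^sub>R v", OF _ K_deriv]) (auto intro!: derivative_eq_intros)
    then have "((\<lambda>s. K (y - s *\<^sub>R v)) has_vector_derivative - (k (y - s *\<^sub>R v) \<bullet> v)) (at s)"
      by (simp add: has_vector_derivative_def mult.commute)
    from has_vector_derivative_scaleR[OF this[unfolded has_real_derivative_iff_has_vector_derivative[symmetric]] has_vector_derivative_const, of "\<phi> (x + y)"]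
    show "((\<lambda>s. K (y - s *\<^sub>R v) *\<^sub>R \<phi> (x + y)) has_vector_derivative - (k (y - s *\<^sub>R v) \<bullet> v) *\<^sub>R \<phi> (x + y)) (at s within ?U)"
      by (auto intro: has_vector_derivative_at_within)
    show "(\<lambda>y. K (y - s *\<^sub>R v) *\<^sub>R \<phi> (x + y)) integrable_on ?B"
      by (intro integrable_continuous continuous_intros continuous_on_compose2[OF K_cont] continuous_on_compose2[OF c\<phi>]) auto
  next
    show "continuous_on (?U \<times> ?B) (\<lambda>(s, y). - (k (y - s *\<^sub>R v) \<bullet> v) *\<^sub>R \<phi> (x + y))"
      by (auto simp: split_beta' intro!: continuous_intros continuous_on_compose2[OF c\<phi>] continuous_on_compose2[OF k_cont])
  qed (use r in auto)
  also have "integral ?B (\<lambda>y. - (k (y - 0 *\<^sub>R v) \<bullet> v) *\<^sub>R \<phi> (x + y)) = (\<integral>y. - (k (y - 0 *\<^sub>R v) \<bullet> v) *\<^sub>R \<phi> (x + y) \<partial>lborel)"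
    using out[of _ 0] K0 r
    by (intro lborel_integral_eq_cbox[symmetric] continuous_intros continuous_on_compose2[OF k_cont] continuous_on_compose2[OF c\<phi>]) auto
  also have "\<dots> = - smear (\<lambda>y. k y \<bullet> v) \<phi> x"
    by (simp add: smear_def)
  finally have "((\<lambda>s. smear K \<phi> (x + s *\<^sub>R v)) has_vector_derivative - smear (\<lambda>y. k y \<bullet> v) \<phi> x) (at 0 within ?U)"
    by (rule has_vector_derivative_transform[rotated 2]) (use r eq in auto)
  then have 1: "((\<lambda>s. smear K \<phi> (x + s *\<^sub>R v)) has_vector_derivative - smear (\<lambda>y. k y \<bullet> v) \<phi> x) (at 0)"
    using r at_within_open[of 0 ?U] by auto
  have "((\<lambda>s. smear K \<phi> (x + s *\<^sub>R v)) has_derivative (\<lambda>h. smear K (\<lambda>x. \<phi>' x (h *\<^sub>R v)) x)) (at 0)"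
    using smear_has_derivative[OF \<phi> cont]
    by (intro has_derivative_compose[where g="smear K \<phi>" and f="\<lambda>s. x + s *\<^sub>R v"]) (auto intro!: derivative_eq_intros)
  moreover have "smear K (\<lambda>x. \<phi>' x (h *\<^sub>R v)) x = h *\<^sub>R smear K (\<lambda>x. \<phi>' x v) x" for h
    using linear_scale[OF has_derivative_linear[OF \<phi>]] 
    by (simp add: smear_def mult.commute flip: integral_scaleR_right)
  ultimately have 2: "((\<lambda>s. smear K \<phi> (x + s *\<^sub>R v)) has_vector_derivative smear K (\<lambda>x. \<phi>' x v) x) (at 0)"
    by (simp add: has_vector_derivative_def)
  show ?thesis by (rule vector_derivative_unique_at[OF 2 1])
qed

lemma Ck_on_smear: "Ck_on n UNIV \<phi> \<Longrightarrow> Ck_on n UNIV (smear K \<phi>)"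
proof (induction n arbitrary: \<phi>)
  case 0 then show ?case by (simp add: smear_continuous)
next
  case (Suc n)
  then obtain \<phi>' where \<phi>': "\<And>x. (\<phi> has_derivative \<phi>' x) (at x)" "\<And>v. Ck_on n UNIV (\<lambda>x. \<phi>' x v)" by auto
  have "continuous_on UNIV (\<lambda>x. \<phi>' x v)" for v using Ck_on_imp_continuous[OF \<phi>'(2)] .
  from smear_has_derivative[OF \<phi>'(1) this] Suc.IH[OF \<phi>'(2)]
  show ?case by (auto intro!: exI[of _ "\<lambda>x v. smear K (\<lambda>x. \<phi>' x v) x"])
qed

end

text \<open>\<open>smooth_on\<close> provides a derivative for each order separately. By uniqueness
  they all coincide with \<open>frechet_derivative\<close>, which is therefore smooth
  itself.\<close>

lemma smooth_on_UNIV_derivative: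
  fixes f :: "real^3 \<Rightarrow> 'b::real_normed_vector"
  assumes "smooth_on UNIV f"
  shows "(f has_derivative frechet_derivative f (at x)) (at x)" 
    and "smooth_on UNIV (\<lambda>x. frechet_derivative f (at x) v)"
    and "continuous_on UNIV (\<lambda>x. frechet_derivative f (at x) v)"
proof -
  have 1: "\<exists>f'. (\<forall>x. (f has_derivative f' x) (at x)) \<and> (\<forall>v. Ck_on k UNIV (\<lambda>x. f' x v))" for k
    using assms[unfolded smooth_on_def, rule_format, of "Suc k"] by simp
  have eq: "f' = (\<lambda>x. frechet_derivative f (at x))" if "\<forall>x. (f has_derivative f' x) (at x)" for f'
    using that frechet_derivative_at by blast
  show "(f has_derivative frechet_derivative f (at x)) (at x)" using 1 eq by metis
  show s: "smooth_on UNIV (\<lambda>x. frechet_derivative f (at x) v)"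
    unfolding smooth_on_def using 1 eq by metis
  show "continuous_on UNIV (\<lambda>x. frechet_derivative f (at x) v)"
    using s Ck_on_imp_continuous unfolding smooth_on_def by blast
qed

lemma smooth_on_UNIV_continuous: "smooth_on UNIV f \<Longrightarrow> continuous_on UNIV f"
  using Ck_on_imp_continuous unfolding smooth_on_def by blast

section \<open>Test fields: derivatives, bounds, mollification and integrability\<close>

lemma unbounded_part_add: "unbounded_part P (x + y) = unbounded_part P x + unbounded_part P y"
  by (auto simp: unbounded_part_def vec_eq_iff)

lemma norm_unbounded_part_le: "norm (unbounded_part P x) \<le> norm x"
  by (rule norm_le_componentwise_cart) (auto simp: unbounded_part_def)

lemma continuous_unbounded_part: "continuous_on UNIV (unbounded_part P)"
proof -
  have "bounded_linear (unbounded_part P)"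
    by (rule bounded_linear_intro[where K=1])
      (auto simp: unbounded_part_add norm_unbounded_part_le, auto simp: unbounded_part_def vec_eq_iff)
  then show ?thesis by (rule linear_continuous_on)
qed

lemma test_fields_derivative:
  assumes "\<phi> \<in> test_fields P"
  shows "(\<lambda>x. frechet_derivative \<phi> (at x) v) \<in> test_fields P"
proof -
  from assms obtain R where per: "periodic P \<phi>" and s: "smooth_on UNIV \<phi>"
    and R: "\<And>x. norm (unbounded_part P x) > R \<Longrightarrow> \<phi> x = 0" by (auto simp: test_fields_def)
  note d = smooth_on_UNIV_derivative(1)[OF s]
  have "frechet_derivative \<phi> (at (x + axis i (2 * pi))) = frechet_derivative \<phi> (at x)" if "i \<in> P" for i x
  proof -
    have "((\<lambda>x. x + axis i (2 * pi)) has_derivative (\<lambda>h. h)) (at x)"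
      by (auto intro!: derivative_eq_intros)
    from has_derivative_compose[OF this d] have "(\<phi> has_derivative frechet_derivative \<phi> (at (x + axis i (2 * pi)))) (at x)"
      using per that by (simp add: periodic_def)
    then show ?thesis using frechet_derivative_at by metis
  qed
  moreover have "frechet_derivative \<phi> (at x) v = 0" if "norm (unbounded_part P x) > R" for x
  proof -
    have "open {x. norm (unbounded_part P x) > R}"
      by (intro open_Collect_less continuous_intros continuous_unbounded_part)
    moreover have "((\<lambda>_. 0) has_derivative (\<lambda>_. 0)) (at x)" by simp
    ultimately have "(\<phi> has_derivative (\<lambda>_. 0)) (at x)"
      using that R by (elim has_derivative_transform_within_open[rotated 1]) auto
    then show ?thesis using frechet_derivative_at by metis
  qed
  ultimately show ?thesis
    using smooth_on_UNIV_derivative(2)[OF s] by (auto simp: test_fields_def periodic_def)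
qed

text \<open>Reduction modulo the lattice moves every point at which the field can be nonzero into
  one compact box.\<close>

lemma test_fields_bounded:
  assumes "\<phi> \<in> test_fields P"
  obtains B R where "\<And>x. norm (\<phi> x) \<le> B" "0 \<le> B" "0 \<le> R" "\<And>x. norm (unbounded_part P x) > R \<Longrightarrow> \<phi> x = 0"
proof -
  from assms obtain R0 where per: "periodic P \<phi>" and s: "smooth_on UNIV \<phi>"
    and R0: "\<And>x. norm (unbounded_part P x) > R0 \<Longrightarrow> \<phi> x = 0" by (auto simp: test_fields_def)
  define R where "R = max R0 0"
  let ?S = "cbox (\<chi> i. - R) (\<chi> i. max R (2 * pi)) :: (real^3) set"
  obtain B where B: "B \<ge> 0" "\<And>x. x \<in> ?S \<Longrightarrow> norm (\<phi> x) \<le> B"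
    by (rule continuous_on_compact_bound[OF compact_cbox continuous_on_subset[OF smooth_on_UNIV_continuous[OF s]]]) auto
  have "norm (\<phi> x) \<le> B" for x
  proof (cases "norm (unbounded_part P x) > R0")
    case False
    have "reduce P x \<in> ?S"
    proof -
      have "- R \<le> reduce P x $ i \<and> reduce P x $ i \<le> max R (2 * pi)" for i
      proof (cases "i \<in> P")
        case True
        then show ?thesis using reduce_in_cell[of P x] by (auto simp: cell_def R_def)
      next
        case iP: False
        then have "\<bar>reduce P x $ i\<bar> = \<bar>unbounded_part P x $ i\<bar>" by (simp add: unbounded_part_def reduce_def)
        also have "\<dots> \<le> R" using False component_le_norm_cart[of "unbounded_part P x" i] by (simp add: R_def)
        finally show ?thesis by linarith
      qed
      then show ?thesis by (simp add: mem_box_cart)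
    qed
    then show ?thesis using B(2)[of "reduce P x"] periodic_reduce[OF per] by simp
  qed (use R0 B in auto)
  then show thesis using that[of B R] B(1) R0 by (simp add: R_def)
qed

lemma test_fields_subset_Schwartz: "test_fields P \<subseteq> Schwartz P"
proof
  fix \<phi> assume \<phi>: "\<phi> \<in> test_fields P"
  have p: "partial_deriv i \<psi> \<in> test_fields P" if "\<psi> \<in> test_fields P" for i and \<psi> :: "real^3 \<Rightarrow> real^3"
    using test_fields_derivative[OF that] by (simp add: partial_deriv_def[abs_def])
  have pn: "(partial_deriv i ^^ n) \<psi> \<in> test_fields P" if "\<psi> \<in> test_fields P" for i n and \<psi> :: "real^3 \<Rightarrow> real^3"
    using that by (induction n) (auto intro: p)
  have "\<exists>C. \<forall>x. norm (multi_deriv \<alpha> \<phi> x) * norm (unbounded_part P x) ^ k \<le> C" for \<alpha> k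
  proof -
    have "multi_deriv \<alpha> \<phi> \<in> test_fields P" unfolding multi_deriv_def by (intro pn \<phi>)
    then obtain B R where B: "\<And>x. norm (multi_deriv \<alpha> \<phi> x) \<le> B" "0 \<le> B" "0 \<le> R" 
      "\<And>x. norm (unbounded_part P x) > R \<Longrightarrow> multi_deriv \<alpha> \<phi> x = 0" by (rule test_fields_bounded) blast
    have "norm (multi_deriv \<alpha> \<phi> x) * norm (unbounded_part P x) ^ k \<le> B * R ^ k" for x
    proof (cases "norm (unbounded_part P x) > R")
      case False then show ?thesis using B by (intro mult_mono power_mono) auto
    qed (use B in auto)
    then show ?thesis by blast
  qed
  then show "\<phi> \<in> Schwartz P" using \<phi> by (auto simp: Schwartz_def test_fields_def)
qed

text \<open>\<open>Ck_on\<close> asks for some derivative within the set, so the spatial derivative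
  composed with \<open>fst\<close> serves at every time, end points included.\<close>

lemma Ck_on_time_independent:
  fixes f :: "real^3 \<Rightarrow> 'b::real_normed_vector"
  shows "Ck_on k UNIV f \<Longrightarrow> Ck_on k (UNIV \<times> (S :: real set)) (\<lambda>(x, t). f x)"
proof (induction k arbitrary: f)
  case 0
  then show ?case by (auto simp: split_beta' intro!: continuous_on_compose2[of UNIV f] continuous_intros)
next
  case (Suc k)
  then obtain f' where f': "\<And>x. (f has_derivative f' x) (at x)" "\<And>v. Ck_on k UNIV (\<lambda>x. f' x v)" by auto
  have "((\<lambda>(x, t). f x) has_derivative (\<lambda>h. f' (fst z) (fst h))) (at z within UNIV \<times> S)" for z
    unfolding split_beta'
    by (rule has_derivative_compose[where f=fst and g=f, OF _ f'(1)]) (auto intro!: derivative_eq_intros)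
  moreover have "Ck_on k (UNIV \<times> S) (\<lambda>z. f' (fst z) (fst v))" for v
    using Suc.IH[OF f'(2), of "fst v"] by (simp add: split_beta')
  ultimately show ?case by (auto intro!: exI[of _ "\<lambda>z h. f' (fst z) (fst h)"])
qed

lemma test_fields_time_independent:
  assumes "\<phi> \<in> test_fields_sigma P"
  shows "(\<lambda>_. \<phi>) \<in> Schwartz_sigma_T P T"
  using assms test_fields_subset_Schwartz[of P]
  by (auto simp: Schwartz_sigma_T_def Schwartz_sigma_def test_fields_sigma_def smooth_on_def test_fields_def
      intro!: Ck_on_time_independent)

lemma (in mollifier) smear_test_fields:
  assumes "\<phi> \<in> test_fields P"
  shows "smear K \<phi> \<in> test_fields P"
proof -
  from assms obtain R where per: "periodic P \<phi>" and s: "smooth_on UNIV \<phi>"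
    and R: "\<And>x. norm (unbounded_part P x) > R \<Longrightarrow> \<phi> x = 0" by (auto simp: test_fields_def)
  have "smear K \<phi> x = 0" if x: "norm (unbounded_part P x) > R + 1" for x
  proof -
    have "K y *\<^sub>R \<phi> (x + y) = 0" for y
    proof (cases "norm y \<le> 1")
      case True
      then have "norm (unbounded_part P (x + y)) > R"
        using x norm_unbounded_part_le[of P y] norm_triangle_ineq2[of "unbounded_part P x" "- unbounded_part P y"] 
        by (simp add: unbounded_part_add)
      then show ?thesis using R by simp
    next
      case False then show ?thesis using K_bound[of y] by auto
    qed
    then have "(\<lambda>y. K y *\<^sub>R \<phi> (x + y)) = (\<lambda>y. 0)" by blast
    then show ?thesis by (simp only: smear_def) simp
  qed
  moreover have "smooth_on UNIV (smear K \<phi>)"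
    using s Ck_on_smear by (simp add: smooth_on_def)
  ultimately show ?thesis using smear_periodic[OF per] by (auto simp: test_fields_def)
qed

lemma (in mollifier) frechet_derivative_smear:
  assumes s: "smooth_on UNIV \<phi>"
  shows "frechet_derivative (smear K \<phi>) (at x) v = smear K (\<lambda>x. frechet_derivative \<phi> (at x) v) x"
    and "frechet_derivative (smear K \<phi>) (at x) v = - smear (\<lambda>y. k y \<bullet> v) \<phi> x"
proof -
  show 1: "frechet_derivative (smear K \<phi>) (at x) v = smear K (\<lambda>x. frechet_derivative \<phi> (at x) v) x"
    using frechet_derivative_at[OF smear_has_derivative[OF smooth_on_UNIV_derivative(1,3)[OF s]]] by metis
  show "frechet_derivative (smear K \<phi>) (at x) v = - smear (\<lambda>y. k y \<bullet> v) \<phi> x"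
    unfolding 1 by (rule smear_has_derivative_kernel[OF smooth_on_UNIV_derivative(1,3)[OF s]])
qed

lemma test_fields_L2:
  assumes "\<phi> \<in> test_fields P"
  shows "L2_field P \<phi>" and "integrable (cell_measure P) (\<lambda>x. norm (\<phi> x))"
    and "((\<lambda>y. sq_norm P (\<lambda>x. \<phi> (x + y) - \<phi> x)) \<longlongrightarrow> 0) (at 0)"
proof -
  from assms have per: "periodic P \<phi>" and s: "smooth_on UNIV \<phi>" by (auto simp: test_fields_def)
  note cont = smooth_on_UNIV_continuous[OF s]
  from test_fields_bounded[OF assms] obtain B R where B: "\<And>x. norm (\<phi> x) \<le> B" "0 \<le> B" "0 \<le> R" 
      "\<And>x. norm (unbounded_part P x) > R \<Longrightarrow> \<phi> x = 0" by blast
  have m[measurable]: "\<phi> \<in> borel_measurable borel"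
    by (intro borel_measurable_continuous_onI cont)
  \<comment> \<open>Enlarged by 1 so that, for shifts shorter than 1, the box also contains the
    points of the cell at which only the shifted field is nonzero.\<close>
  let ?S = "cbox (\<chi> i. - (R + 1)) (\<chi> i. max (R + 1) (2 * pi)) :: (real^3) set"
  have S: "x \<in> ?S" if "x \<in> cell P" "norm (unbounded_part P x) \<le> R + 1" for x
  proof -
    have "- (R + 1) \<le> x $ i \<and> x $ i \<le> max (R + 1) (2 * pi)" for i
    proof (cases "i \<in> P")
      case True
      then show ?thesis using that B(3) by (auto simp: cell_def)
    next
      case iP: False
      then have "\<bar>x $ i\<bar> = \<bar>unbounded_part P x $ i\<bar>" by (simp add: unbounded_part_def)
      also have "\<dots> \<le> R + 1" using that component_le_norm_cart[of "unbounded_part P x" i] by linarith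
      finally show ?thesis by linarith
    qed
    then show ?thesis by (simp add: mem_box_cart)
  qed
  have intS: "integrable (cell_measure P) (\<lambda>x. c * indicator ?S x :: real)" for c
  proof -
    have "emeasure (cell_measure P) ?S \<le> emeasure lborel ?S"
    proof -
      have "emeasure (cell_measure P) ?S = (\<integral>\<^sup>+x. indicator (cell P) x * indicator ?S x \<partial>lborel)"
        unfolding cell_measure_def by (rule emeasure_density) auto
      also have "\<dots> \<le> (\<integral>\<^sup>+x. indicator ?S x \<partial>lborel)"
        by (intro nn_integral_mono) (auto simp: indicator_def)
      also have "\<dots> = emeasure lborel ?S" by (rule nn_integral_indicator) simp
      finally show ?thesis .
    qed
    also have "\<dots> < \<infinity>" by (rule emeasure_compact_finite) simp
    finally show ?thesis by (intro integrable_mult_right integrable_real_indicator) auto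
  qed
  have AE_cell: "AE x in cell_measure P. x \<in> cell P"
    unfolding cell_measure_def by (subst AE_density) (auto simp: indicator_def)
  have bound: "AE x in cell_measure P. norm ((norm (\<phi> (x + y) - \<phi> x))\<^sup>2) \<le> (2 * B)\<^sup>2 * indicator ?S x" if "norm y < 1" for y
    using AE_cell
  proof eventually_elim
    case (elim x)
    show ?case
    proof (cases "norm (unbounded_part P x) \<le> R + 1")
      case True
      have "norm (\<phi> (x + y) - \<phi> x) \<le> 2 * B" using norm_triangle_ineq4[of "\<phi> (x + y)" "\<phi> x"] B(1)[of x] B(1)[of "x + y"] by linarith
      then have "(norm (\<phi> (x + y) - \<phi> x))\<^sup>2 \<le> (2 * B)\<^sup>2" by (intro power_mono) auto
      then show ?thesis using S[OF elim True] by simp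
    next
      case False
      then have "norm (unbounded_part P (x + y)) > R"
        using that norm_unbounded_part_le[of P y] norm_triangle_ineq2[of "unbounded_part P x" "- unbounded_part P y"] 
        by (simp add: unbounded_part_add)
      with False B(4)[of x] B(4)[of "x + y"] show ?thesis by (simp add: indicator_def)
    qed
  qed
  have "integrable (cell_measure P) (\<lambda>x. (norm (\<phi> x))\<^sup>2)"
  proof (rule Bochner_Integration.integrable_bound[OF intS[of "B\<^sup>2"]])
    show "AE x in cell_measure P. norm ((norm (\<phi> x))\<^sup>2) \<le> norm (B\<^sup>2 * indicator ?S x)"
      using AE_cell
    proof eventually_elim
      case (elim x)
      show ?case
        using S[OF elim] B(1)[of x] B(4)[of x]
        by (cases "norm (unbounded_part P x) \<le> R + 1") (auto intro!: power_mono simp: abs_mult)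
    qed
  qed simp
  then show "L2_field P \<phi>" using per by (simp add: L2_field_def)
  show "integrable (cell_measure P) (\<lambda>x. norm (\<phi> x))"
  proof (rule Bochner_Integration.integrable_bound[OF intS[of B]])
    show "AE x in cell_measure P. norm (norm (\<phi> x)) \<le> norm (B * indicator ?S x)"
      using AE_cell
    proof eventually_elim
      case (elim x)
      show ?case
        using S[OF elim] B(1)[of x] B(2) B(4)[of x]
        by (cases "norm (unbounded_part P x) \<le> R + 1") auto
    qed
  qed simp
  show "((\<lambda>y. sq_norm P (\<lambda>x. \<phi> (x + y) - \<phi> x)) \<longlongrightarrow> 0) (at 0)"
    unfolding tendsto_at_iff_sequentially comp_def
  proof (intro allI impI)
    fix Y :: "nat \<Rightarrow> real^3" assume Y: "Y \<longlonglongrightarrow> 0"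
    then obtain N where "\<And>n. n \<ge> N \<Longrightarrow> norm (Y n) < 1"
      using LIMSEQ_D[OF Y, of 1] by auto
    then have N: "norm (Y (n + N)) < 1" for n by simp
    have "(\<lambda>n. \<integral>x. (norm (\<phi> (x + Y (n + N)) - \<phi> x))\<^sup>2 \<partial>cell_measure P) \<longlonglongrightarrow> (\<integral>x. 0 \<partial>cell_measure P)"
    proof (rule integral_dominated_convergence[OF _ _ intS[of "(2 * B)\<^sup>2"]])
      show "AE x in cell_measure P. (\<lambda>n. (norm (\<phi> (x + Y (n + N)) - \<phi> x))\<^sup>2) \<longlonglongrightarrow> 0"
      proof (rule AE_I2)
        fix x
        have "(\<lambda>n. x + Y (n + N)) \<longlonglongrightarrow> x + 0"
          by (intro tendsto_intros LIMSEQ_ignore_initial_segment Y)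
        then have "(\<lambda>n. \<phi> (x + Y (n + N))) \<longlonglongrightarrow> \<phi> x"
          using continuous_on_tendsto_compose[OF cont, of "\<lambda>n. x + Y (n + N)" x sequentially] by simp
        then have "(\<lambda>n. (norm (\<phi> (x + Y (n + N)) - \<phi> x))\<^sup>2) \<longlonglongrightarrow> (norm (\<phi> x - \<phi> x))\<^sup>2"
          by (intro tendsto_intros)
        then show "(\<lambda>n. (norm (\<phi> (x + Y (n + N)) - \<phi> x))\<^sup>2) \<longlonglongrightarrow> 0" by simp
      qed
    qed (use bound[OF N] in auto)
    then show "(\<lambda>n. sq_norm P (\<lambda>x. \<phi> (x + Y n) - \<phi> x)) \<longlonglongrightarrow> 0"
      unfolding sq_norm_def by - (rule LIMSEQ_offset[of _ N], simp)
  qed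
qed


section \<open>Uniform boundedness and an explicit mollifier\<close>

lemma sqrt_sq_norm_add_le:
  assumes f: "L2_field P f" and g: "L2_field P g"
  shows "sqrt (sq_norm P (\<lambda>x. f x + g x)) \<le> sqrt (sq_norm P f) + sqrt (sq_norm P g)"
proof -
  have eq: "(norm (f x + g x))\<^sup>2 = (norm (f x))\<^sup>2 + 2 * (f x \<bullet> g x) + (norm (g x))\<^sup>2" for x
    by (simp add: power2_norm_eq_inner algebra_simps inner_commute)
  have "sq_norm P (\<lambda>x. f x + g x) = sq_norm P f + 2 * (\<integral>x. f x \<bullet> g x \<partial>cell_measure P) + sq_norm P g"
    using L2_fieldD(3)[OF f] L2_fieldD(3)[OF g] L2_field_integrable_inner[OF f g]
    by (simp add: sq_norm_def eq)
  also have "\<dots> \<le> (sqrt (sq_norm P f) + sqrt (sq_norm P g))\<^sup>2"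
    using L2_field_CS[OF f g] by (simp add: power2_sum)
  finally show ?thesis by (intro real_le_lsqrt) auto
qed

lemma sq_norm_scaleR: "sq_norm P (\<lambda>x. c *\<^sub>R f x) = c\<^sup>2 * sq_norm P f"
  by (simp add: sq_norm_def power_mult_distrib)

lemma sqrt_sq_norm_triangle:
  assumes "L2_field P f" "L2_field P g" "L2_field P h"
  shows "sqrt (sq_norm P (\<lambda>x. f x - h x)) \<le> sqrt (sq_norm P (\<lambda>x. f x - g x)) + sqrt (sq_norm P (\<lambda>x. g x - h x))"
  using sqrt_sq_norm_add_le[OF L2_field_diff[OF assms(1,2)] L2_field_diff[OF assms(2,3)]] by simp

text \<open>Completeness of L^2 for a sequence with geometric steps. The squared steps are summed
  with weights \<open>3 ^ m\<close>; their integrals are at most (1/9)^m, so the weighted sum is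
  finite almost everywhere, and this forces pointwise convergence. Fatou's lemma then carries the
  geometric bound to the limit.\<close>

lemma L2_field_limit:
  assumes x: "\<And>n. L2_field P (x n)" and d: "\<And>n. sqrt (sq_norm P (\<lambda>z. x (Suc n) z - x n z)) \<le> (1/3) ^ n"
  shows "\<exists>X. L2_field P X \<and> (\<forall>n. sqrt (sq_norm P (\<lambda>z. X z - x n z)) \<le> 3/2 * (1/3) ^ n)"
proof -
  note [measurable] = L2_fieldD(2)[OF x]
  let ?d = "\<lambda>n z. x (Suc n) z - x n z"
  \<comment> \<open>Where the sequence diverges, \<open>lim\<close> is an arbitrary value. This
    concerns a null set only, and \<open>X\<close> is Borel and periodic everywhere.\<close>
  define X where "X z = lim (\<lambda>n. x n z)" for z
  have L2d: "L2_field P (?d n)" for n by (intro L2_field_diff x)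
  have [measurable]: "X \<in> borel_measurable borel" unfolding X_def by measurable
  have per: "periodic P X" using L2_fieldD(1)[OF x] by (simp add: periodic_def X_def)
  have "(\<integral>\<^sup>+z. (\<Sum>m. ennreal (3 ^ m * (norm (?d m z))\<^sup>2)) \<partial>cell_measure P)
      = (\<Sum>m. (\<integral>\<^sup>+z. ennreal (3 ^ m * (norm (?d m z))\<^sup>2) \<partial>cell_measure P))"
    by (intro nn_integral_suminf) simp
  also have "\<dots> \<le> (\<Sum>m. ennreal ((1/3) ^ m))"
  proof (intro suminf_le)
    fix m
    have "(\<integral>\<^sup>+z. ennreal (3 ^ m * (norm (?d m z))\<^sup>2) \<partial>cell_measure P) = ennreal (3 ^ m) * ennreal (sq_norm P (?d m))"
      by (simp add: ennreal_mult nn_integral_cmult nn_integral_sq_norm[OF L2d])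
    also have "\<dots> = ennreal (3 ^ m * sq_norm P (?d m))" by (simp add: ennreal_mult)
    also have "\<dots> \<le> ennreal (3 ^ m * ((1/3) ^ m)\<^sup>2)"
      using d[of m] by (intro ennreal_leI mult_left_mono) (auto simp: real_le_rsqrt sqrt_le_D)
    also have "3 ^ m * ((1/3) ^ m)\<^sup>2 = (1/3 :: real) ^ m"
      by (simp add: power2_eq_square power_mult_distrib[symmetric] flip: mult.assoc)
    finally show "(\<integral>\<^sup>+z. ennreal (3 ^ m * (norm (?d m z))\<^sup>2) \<partial>cell_measure P) \<le> ennreal ((1/3) ^ m)" .
  qed auto
  also have "\<dots> = ennreal (\<Sum>m. (1/3) ^ m)"
    by (intro suminf_ennreal2 summable_geometric) auto
  also have "\<dots> < \<infinity>" by simp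
  finally have "AE z in cell_measure P. (\<Sum>m. ennreal (3 ^ m * (norm (?d m z))\<^sup>2)) \<noteq> \<infinity>"
    by (intro nn_integral_PInf_AE) auto
  then have conv: "AE z in cell_measure P. (\<lambda>n. x n z) \<longlonglongrightarrow> X z"
  proof eventually_elim
    case (elim z)
    then have s: "summable (\<lambda>m. 3 ^ m * (norm (?d m z))\<^sup>2)"
      by (intro summable_suminf_not_top) (auto simp: top_unique)
    \<comment> \<open>With \<open>a\<close> and \<open>b\<close> as below this is
      \<open>a * b \<le> a * (1 + b\<^sup>2)\<close>: it deduces summability of the steps from that
      of the weighted squares.\<close>
    have "norm (?d m z) \<le> (1/3) ^ m + 3 ^ m * (norm (?d m z))\<^sup>2" for m
    proof -
      define a b :: real where "a = (1/3) ^ m" and "b = 3 ^ m * norm (?d m z)"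
      have ab: "a * b = norm (?d m z)" by (simp add: a_def b_def flip: mult.assoc power_mult_distrib)
      have "a \<le> a * (1 + b\<^sup>2)" "0 < a" by (simp_all add: a_def mult_left_mono)
      moreover have "a * (b * 1) \<le> a * (1 + b\<^sup>2)"
        using sum_squares_ge_zero[of "b - 1/2" 0] by (intro mult_left_mono) (auto simp: a_def power2_eq_square algebra_simps)
      moreover have "a * b\<^sup>2 = 3 ^ m * (norm (?d m z))\<^sup>2"
        using ab by (simp add: power2_eq_square b_def flip: mult.assoc) 
      ultimately show ?thesis using ab by (simp add: a_def algebra_simps)
    qed
    moreover have "summable (\<lambda>m. (1/3) ^ m + 3 ^ m * (norm (?d m z))\<^sup>2)"
      by (intro summable_add s summable_geometric) simp
    ultimately have "summable (\<lambda>m. norm (?d m z))"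
      using summable_comparison_test'[where N=0 and f="\<lambda>m. norm (?d m z)"] by auto
    then have "summable (\<lambda>m. ?d m z)" by (rule summable_norm_cancel)
    then have "convergent (\<lambda>n. \<Sum>m<n. ?d m z)" by (simp add: summable_iff_convergent)
    then have "convergent (\<lambda>n. (x n z - x 0 z) + x 0 z)"
      by (intro convergent_add convergent_const) (simp add: sum_lessThan_telescope[of "\<lambda>n. x n z"])
    then show ?case by (simp add: X_def convergent_LIMSEQ_iff)
  qed
  \<comment> \<open>A partial geometric sum; 3/2 is the sum of all powers of 1/3.\<close>
  have step: "sqrt (sq_norm P (\<lambda>z. x (n + j) z - x n z)) \<le> 3/2 * (1/3) ^ n * (1 - (1/3) ^ j)" for n j
  proof (induction j)
    case 0 then show ?case by (simp add: sq_norm_def)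
  next
    case (Suc j)
    have "sqrt (sq_norm P (\<lambda>z. x (n + Suc j) z - x n z)) \<le> (1/3) ^ (n + j) + sqrt (sq_norm P (\<lambda>z. x (n + j) z - x n z))"
      using sqrt_sq_norm_triangle[OF x[of "n + Suc j"] x[of "n + j"] x[of n]] d[of "n + j"] by simp
    also have "\<dots> \<le> (1/3) ^ (n + j) + 3/2 * (1/3) ^ n * (1 - (1/3) ^ j)" using Suc by simp
    also have "\<dots> = 3/2 * (1/3) ^ n * (1 - (1/3) ^ Suc j)" by (simp add: power_add field_simps)
    finally show ?case .
  qed
  have le: "(\<integral>\<^sup>+z. ennreal ((norm (X z - x n z))\<^sup>2) \<partial>cell_measure P) \<le> ennreal ((3/2 * (1/3) ^ n)\<^sup>2)" for n
  proof -
    have "(\<integral>\<^sup>+z. ennreal ((norm (X z - x n z))\<^sup>2) \<partial>cell_measure P) 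
       = (\<integral>\<^sup>+z. liminf (\<lambda>j. ennreal ((norm (x (n + j) z - x n z))\<^sup>2)) \<partial>cell_measure P)"
    proof (rule nn_integral_cong_AE)
      show "AE z in cell_measure P. ennreal ((norm (X z - x n z))\<^sup>2) = liminf (\<lambda>j. ennreal ((norm (x (n + j) z - x n z))\<^sup>2))"
        using conv
      proof eventually_elim
        case (elim z)
        then have "(\<lambda>j. x (n + j) z) \<longlonglongrightarrow> X z" using LIMSEQ_ignore_initial_segment[of _ "X z" n] by (simp add: add.commute)
        then have "(\<lambda>j. ennreal ((norm (x (n + j) z - x n z))\<^sup>2)) \<longlonglongrightarrow> ennreal ((norm (X z - x n z))\<^sup>2)"
          by (intro tendsto_intros)
        then show ?case using lim_imp_Liminf[OF sequentially_bot] by metis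
      qed
    qed
    also have "\<dots> \<le> liminf (\<lambda>j. \<integral>\<^sup>+z. ennreal ((norm (x (n + j) z - x n z))\<^sup>2) \<partial>cell_measure P)"
      by (intro nn_integral_liminf) simp
    also have "\<dots> \<le> ennreal ((3/2 * (1/3) ^ n)\<^sup>2)"
    proof (intro Liminf_le)
      show "\<forall>\<^sub>F j in sequentially. (\<integral>\<^sup>+z. ennreal ((norm (x (n + j) z - x n z))\<^sup>2) \<partial>cell_measure P) \<le> ennreal ((3/2 * (1/3) ^ n)\<^sup>2)"
      proof (intro always_eventually allI)
        fix j
        have "sqrt (sq_norm P (\<lambda>z. x (n + j) z - x n z)) \<le> 3/2 * (1/3) ^ n * 1"
          by (rule order_trans[OF step]) (intro mult_left_mono; simp)
        then have "sq_norm P (\<lambda>z. x (n + j) z - x n z) \<le> (3/2 * (1/3) ^ n)\<^sup>2" using sqrt_le_D by simp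
        then show "(\<integral>\<^sup>+z. ennreal ((norm (x (n + j) z - x n z))\<^sup>2) \<partial>cell_measure P) \<le> ennreal ((3/2 * (1/3) ^ n)\<^sup>2)"
          by (subst nn_integral_sq_norm[OF L2_field_diff[OF x x]]) (rule ennreal_leI)
      qed
    qed auto
    finally show ?thesis .
  qed
  have L2: "L2_field P (\<lambda>z. X z - x n z)" for n
    unfolding L2_field_def
  proof (intro conjI)
    show "periodic P (\<lambda>z. X z - x n z)" using per L2_fieldD(1)[OF x] by (simp add: periodic_def)
    show "integrable (cell_measure P) (\<lambda>z. (norm (X z - x n z))\<^sup>2)"
      by (rule integrableI_bounded) (use le[of n] in \<open>auto intro: le_less_trans\<close>)
  qed measurable
  have "L2_field P X" using L2_field_add[OF L2[of 0] x[of 0]] by simp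
  moreover have "sqrt (sq_norm P (\<lambda>z. X z - x n z)) \<le> 3/2 * (1/3) ^ n" for n
    using le[of n] unfolding nn_integral_sq_norm[OF L2]
    by (intro real_le_lsqrt) (auto simp: ennreal_le_iff)
  ultimately show ?thesis by blast
qed

text \<open>The gliding hump argument of Sokal.\<close>

lemma L2_uniform_boundedness:
  assumes f: "\<And>t. t \<in> S \<Longrightarrow> L2_field P (f t)"
    and bdd: "\<And>\<phi>. L2_field P \<phi> \<Longrightarrow> \<exists>B. \<forall>t\<in>S. \<bar>\<integral>x. f t x \<bullet> \<phi> x \<partial>cell_measure P\<bar> \<le> B"
  shows "\<exists>M. \<forall>t\<in>S. sq_norm P (f t) \<le> M"
proof (rule ccontr)
  assume "\<not> ?thesis"
  \<comment> \<open>The norms grow like 4^n while the steps taken below shrink like 3^(-n). The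
    quotient 4/3 exceeds 1, which yields the contradiction.\<close>
  then have "\<exists>t\<in>S. sq_norm P (f t) > (4 ^ n)\<^sup>2" for n :: nat by (meson not_le)
  then obtain t where t: "\<And>n. t n \<in> S" "\<And>n. sq_norm P (f (t n)) > (4 ^ n)\<^sup>2" by metis
  define N where "N n = sqrt (sq_norm P (f (t n)))" for n
  have N: "N n \<ge> 4 ^ n" for n unfolding N_def using t(2)[of n] by (intro real_le_rsqrt) simp
  have N0: "N n > 0" for n using N[of n] zero_less_power[of "4::real" n] by linarith
  define g where "g n x = (1 / N n) *\<^sub>R f (t n) x" for n x
  note ft = f[OF t(1)]
  have g: "L2_field P (g n)" for n unfolding g_def by (intro L2_field_scaleR ft)
  have g1: "sq_norm P (g n) = 1" for n
    using N0[of n] unfolding g_def sq_norm_scaleR by (simp add: N_def power_divide)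
  define pr where "pr n \<phi> = (\<integral>x. f (t n) x \<bullet> \<phi> x \<partial>cell_measure P)" for n \<phi>
  have pr_add: "pr n (\<lambda>x. \<phi> x + c *\<^sub>R \<psi> x) = pr n \<phi> + c * pr n \<psi>" if "L2_field P \<phi>" "L2_field P \<psi>" for n c \<phi> \<psi>
    using L2_field_integrable_inner[OF ft that(1)] L2_field_integrable_inner[OF ft that(2)]
    by (simp add: pr_def inner_add_right)
  have pg: "pr n (g n) = N n" for n
  proof -
    have "pr n (g n) = (1 / N n) * sq_norm P (f (t n))"
      by (simp add: pr_def g_def sq_norm_def power2_norm_eq_inner)
    also have "\<dots> = N n" using N0[of n] by (simp add: N_def field_simps) 
    finally show ?thesis .
  qed
  define c :: "nat \<Rightarrow> real" where "c n = (1/3) ^ n" for n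
  \<comment> \<open>The sign of step \<open>n\<close> is chosen so that functional \<open>n\<close>
    is large at the new point. One of the two signs works, because the two candidate values differ
    by \<open>2 * c n * N n\<close>.\<close>
  define x where "x = rec_nat (\<lambda>_. 0) (\<lambda>n y. if \<bar>pr n (\<lambda>z. y z + c n *\<^sub>R g n z)\<bar> \<ge> c n * N n 
     then (\<lambda>z. y z + c n *\<^sub>R g n z) else (\<lambda>z. y z + (- c n) *\<^sub>R g n z))"
  have x0: "x 0 = (\<lambda>_. 0)" by (simp add: x_def)
  have xS: "x (Suc n) = (if \<bar>pr n (\<lambda>z. x n z + c n *\<^sub>R g n z)\<bar> \<ge> c n * N n 
     then (\<lambda>z. x n z + c n *\<^sub>R g n z) else (\<lambda>z. x n z + (- c n) *\<^sub>R g n z))" for n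
    by (simp add: x_def)
  have L2x: "L2_field P (x n)" for n
  proof (induction n)
    case 0 show ?case by (simp add: x0 L2_field_def periodic_def)
  next
    case (Suc n)
    have a: "L2_field P (\<lambda>z. x n z + d *\<^sub>R g n z)" for d
      by (rule L2_field_add[OF Suc L2_field_scaleR[OF g]])
    show ?case unfolding xS by (split if_split) (intro conjI impI a)
  qed
  have "sqrt (sq_norm P (\<lambda>z. x (Suc n) z - x n z)) \<le> (1/3) ^ n" for n
    using sq_norm_scaleR[of P "c n" "g n"] sq_norm_scaleR[of P "- c n" "g n"] by (auto simp: xS g1 c_def)
  from L2_field_limit[of P x, OF L2x this] obtain X 
    where X: "L2_field P X" "\<And>n. sqrt (sq_norm P (\<lambda>z. X z - x n z)) \<le> 3/2 * (1/3) ^ n" by blast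
  have big: "\<bar>pr n (x (Suc n))\<bar> \<ge> c n * N n" for n
    using pr_add[OF L2x g, of n n "c n" n] pr_add[OF L2x g, of n n "- c n" n] N0[of n]
    by (auto simp: xS pg c_def) 
  have lower: "\<bar>pr n X\<bar> \<ge> 1/2 * (4/3) ^ n" for n
  proof -
    have "\<bar>pr n X - pr n (x (Suc n))\<bar> = \<bar>\<integral>z. f (t n) z \<bullet> (X z - x (Suc n) z) \<partial>cell_measure P\<bar>"
      using L2_field_integrable_inner[OF ft X(1)] L2_field_integrable_inner[OF ft L2x]
      by (simp add: pr_def inner_diff_right)
    also have "\<dots> \<le> N n * sqrt (sq_norm P (\<lambda>z. X z - x (Suc n) z))"
      unfolding N_def by (intro L2_field_CS ft L2_field_diff X L2x)
    \<comment> \<open>All later steps together can destroy only half of \<open>c n * N n\<close>,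
      since 3/2 times (1/3)^(n+1) is half of (1/3)^n.\<close>
    also have "\<dots> \<le> N n * (3/2 * (1/3) ^ Suc n)" using N0[of n] by (intro mult_left_mono X) simp
    finally have "\<bar>pr n X\<bar> \<ge> c n * N n - N n * (3/2 * (1/3) ^ Suc n)" using big[of n] by linarith
    also have "c n * N n - N n * (3/2 * (1/3) ^ Suc n) = 1/2 * (1/3) ^ n * N n" by (simp add: c_def)
    finally have "\<bar>pr n X\<bar> \<ge> 1/2 * (1/3) ^ n * N n" .
    moreover have "1/2 * (1/3) ^ n * N n \<ge> 1/2 * (1/3) ^ n * 4 ^ n" by (intro mult_left_mono N) simp
    moreover have "1/2 * (1/3) ^ n * 4 ^ n = 1/2 * (4/3 :: real) ^ n" by (simp add: power_divide)
    ultimately show ?thesis by linarith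
  qed
  obtain B where B: "\<And>n. \<bar>pr n X\<bar> \<le> B" using bdd[OF X(1)] t(1) unfolding pr_def by blast
  obtain n where "(4/3 :: real) ^ n > 2 * B" using real_arch_pow[of "4/3" "2 * B"] by auto
  then show False using lower[of n] B[of n] by linarith
qed

section \<open>An explicit kernel of class C^1 and its quantitative bounds\<close>

lemma pos_part_square_has_derivative:
  "((\<lambda>s::real. (max 0 s)\<^sup>2) has_real_derivative 2 * max 0 s) (at s)"
proof -
  consider "s > 0" | "s < 0" | "s = 0" by linarith
  then show ?thesis
  proof cases
    case 1
    have "((\<lambda>s. s\<^sup>2) has_real_derivative 2 * max 0 s) (at s)"
      using 1 by (auto intro!: derivative_eq_intros)
    then show ?thesis
      by (rule has_field_derivative_transform_within_open[where S="{0<..}"]) (use 1 in auto)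
  next
    case 2
    have "((\<lambda>s. 0) has_real_derivative 2 * max 0 s) (at s)"
      using 2 by (auto intro!: derivative_eq_intros)
    then show ?thesis
      by (rule has_field_derivative_transform_within_open[where S="{..<0}"]) (use 2 in auto)
  next
    \<comment> \<open>At 0 the square bounds the difference quotient by the absolute value of
      \<open>h\<close>, so the kink of the positive part disappears.\<close>
    case 3
    have "((\<lambda>h::real. (max 0 h)\<^sup>2 / h) \<longlongrightarrow> 0) (at 0)"
    proof (rule Lim_null_comparison)
      show "\<forall>\<^sub>F h in at (0::real). norm ((max 0 h)\<^sup>2 / h) \<le> \<bar>h\<bar>"
        by (intro always_eventually) (auto simp: max_def power2_eq_square)
      show "((\<lambda>h::real. \<bar>h\<bar>) \<longlongrightarrow> 0) (at 0)" by (intro tendsto_eq_intros) auto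
    qed
    then show ?thesis using 3 by (simp add: DERIV_def)
  qed
qed

text \<open>A kernel of class \<open>C\<^sup>1\<close> is enough, because the smoothness of \<open>smear K \<phi>\<close> comes from \<open>\<phi>\<close>.\<close>

definition bump :: "real^3 \<Rightarrow> real" where
  "bump y = (max 0 (1 - y \<bullet> y))\<^sup>2"

definition bump_grad :: "real^3 \<Rightarrow> real^3" where
  "bump_grad y = (- 4 * max 0 (1 - y \<bullet> y)) *\<^sub>R y"

lemma bump_has_derivative: "(bump has_derivative (\<lambda>h. bump_grad y \<bullet> h)) (at y)"
proof -
  have "((\<lambda>y::real^3. 1 - y \<bullet> y) has_derivative (\<lambda>h. - 2 * (y \<bullet> h))) (at y)"
    by (auto intro!: derivative_eq_intros simp: inner_commute)
  from has_derivative_compose[OF this pos_part_square_has_derivative[unfolded has_field_derivative_def]]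
  show ?thesis by (simp add: bump_def[abs_def] bump_grad_def mult_ac)
qed

text \<open>Kept as an unevaluated integral, to be compared with the volume of the ball of radius
  \<open>\<epsilon>\<close>.\<close>

definition bump_mass :: "real \<Rightarrow> real" where
  "bump_mass \<epsilon> = (\<integral>y. bump (y /\<^sub>R \<epsilon>) \<partial>lborel)"

definition moll :: "real \<Rightarrow> real^3 \<Rightarrow> real" where
  "moll \<epsilon> y = bump (y /\<^sub>R \<epsilon>) / bump_mass \<epsilon>"

definition moll_grad :: "real \<Rightarrow> real^3 \<Rightarrow> real^3" where
  "moll_grad \<epsilon> y = (1 / (\<epsilon> * bump_mass \<epsilon>)) *\<^sub>R bump_grad (y /\<^sub>R \<epsilon>)"

lemma bump_cont: "continuous_on UNIV bump"
  unfolding bump_def by (intro continuous_intros)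

lemma bump_measurable [measurable]: "bump \<in> borel_measurable borel"
  by (intro borel_measurable_continuous_onI bump_cont)

lemma bump_le: "bump y \<le> indicator (cball 0 1) y"
proof -
  have "1 - y \<bullet> y \<le> 0" if "\<not> norm y \<le> 1"
    using that power_mono[of 1 "norm y" 2] by (simp add: power2_norm_eq_inner)
  moreover have "(max 0 (1 - y \<bullet> y))\<^sup>2 \<le> 1"
    using power_mono[of "max 0 (1 - y \<bullet> y)" 1 2] by simp
  ultimately show ?thesis by (auto simp: bump_def indicator_def max_def)
qed

lemma norm_bump_grad_le: "norm (bump_grad y) \<le> 4 * indicator (cball 0 1) y"
proof -
  have "1 - y \<bullet> y \<le> 0" if "\<not> norm y \<le> 1"
    using that power_mono[of 1 "norm y" 2] by (simp add: power2_norm_eq_inner)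
  moreover have "max 0 (1 - y \<bullet> y) * norm y \<le> 1 * 1" if "norm y \<le> 1"
    using that by (intro mult_mono) auto
  ultimately show ?thesis by (auto simp: bump_grad_def indicator_def max_def)
qed

lemma indicator_cball_scale: "\<epsilon> > 0 \<Longrightarrow> indicator (cball 0 1) (y /\<^sub>R \<epsilon>) = (indicator (cball 0 \<epsilon>) (y :: real^3) :: real)"
  by (auto simp: indicator_def divide_simps)

text \<open>On the ball of half the radius the bump is at least (3/4)^2 = 9/16, and this ball has
  one eighth of the volume; 9/128 exceeds 1/16.\<close>

lemma bump_mass_ge:
  assumes "\<epsilon> > 0"
  shows "bump_mass \<epsilon> \<ge> measure lborel (cball (0::real^3) \<epsilon>) / 16" "measure lborel (cball (0::real^3) \<epsilon>) > 0"
    "bump_mass \<epsilon> > 0"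
proof -
  have vol: "measure lborel (cball (0::real^3) r) = r ^ 3 * measure lborel (ball (0::real^3) 1)" if "r > 0" for r
    using content_ball_conv_unit_ball[of r "0::real^3"] that content_cball_conv_ball[of "0::real^3" r] by simp
  have pos: "measure lborel (ball (0::real^3) 1) > 0" using content_ball_pos[of 1 "0::real^3"] by simp
  show V: "measure lborel (cball (0::real^3) \<epsilon>) > 0" using vol[OF assms] pos assms by simp
  have int: "integrable lborel (\<lambda>y. indicator (cball (0::real^3) r) y :: real)" for r
    using emeasure_compact_finite[of "cball (0::real^3) r"] by (intro integrable_real_indicator) auto
  have "measure lborel (cball (0::real^3) \<epsilon>) / 16 \<le> measure lborel (cball (0::real^3) (\<epsilon>/2)) * (9/16)"
    using pos assms by (simp add: vol field_simps)
  also have "\<dots> = (\<integral>y. indicator (cball (0::real^3) (\<epsilon>/2)) y * (9/16) \<partial>lborel)" by simp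
  also have "\<dots> \<le> bump_mass \<epsilon>"
    unfolding bump_mass_def
  proof (rule integral_mono)
    show "integrable lborel (\<lambda>y. bump (y /\<^sub>R \<epsilon>))"
    proof (rule Bochner_Integration.integrable_bound[OF int[of \<epsilon>]])
      have "norm (bump (y /\<^sub>R \<epsilon>)) \<le> norm (indicator (cball 0 \<epsilon>) y :: real)" for y :: "real^3"
      proof -
        have "0 \<le> bump (y /\<^sub>R \<epsilon>)" by (simp add: bump_def)
        then show ?thesis using bump_le[of "y /\<^sub>R \<epsilon>"] indicator_cball_scale[OF assms, of y] by simp
      qed
      then show "AE y in lborel. norm (bump (y /\<^sub>R \<epsilon>)) \<le> norm (indicator (cball (0::real^3) \<epsilon>) y :: real)" by simp
    qed measurable
    show "indicator (cball 0 (\<epsilon>/2)) y * (9/16) \<le> bump (y /\<^sub>R \<epsilon>)" for y :: "real^3"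
    proof (cases "norm y \<le> \<epsilon> / 2")
      case True
      define z where "z = y /\<^sub>R \<epsilon>"
      have "norm z \<le> 1/2" using True assms by (simp add: z_def field_simps)
      then have "z \<bullet> z \<le> 1/4" using power_mono[of "norm z" "1/2" 2] by (simp add: power2_norm_eq_inner power_divide)
      then have "(3/4)\<^sup>2 \<le> bump z" unfolding bump_def by (intro power_mono) auto
      then show ?thesis using True by (simp add: z_def power_divide)
    qed (simp add: bump_def)
  qed (use int in auto)
  finally show m: "bump_mass \<epsilon> \<ge> measure lborel (cball (0::real^3) \<epsilon>) / 16" .
  show "bump_mass \<epsilon> > 0" using m V by linarith
qed

lemma moll_integral: "\<epsilon> > 0 \<Longrightarrow> (\<integral>y. moll \<epsilon> y \<partial>lborel) = 1"
  using bump_mass_ge(3)[of \<epsilon>] by (simp add: moll_def bump_mass_def)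

lemma moll_nonneg: "\<epsilon> > 0 \<Longrightarrow> 0 \<le> moll \<epsilon> y"
  using bump_mass_ge(3)[of \<epsilon>] by (simp add: moll_def bump_def)

lemma moll_support:
  assumes "\<epsilon> > 0" "moll \<epsilon> y \<noteq> 0" shows "norm y \<le> \<epsilon>"
proof (rule ccontr)
  assume "\<not> norm y \<le> \<epsilon>"
  then have "bump (y /\<^sub>R \<epsilon>) \<le> 0" using bump_le[of "y /\<^sub>R \<epsilon>", unfolded indicator_cball_scale[OF assms(1)]] by simp
  then have "bump (y /\<^sub>R \<epsilon>) = 0" by (simp add: bump_def)
  then show False using assms(2) by (simp add: moll_def)
qed

text \<open>64 is the bound 4 for \<open>bump_grad\<close> times the factor 16 lost in the lower
  bound for the mass.\<close>

lemma norm_moll_grad_le: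
  assumes "\<epsilon> > 0"
  shows "norm (moll_grad \<epsilon> y) \<le> 64 / (\<epsilon> * measure lborel (cball (0::real^3) \<epsilon>)) * indicator (cball 0 \<epsilon>) y"
proof -
  let ?V = "measure lborel (cball (0::real^3) \<epsilon>)"
  note m = bump_mass_ge[OF assms]
  have "norm (moll_grad \<epsilon> y) = 1 / (\<epsilon> * bump_mass \<epsilon>) * norm (bump_grad (y /\<^sub>R \<epsilon>))"
    using assms m(3) by (simp add: moll_grad_def abs_mult)
  also have "\<dots> \<le> 1 / (\<epsilon> * (?V / 16)) * (4 * indicator (cball 0 \<epsilon>) y)"
    using norm_bump_grad_le[of "y /\<^sub>R \<epsilon>"] m assms indicator_cball_scale[OF assms, of y]
    by (intro mult_mono divide_left_mono mult_left_mono) auto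
  finally show ?thesis using m by (simp add: field_simps)
qed

lemma mollifier_moll:
  assumes \<epsilon>: "0 < \<epsilon>" "\<epsilon> \<le> 1"
  shows "mollifier (moll \<epsilon>) (moll_grad \<epsilon>) (64 / (\<epsilon> * measure lborel (cball (0::real^3) \<epsilon>)))"
proof
  let ?V = "measure lborel (cball (0::real^3) \<epsilon>)"
  let ?C = "64 / (\<epsilon> * ?V)"
  note m = bump_mass_ge[OF \<epsilon>(1)]
  have sub: "indicator (cball 0 \<epsilon>) y \<le> (indicator (cball 0 1) y :: real)" for y :: "real^3"
    using \<epsilon> by (auto simp: indicator_def)
  have C: "0 \<le> ?C" using \<epsilon> m by simp
  fix y :: "real^3"
  have "((\<lambda>y. y /\<^sub>R \<epsilon>) has_derivative (\<lambda>h. h /\<^sub>R \<epsilon>)) (at y)" by (auto intro!: derivative_eq_intros)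
  from has_derivative_compose[OF this bump_has_derivative]
  have "((\<lambda>y. bump (y /\<^sub>R \<epsilon>)) has_derivative (\<lambda>h. bump_grad (y /\<^sub>R \<epsilon>) \<bullet> (h /\<^sub>R \<epsilon>))) (at y)" .
  from has_derivative_mult_right[OF this, of "1 / bump_mass \<epsilon>"]
  show "(moll \<epsilon> has_derivative (\<lambda>h. moll_grad \<epsilon> y \<bullet> h)) (at y)"
    by (simp add: moll_def[abs_def] moll_grad_def field_simps)
  show "norm (moll_grad \<epsilon> y) \<le> ?C * indicator (cball 0 1) y"
    using norm_moll_grad_le[OF \<epsilon>(1), of y] mult_left_mono[OF sub[of y] C] by linarith
  have "moll \<epsilon> y \<le> 1 / (?V / 16) * indicator (cball 0 1) y"
  proof -
    have b: "bump (y /\<^sub>R \<epsilon>) \<le> indicator (cball 0 1) y" "0 \<le> bump (y /\<^sub>R \<epsilon>)"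
      using bump_le[of "y /\<^sub>R \<epsilon>", unfolded indicator_cball_scale[OF \<epsilon>(1)]] sub[of y] 
      by (linarith, simp add: bump_def)
    have "1 / bump_mass \<epsilon> \<le> 1 / (?V / 16)"
      using m by (intro divide_left_mono mult_pos_pos) auto
    then have "1 / bump_mass \<epsilon> * bump (y /\<^sub>R \<epsilon>) \<le> 1 / (?V / 16) * indicator (cball 0 1) y"
      using b m(2) by (intro mult_mono) auto
    then show ?thesis by (simp add: moll_def)
  qed
  \<comment> \<open>Since \<open>\<epsilon>\<close> is at most 1, the constant for the gradient also
    dominates the kernel.\<close>
  also have "1 / (?V / 16) \<le> ?C"
  proof -
    have "16 * \<epsilon> \<le> 64" using \<epsilon> by simp
    then show ?thesis using \<epsilon> m by (simp add: field_simps)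
  qed
  finally have "moll \<epsilon> y \<le> ?C * indicator (cball 0 1) y" by (simp add: mult_right_mono)
  then show "\<bar>moll \<epsilon> y\<bar> \<le> ?C * indicator (cball 0 1) y" using moll_nonneg[OF \<epsilon>(1)] by simp
  show "moll \<epsilon> (- y) = moll \<epsilon> y" by (simp add: moll_def bump_def)
  show "moll_grad \<epsilon> (- y) = - moll_grad \<epsilon> y" by (simp add: moll_grad_def bump_grad_def)
next
  show "continuous_on UNIV (moll_grad \<epsilon>)"
    unfolding moll_grad_def bump_grad_def by (intro continuous_intros)
qed


section \<open>The energy flux\<close>

text \<open>For a test field \<open>g\<close> and \<open>k\<close> the gradient of \<open>K\<close>,
  this is the pairing of the tensor square of \<open>f\<close> with the gradient of
  \<open>smear K g\<close>. The derivative has been moved to the kernel, whence the sign, so the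
  expression makes sense for every square integrable \<open>g\<close>.\<close>

definition flux :: "3 set \<Rightarrow> (real^3 \<Rightarrow> real^3) \<Rightarrow> (real^3 \<Rightarrow> real^3) \<Rightarrow> (real^3 \<Rightarrow> real^3) \<Rightarrow> real" where
  "flux P k f g = - (\<integral>x. f x \<bullet> smear (\<lambda>y. k y \<bullet> f x) g x \<partial>cell_measure P)"

text \<open>Borel representatives of the elements of \<open>H_sigma P\<close>.\<close>

definition solenoidal :: "3 set \<Rightarrow> (real^3 \<Rightarrow> real^3) \<Rightarrow> bool" where
  "solenoidal P f \<longleftrightarrow> L2_field P f \<and>
     (\<forall>e>0. \<exists>\<phi>\<in>test_fields_sigma P. sq_norm P (\<lambda>x. f x - \<phi> x) < e)"

lemma solenoidal_L2: "solenoidal P f \<Longrightarrow> L2_field P f"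
  by (simp add: solenoidal_def)

lemma test_fields_sigma_L2: "\<phi> \<in> test_fields_sigma P \<Longrightarrow> L2_field P \<phi>"
  by (simp add: test_fields_sigma_def test_fields_L2)

lemma solenoidal_approx:
  assumes "solenoidal P f"
  obtains \<phi> where "\<And>n::nat. \<phi> n \<in> test_fields_sigma P" "(\<lambda>n. sq_norm P (\<lambda>x. f x - \<phi> n x)) \<longlonglongrightarrow> 0"
proof -
  have "\<forall>n::nat. \<exists>\<phi>\<in>test_fields_sigma P. sq_norm P (\<lambda>x. f x - \<phi> x) < 1 / real (Suc n)"
    using assms by (auto simp: solenoidal_def)
  then obtain \<phi> where \<phi>: "\<And>n::nat. \<phi> n \<in> test_fields_sigma P" "\<And>n. sq_norm P (\<lambda>x. f x - \<phi> n x) < 1 / real (Suc n)"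
    by metis
  have "(\<lambda>n. sq_norm P (\<lambda>x. f x - \<phi> n x)) \<longlonglongrightarrow> 0"
    by (rule real_tendsto_sandwich[OF _ _ tendsto_const LIMSEQ_Suc[OF lim_1_over_n]])
      (auto intro!: always_eventually less_imp_le \<phi>(2)[unfolded of_nat_Suc])
  with \<phi>(1) show thesis by (rule that)
qed

text \<open>Test fields are dense and translation acts continuously on them. The approximation error
  contributes at most 8 times e / 16, the increment of the test field 2 times e / 4.\<close>

lemma solenoidal_translation_tendsto:
  assumes "solenoidal P f"
  shows "((\<lambda>y. sq_norm P (\<lambda>x. f (x + y) - f x)) \<longlongrightarrow> 0) (at 0)"
proof (rule tendstoI)
  fix e :: real assume "0 < e"
  note f = solenoidal_L2[OF assms]
  from \<open>0 < e\<close> assms obtain \<phi> where \<phi>: "\<phi> \<in> test_fields_sigma P" and le: "sq_norm P (\<lambda>x. f x - \<phi> x) < e / 16"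
    unfolding solenoidal_def by (meson divide_pos_pos zero_less_numeral)
  have L\<phi>: "L2_field P \<phi>" using \<phi> by (rule test_fields_sigma_L2)
  have "((\<lambda>y. sq_norm P (\<lambda>x. \<phi> (x + y) - \<phi> x)) \<longlongrightarrow> 0) (at 0)"
    using \<phi> by (auto simp: test_fields_sigma_def intro: test_fields_L2)
  then have "\<forall>\<^sub>F y in at 0. sq_norm P (\<lambda>x. \<phi> (x + y) - \<phi> x) < e / 4"
    using \<open>0 < e\<close> by (intro order_tendstoD) auto
  then show "\<forall>\<^sub>F y in at 0. dist (sq_norm P (\<lambda>x. f (x + y) - f x)) 0 < e"
  proof eventually_elim
    case (elim y)
    let ?d = "\<lambda>x. f x - \<phi> x"
    have d: "L2_field P ?d" by (intro L2_field_diff f L\<phi>)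
    have "sq_norm P (\<lambda>x. f (x + y) - f x) = sq_norm P (\<lambda>x. (?d (x + y) - ?d x) + (\<phi> (x + y) - \<phi> x))"
      by (simp add: sq_norm_def)
    also have "\<dots> \<le> 2 * sq_norm P (\<lambda>x. ?d (x + y) - ?d x) + 2 * sq_norm P (\<lambda>x. \<phi> (x + y) - \<phi> x)"
      by (intro sq_norm_add_le L2_field_diff[OF L2_field_shift[OF d] d] L2_field_diff[OF L2_field_shift[OF L\<phi>] L\<phi>])
    also have "sq_norm P (\<lambda>x. ?d (x + y) - ?d x) \<le> 2 * sq_norm P (\<lambda>x. ?d (x + y)) + 2 * sq_norm P ?d"
      by (rule sq_norm_diff_le[OF L2_field_shift[OF d] d])
    also have "sq_norm P (\<lambda>x. ?d (x + y)) = sq_norm P ?d" by (rule sq_norm_shift[OF d])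
    finally show ?case using le elim by simp
  qed
qed

lemma frechet_derivative_test_field_sigma:
  assumes "\<phi> \<in> test_fields_sigma P"
  shows "(\<Sum>i\<in>UNIV. frechet_derivative \<phi> (at x) (axis i 1) $ i) = 0"
  using assms by (simp add: test_fields_sigma_def divergence_def partial_deriv_def)

lemma smear_component: 
  "integrable lborel (\<lambda>y. k y *\<^sub>R f (x + y)) \<Longrightarrow> smear k f x $ i = (\<integral>y. k y * f (x + y) $ i \<partial>lborel)"
  unfolding smear_def 
  using integral_inner_left[of "axis i (1::real)" lborel "\<lambda>y. k y *\<^sub>R f (x + y)"]
  by (simp add: inner_axis)

context mollifier
begin

lemma k_inner_integral:
  assumes f: "L2_field P f"
  shows "integrable lborel (\<lambda>y. k y \<bullet> f (x + y))"
    and "(\<integral>y. k y \<bullet> f (x + y) \<partial>lborel) = (\<Sum>i\<in>UNIV. smear (\<lambda>y. k y \<bullet> axis i 1) f x $ i)"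
proof -
  have int: "integrable lborel (\<lambda>y. (k y \<bullet> axis i 1) *\<^sub>R f (x + y))" for i
    by (rule smear_integrable[OF kernel_k f])
  have int': "integrable lborel (\<lambda>y. k y $ i * f (x + y) $ i)" for i
    using integrable_inner_left[of "axis i (1::real)", OF int[of i]] by (simp add: inner_axis)
  have eq: "k y \<bullet> f (x + y) = (\<Sum>i\<in>UNIV. k y $ i * f (x + y) $ i)" for y
    by (simp add: inner_vec_def)
  show "integrable lborel (\<lambda>y. k y \<bullet> f (x + y))"
    unfolding eq by (intro Bochner_Integration.integrable_sum int')
  have "(\<integral>y. k y \<bullet> f (x + y) \<partial>lborel) = (\<Sum>i\<in>UNIV. (\<integral>y. k y $ i * f (x + y) $ i \<partial>lborel))"
    unfolding eq by (intro Bochner_Integration.integral_sum int')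
  also have "\<dots> = (\<Sum>i\<in>UNIV. smear (\<lambda>y. k y \<bullet> axis i 1) f x $ i)"
    by (subst smear_component[OF int]) (simp add: inner_axis)
  finally show "(\<integral>y. k y \<bullet> f (x + y) \<partial>lborel) = (\<Sum>i\<in>UNIV. smear (\<lambda>y. k y \<bullet> axis i 1) f x $ i)" .
qed

lemma smear_test_fields_sigma:
  assumes \<phi>: "\<phi> \<in> test_fields_sigma P"
  shows "smear K \<phi> \<in> test_fields_sigma P"
proof -
  have t: "\<phi> \<in> test_fields P" and s: "smooth_on UNIV \<phi>"
    using \<phi> by (auto simp: test_fields_sigma_def test_fields_def)
  have "divergence (smear K \<phi>) x = 0" for x
  proof -
    have L2: "L2_field P (\<lambda>x. frechet_derivative \<phi> (at x) v)" for v
      by (rule test_fields_L2(1)[OF test_fields_derivative[OF t]])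
    have int: "integrable lborel (\<lambda>y. K y *\<^sub>R frechet_derivative \<phi> (at (x + y)) v)" for v
      using smear_integrable[OF kernel_K L2] .
    have int': "integrable lborel (\<lambda>y. K y * frechet_derivative \<phi> (at (x + y)) v $ i)" for v i
      using integrable_inner_left[of "axis i (1::real)", OF int] by (simp add: inner_axis)
    have "divergence (smear K \<phi>) x = (\<Sum>i\<in>UNIV. smear K (\<lambda>x. frechet_derivative \<phi> (at x) (axis i 1)) x $ i)"
      by (simp add: divergence_def partial_deriv_def frechet_derivative_smear(1)[OF s])
    also have "\<dots> = (\<Sum>i\<in>UNIV. (\<integral>y. K y * frechet_derivative \<phi> (at (x + y)) (axis i 1) $ i \<partial>lborel))"
      by (subst smear_component[OF int]) simp
    also have "\<dots> = (\<integral>y. (\<Sum>i\<in>UNIV. K y * frechet_derivative \<phi> (at (x + y)) (axis i 1) $ i) \<partial>lborel)"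
      by (intro Bochner_Integration.integral_sum[symmetric] int')
    also have "\<dots> = 0"
      by (simp only: sum_distrib_left[symmetric] frechet_derivative_test_field_sigma[OF \<phi>]) simp
    finally show ?thesis .
  qed
  then show ?thesis using smear_test_fields[OF t] by (simp add: test_fields_sigma_def)
qed

text \<open>The weak form of vanishing divergence. For a test field the integral is minus the
  divergence of its mollification, hence 0; \<open>norm_smear_le\<close> makes the integral
  continuous in L^2 at a fixed point, so the limit inherits the value.\<close>

lemma k_inner_integral_solenoidal:
  assumes f: "solenoidal P f"
  shows "(\<integral>y. k y \<bullet> f (x + y) \<partial>lborel) = 0"
proof -
  note L2 = solenoidal_L2[OF f]
  from solenoidal_approx[OF f] obtain \<phi> where \<phi>: "\<And>n::nat. \<phi> n \<in> test_fields_sigma P" 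
    and lim: "(\<lambda>n. sq_norm P (\<lambda>x. f x - \<phi> n x)) \<longlonglongrightarrow> 0" by blast
  note L\<phi> = test_fields_sigma_L2[OF \<phi>]
  have 0: "(\<Sum>i\<in>UNIV. smear (\<lambda>y. k y \<bullet> axis i 1) (\<phi> n) x $ i) = 0" for n
  proof -
    have s: "smooth_on UNIV (\<phi> n)" using \<phi>[of n] by (auto simp: test_fields_sigma_def test_fields_def)
    have "smear (\<lambda>y. k y \<bullet> axis i 1) (\<phi> n) x = - frechet_derivative (smear K (\<phi> n)) (at x) (axis i 1)" for i
      by (simp add: frechet_derivative_smear(2)[OF s])
    then show ?thesis using frechet_derivative_test_field_sigma[OF smear_test_fields_sigma[OF \<phi>[of n]]] 
      by (simp add: sum_negf)
  qed
  have "(\<lambda>n. smear (\<lambda>y. k y \<bullet> a) (\<phi> n) x) \<longlonglongrightarrow> smear (\<lambda>y. k y \<bullet> a) f x" for a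
  proof (rule Lim_transform2[OF tendsto_const], rule Lim_null_comparison)
    show "\<forall>\<^sub>F n in sequentially. norm (smear (\<lambda>y. k y \<bullet> a) f x - smear (\<lambda>y. k y \<bullet> a) (\<phi> n) x)
       \<le> C * norm a * sqrt unit_vol * sqrt (sq_norm P (\<lambda>x. f x - \<phi> n x))"
      using norm_smear_le[OF kernel_k L2_field_diff[OF L2 L\<phi>]] 
      by (intro always_eventually) (simp add: smear_diff[OF kernel_k L2 L\<phi>])
    have "(\<lambda>n. C * norm a * sqrt unit_vol * sqrt (sq_norm P (\<lambda>x. f x - \<phi> n x))) \<longlonglongrightarrow> C * norm a * sqrt unit_vol * sqrt 0"
      by (intro tendsto_intros lim)
    then show "(\<lambda>n. C * norm a * sqrt unit_vol * sqrt (sq_norm P (\<lambda>x. f x - \<phi> n x))) \<longlonglongrightarrow> 0" by simp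
  qed
  then have "(\<lambda>n. \<Sum>i\<in>UNIV. smear (\<lambda>y. k y \<bullet> axis i 1) (\<phi> n) x $ i) \<longlonglongrightarrow> (\<Sum>i\<in>UNIV. smear (\<lambda>y. k y \<bullet> axis i 1) f x $ i)"
    by (intro tendsto_intros)
  then have "(\<Sum>i\<in>UNIV. smear (\<lambda>y. k y \<bullet> axis i 1) f x $ i) = 0"
    by (simp add: 0 LIMSEQ_const_iff)
  then show ?thesis by (simp add: k_inner_integral(2)[OF L2])
qed

lemma flux_integrand_measurable [measurable]:
  assumes [measurable]: "f \<in> borel_measurable borel" "g \<in> borel_measurable borel"
  shows "(\<lambda>x. f x \<bullet> smear (\<lambda>y. k y \<bullet> f x) g x) \<in> borel_measurable borel"
  unfolding smear_def by measurable

text \<open>The inner average is bounded uniformly in space by the L^2 norm of \<open>g\<close>.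
  This leaves the square of \<open>f\<close> as an integrable majorant, without any cubic
  integrability.\<close>

lemma flux_integrand_le:
  assumes "L2_field P g"
  shows "\<bar>f x \<bullet> smear (\<lambda>y. k y \<bullet> f x) g x\<bar> \<le> C * sqrt unit_vol * sqrt (sq_norm P g) * (norm (f x))\<^sup>2"
proof -
  have "\<bar>f x \<bullet> smear (\<lambda>y. k y \<bullet> f x) g x\<bar> \<le> norm (f x) * (C * norm (f x) * sqrt unit_vol * sqrt (sq_norm P g))"
    by (rule order_trans[OF Cauchy_Schwarz_ineq2 mult_left_mono[OF norm_smear_le[OF kernel_k assms]]]) simp
  then show ?thesis by (simp add: power2_eq_square mult_ac)
qed

lemma flux_integrable:
  assumes f: "L2_field P f" and g: "L2_field P g"
  shows "integrable (cell_measure P) (\<lambda>x. f x \<bullet> smear (\<lambda>y. k y \<bullet> f x) g x)"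
proof (rule Bochner_Integration.integrable_bound)
  show "(\<lambda>x. f x \<bullet> smear (\<lambda>y. k y \<bullet> f x) g x) \<in> borel_measurable (cell_measure P)"
    using flux_integrand_measurable[OF L2_fieldD(2)[OF f] L2_fieldD(2)[OF g]] by simp
  show "integrable (cell_measure P) (\<lambda>x. C * sqrt unit_vol * sqrt (sq_norm P g) * (norm (f x))\<^sup>2)"
    using L2_fieldD(3)[OF f] by (intro integrable_mult_right)
  show "AE x in cell_measure P. norm (f x \<bullet> smear (\<lambda>y. k y \<bullet> f x) g x) \<le> norm (C * sqrt unit_vol * sqrt (sq_norm P g) * (norm (f x))\<^sup>2)"
    unfolding real_norm_def by (intro AE_I2 order_trans[OF flux_integrand_le[OF g] abs_ge_self])
qed

lemma flux_le:
  assumes f: "L2_field P f" and g: "L2_field P g"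
  shows "\<bar>flux P k f g\<bar> \<le> C * sqrt unit_vol * sqrt (sq_norm P g) * sq_norm P f"
proof -
  have "\<bar>flux P k f g\<bar> \<le> (\<integral>x. \<bar>f x \<bullet> smear (\<lambda>y. k y \<bullet> f x) g x\<bar> \<partial>cell_measure P)"
    unfolding flux_def using integral_abs_bound by simp
  also have "\<dots> \<le> (\<integral>x. C * sqrt unit_vol * sqrt (sq_norm P g) * (norm (f x))\<^sup>2 \<partial>cell_measure P)"
    using L2_fieldD(3)[OF f] by (intro integral_mono flux_integrand_le[OF g] integrable_abs flux_integrable f g) auto
  also have "\<dots> = C * sqrt unit_vol * sqrt (sq_norm P g) * sq_norm P f"
    by (simp add: sq_norm_def)
  finally show ?thesis .
qed

lemma flux_diff:
  assumes f: "L2_field P f" and g: "L2_field P g" and h: "L2_field P h"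
  shows "flux P k f g - flux P k f h = flux P k f (\<lambda>x. g x - h x)"
  using flux_integrable[OF f g] flux_integrable[OF f h]
  by (simp add: flux_def smear_diff[OF kernel_k g h] inner_diff_right)

lemma k_integral_zero: "integrable lborel k" "(\<integral>y. k y \<partial>lborel) = 0"
proof -
  have "integrable lborel (\<lambda>y. C * indicator (cball (0::real^3) 1) y)"
    using emeasure_compact_finite[of "cball (0::real^3) 1"]
    by (intro integrable_mult_right integrable_real_indicator) auto
  then show "integrable lborel k"
    by (rule Bochner_Integration.integrable_bound) (use k_bound in \<open>auto intro!: AE_I2 simp: order_trans[OF _ abs_ge_self]\<close>)
  have "(\<integral>y. k y \<partial>lborel) = - (\<integral>y. k y \<partial>lborel)"
    using lborel_integral_uminus[of k] by (simp add: k_odd)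
  then show "(\<integral>y. k y \<partial>lborel) = 0" unfolding eq_neg_iff_add_eq_0 scaleR_2[symmetric] by simp
qed

text \<open>The identity of Duchon and Robert: after expanding the cube of the increment, only the
  mixed terms survive, because \<open>f\<close> is divergence free and \<open>k\<close> is odd.\<close>

lemma flux_self_le:
  assumes f: "solenoidal P f" and f3: "integrable (cell_measure P) (\<lambda>x. norm (f x) ^ 3)"
  shows "ennreal (4 * \<bar>flux P k f f\<bar>) \<le>
    (\<integral>\<^sup>+y. ennreal (norm (k y)) * (\<integral>\<^sup>+x. ennreal (norm (f (x + y) - f x) ^ 3) \<partial>cell_measure P) \<partial>lborel)"
proof -
  interpret pr: pair_sigma_finite "cell_measure P" "lborel :: (real^3) measure" by (rule pair_cell_lborel)
  note L2 = solenoidal_L2[OF f]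
  note [measurable] = L2_fieldD(2)[OF L2]
  note per = L2_fieldD(1)[OF L2]
  have C: "0 \<le> C" using bounded_kernel_nonneg[OF kernel_K] .
  let ?w = "\<lambda>x. C * norm (f x) ^ 3"
  have w: "?w \<in> borel_measurable borel" "periodic P ?w" "\<And>x. 0 \<le> ?w x" "integrable (cell_measure P) ?w"
    using C f3 per by (auto simp: periodic_def)
  define J where "J H = (\<integral>x. (\<integral>y. H x y \<partial>lborel) \<partial>cell_measure P)" for H :: "real^3 \<Rightarrow> real^3 \<Rightarrow> real"
  \<comment> \<open>Every product in the expanded cube is at most the cube of the larger field
    value, which gives a majorant symmetric in the two points as Fubini and the flip
    require.\<close>
  have bd: "norm ((k y \<bullet> a) * (b \<bullet> c)) \<le> indicator (cball 0 1) y * (?w x + ?w (x + y))"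
    if "norm a \<le> max (norm (f x)) (norm (f (x + y)))" "norm b \<le> max (norm (f x)) (norm (f (x + y)))"
      "norm c \<le> max (norm (f x)) (norm (f (x + y)))" for a b c x y
  proof -
    let ?m = "max (norm (f x)) (norm (f (x + y)))"
    have "norm ((k y \<bullet> a) * (b \<bullet> c)) \<le> (norm (k y) * norm a) * (norm b * norm c)"
      unfolding real_norm_def abs_mult by (intro mult_mono Cauchy_Schwarz_ineq2) auto
    also have "\<dots> \<le> ((C * indicator (cball 0 1) y) * ?m) * (?m * ?m)"
      using that C by (intro mult_mono k_bound) (auto simp: le_max_iff_disj)
    also have "\<dots> = (C * indicator (cball 0 1) y) * ?m ^ 3" by (simp add: power3_eq_cube)
    also have "\<dots> \<le> (C * indicator (cball 0 1) y) * (norm (f x) ^ 3 + norm (f (x + y)) ^ 3)"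
      using C by (intro mult_left_mono) (auto simp: max_def)
    finally show ?thesis by (simp add: algebra_simps)
  qed
  \<comment> \<open>The flags record which factors are taken at \<open>x + y\<close>:
    \<open>a\<close> belongs to the factor paired with \<open>k\<close>, \<open>b\<close> and
    \<open>c\<close> to the scalar product.\<close>
  define t where "t a b c x y = (k y \<bullet> f (x + (if a then y else 0))) * (f (x + (if b then y else 0)) \<bullet> f (x + (if c then y else 0)))" 
    for a b c :: bool and x y
  have tm[measurable]: "(\<lambda>(x, y). t a b c x y) \<in> borel_measurable (borel \<Otimes>\<^sub>M borel)" for a b c
    unfolding t_def by measurable
  have tb: "norm (t a b c x y) \<le> indicator (cball 0 1) y * (?w x + ?w (x + y))" for a b c x y
    unfolding t_def by (rule bd) auto
  have ti: "integrable (cell_measure P \<Otimes>\<^sub>M lborel) (\<lambda>(x, y). t a b c x y)" for a b c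
    by (rule integrable_cell_pair[OF tm w]) (use tb in simp)
  have per': "periodic P (\<lambda>x. f (x + z))" for z by (rule periodic_shift[OF per])
  \<comment> \<open>Exchanging the two points negates all three flags; the sign comes from the
    oddness of \<open>k\<close>.\<close>
  have flip: "J (t a b c) = - J (t (\<not> a) (\<not> b) (\<not> c))" for a b c
  proof -
    have "J (t a b c) = J (\<lambda>x y. t a b c (x + y) (- y))"
      unfolding J_def
    proof (rule cell_integral_flip[OF tm w tb])
      show "periodic P (\<lambda>x. t a b c x y)" for y
        using per'[of 0] per'[of y] by (auto simp: t_def periodic_def)
    qed
    also have "(\<lambda>x y. t a b c (x + y) (- y)) = (\<lambda>x y. - t (\<not> a) (\<not> b) (\<not> c) x y)"
      by (auto simp: t_def k_odd fun_eq_iff)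
    finally show ?thesis by (simp add: J_def)
  qed
  have t2: "J (t False False False) = 0"
    using k_integral_zero by (simp add: J_def t_def)
  \<comment> \<open>The factors at \<open>x\<close> leave the inner integral, and vanishing
    divergence annihilates what remains.\<close>
  have t3: "J (t True False False) = 0"
    using k_inner_integral_solenoidal[OF f] by (simp add: J_def t_def)
  have t5: "J (t False False True) = - flux P k f f"
  proof -
    have "(\<integral>y. t False False True x y \<partial>lborel) = f x \<bullet> smear (\<lambda>y. k y \<bullet> f x) f x" for x
      using smear_integrable[OF kernel_k L2, of "f x" x] 
      by (simp add: t_def smear_def flip: integral_inner_right)
    then show ?thesis by (simp add: J_def flux_def)
  qed
  let ?D = "\<lambda>x y. (k y \<bullet> (f (x + y) - f x)) * ((f (x + y) - f x) \<bullet> (f (x + y) - f x))"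
  have D: "?D x y = (t True True True x y + t True False False x y + 2 * t False False True x y)
        - (2 * t True False True x y + t False True True x y + t False False False x y)" for x y
    by (simp add: t_def algebra_simps inner_commute)
  have ti': "integrable (cell_measure P \<Otimes>\<^sub>M lborel) (\<lambda>z. t a b c (fst z) (snd z))" for a b c
    using ti[of a b c] by (simp add: split_beta')
  have J': "J (\<lambda>x y. H (x, y)) = integral\<^sup>L (cell_measure P \<Otimes>\<^sub>M lborel) H" 
    if "integrable (cell_measure P \<Otimes>\<^sub>M lborel) H" for H
    using pr.integral_fst[of "\<lambda>x y. H (x, y)"] that by (simp add: J_def split_beta')
  have Dint: "integrable (cell_measure P \<Otimes>\<^sub>M lborel) (\<lambda>z. ?D (fst z) (snd z))"
    unfolding D by (intro Bochner_Integration.integrable_add Bochner_Integration.integrable_diff integrable_mult_right ti')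
  have "integral\<^sup>L (cell_measure P \<Otimes>\<^sub>M lborel) (\<lambda>z. ?D (fst z) (snd z)) = 
      (J (t True True True) + J (t True False False) + 2 * J (t False False True))
        - (2 * J (t True False True) + J (t False True True) + J (t False False False))"
    unfolding D by (simp add: ti' J'[OF ti', simplified])
  \<comment> \<open>By \<open>flip\<close> and the two zero cases, the terms with
    \<open>b = c\<close> vanish. The two mixed terms with coefficients 2 and -2 are negatives of
    each other under \<open>flip\<close> and symmetry of the scalar product, so they add up to
    4.\<close>
  also have "\<dots> = 4 * J (t False False True)"
  proof -
    have "J (t False True False) = J (t False False True)"
      by (simp add: t_def J_def inner_commute)
    then show ?thesis
      using flip[of True True True] flip[of False True True] flip[of True False True] t2 t3 by simp
  qed
  also have "\<dots> = - 4 * flux P k f f" by (simp add: t5)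
  finally have "4 * \<bar>flux P k f f\<bar> = norm (integral\<^sup>L (cell_measure P \<Otimes>\<^sub>M lborel) (\<lambda>z. ?D (fst z) (snd z)))"
    by simp
  then have "ennreal (4 * \<bar>flux P k f f\<bar>) \<le> (\<integral>\<^sup>+z. ennreal (norm (?D (fst z) (snd z))) \<partial>(cell_measure P \<Otimes>\<^sub>M lborel))"
    using integral_norm_bound_ennreal[OF Dint] by simp
  also have "\<dots> \<le> (\<integral>\<^sup>+z. ennreal (norm (k (snd z))) * ennreal (norm (f (fst z + snd z) - f (fst z)) ^ 3) \<partial>(cell_measure P \<Otimes>\<^sub>M lborel))"
  proof (intro nn_integral_mono)
    fix z :: "(real^3) \<times> (real^3)"
    let ?d = "f (fst z + snd z) - f (fst z)"
    have "norm (?D (fst z) (snd z)) \<le> (norm (k (snd z)) * norm ?d) * (norm ?d * norm ?d)"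
      unfolding real_norm_def abs_mult by (intro mult_mono Cauchy_Schwarz_ineq2) auto
    then have "norm (?D (fst z) (snd z)) \<le> norm (k (snd z)) * norm ?d ^ 3"
      by (simp add: power3_eq_cube mult.assoc)
    then show "ennreal (norm (?D (fst z) (snd z))) \<le> ennreal (norm (k (snd z))) * ennreal (norm ?d ^ 3)"
      by (simp add: ennreal_leI flip: ennreal_mult)
  qed
  also have "\<dots> = (\<integral>\<^sup>+y. (\<integral>\<^sup>+x. ennreal (norm (k y)) * ennreal (norm (f (x + y) - f x) ^ 3) \<partial>cell_measure P) \<partial>lborel)"
    by (subst pr.nn_integral_snd[symmetric]) auto
  also have "\<dots> = (\<integral>\<^sup>+y. ennreal (norm (k y)) * (\<integral>\<^sup>+x. ennreal (norm (f (x + y) - f x) ^ 3) \<partial>cell_measure P) \<partial>lborel)"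
    by (intro nn_integral_cong nn_integral_cmult) measurable
  finally show ?thesis .
qed

end


section \<open>Weak solutions in time\<close>

text \<open>A value of \<open>smear\<close> at a fixed point is a bounded functional of the field.
  Writing it as a pairing with one square integrable periodic field makes weak continuity in time
  available pointwise in space.\<close>

lemma smear_as_pairing:
  assumes k: "bounded_kernel C \<kappa>"
  obtains \<phi> where "L2_field P \<phi>" 
    "\<And>f. L2_field P f \<Longrightarrow> smear \<kappa> f x \<bullet> e = (\<integral>z. f z \<bullet> \<phi> z \<partial>cell_measure P)"
proof -
  note [measurable] = bounded_kernel_measurable[OF k]
  define c :: "real^3" where "c = (\<chi> i. pi)"
  \<comment> \<open>The kernel recentred at \<open>x\<close> and extended periodically. The shift by
    \<open>c\<close> puts its support inside the cell, so that reduction does not cut it.\<close>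
  define \<phi> where "\<phi> z = \<kappa> (reduce P (z - x + c) - c) *\<^sub>R e" for z
  have [measurable]: "\<phi> \<in> borel_measurable borel" unfolding \<phi>_def by measurable
  have per: "periodic P \<phi>"
    using periodic_shift[OF periodic_comp_reduce[of P "\<lambda>z. \<kappa> (z - c) *\<^sub>R e"], of "c - x"] by (simp add: \<phi>_def[abs_def] algebra_simps)
  have \<phi>s: "\<phi> (z + (x - c)) = \<kappa> (z - c) *\<^sub>R e" if "z \<in> cell P" for z
    using that by (simp add: \<phi>_def reduce_idem)
  have supp: "y + c \<in> cell P" if "\<kappa> y \<noteq> 0" for y
  proof -
    have "y \<in> cball 0 1" using bounded_kernel_le[OF k, of y] that by (cases "norm y \<le> 1") auto
    then show ?thesis using unit_ball_shift_in_cell[of y P] by (simp add: c_def)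
  qed
  have "(\<integral>\<^sup>+z. ennreal ((norm (\<phi> z))\<^sup>2) \<partial>cell_measure P) = (\<integral>\<^sup>+z. ennreal ((norm (\<phi> (z + (x - c))))\<^sup>2) \<partial>cell_measure P)"
    using per by (intro nn_integral_cell_shift[symmetric]) (auto simp: periodic_def)
  also have "\<dots> = (\<integral>\<^sup>+z. indicator (cell P) z * ennreal ((norm (\<phi> (z + (x - c))))\<^sup>2) \<partial>lborel)"
    unfolding cell_measure_def by (subst nn_integral_density) auto
  also have "\<dots> \<le> (\<integral>\<^sup>+z. ennreal ((norm e)\<^sup>2 * (\<kappa> (z + - c))\<^sup>2) \<partial>lborel)"
    by (intro nn_integral_mono) (auto simp: indicator_def \<phi>s power_mult_distrib mult.commute)
  also have "\<dots> = (\<integral>\<^sup>+z. ennreal ((norm e)\<^sup>2 * (\<kappa> z)\<^sup>2) \<partial>lborel)"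
    by (rule nn_integral_lborel_shift[of "\<lambda>z. ennreal ((norm e)\<^sup>2 * (\<kappa> z)\<^sup>2)"]) simp
  also have "\<dots> < \<infinity>"
    using bounded_kernel_integrable(2)[OF k] by (subst nn_integral_eq_integral) (auto intro: integrable_mult_right)
  finally have "integrable (cell_measure P) (\<lambda>z. (norm (\<phi> z))\<^sup>2)"
    by (intro integrableI_bounded) auto
  then have L2: "L2_field P \<phi>" using per by (simp add: L2_field_def)
  have "smear \<kappa> f x \<bullet> e = (\<integral>z. f z \<bullet> \<phi> z \<partial>cell_measure P)" if f: "L2_field P f" for f
  proof -
    note [measurable] = L2_fieldD(2)[OF f]
    have "(\<integral>z. f z \<bullet> \<phi> z \<partial>cell_measure P) = (\<integral>z. f (z + (x - c)) \<bullet> \<phi> (z + (x - c)) \<partial>cell_measure P)"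
      using per L2_fieldD(1)[OF f] 
      by (intro integral_cell_shift[symmetric, of "\<lambda>z. f z \<bullet> \<phi> z"]) (auto simp: periodic_def)
    also have "\<dots> = (\<integral>z. indicator (cell P) z * (f (z + (x - c)) \<bullet> \<phi> (z + (x - c))) \<partial>lborel)"
    proof -
      have eq: "density lborel (indicator (cell P)) = density lborel (\<lambda>z. ennreal (indicator (cell P) z))"
        by (simp add: ennreal_indicator)
      show ?thesis unfolding cell_measure_def eq
        by (subst integral_density) (auto simp: indicator_def)
    qed
    also have "\<dots> = (\<integral>z. \<kappa> (z + - c) * (f (x + (z + - c)) \<bullet> e) \<partial>lborel)"
    proof (rule Bochner_Integration.integral_cong[OF refl])
      fix z :: "real^3"
      show "indicator (cell P) z * (f (z + (x - c)) \<bullet> \<phi> (z + (x - c))) = \<kappa> (z + - c) * (f (x + (z + - c)) \<bullet> e)"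
        using \<phi>s[of z] supp[of "z - c"] by (cases "z \<in> cell P") (auto simp: algebra_simps)
    qed
    also have "\<dots> = (\<integral>z. \<kappa> z * (f (x + z) \<bullet> e) \<partial>lborel)"
    proof -
      have "(\<integral>z. \<kappa> z * (f (x + z) \<bullet> e) \<partial>lborel) = (\<integral>z. \<kappa> z * (f (x + z) \<bullet> e) \<partial>distr lborel borel ((+) (- c)))"
        by (simp add: lborel_distr_plus)
      also have "\<dots> = (\<integral>z. \<kappa> (z + - c) * (f (x + (z + - c)) \<bullet> e) \<partial>lborel)"
        by (subst integral_distr) (auto simp: algebra_simps)
      finally show ?thesis by simp
    qed
    also have "\<dots> = smear \<kappa> f x \<bullet> e"
      using smear_integrable[OF k f] by (simp add: smear_def flip: integral_inner_left)
    finally show ?thesis by simp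
  qed
  with L2 show thesis by (rule that)
qed

lemma continuous_on_integral_dominated:
  fixes F :: "'b::metric_space \<Rightarrow> 'a \<Rightarrow> real"
  assumes meas: "\<And>t. t \<in> S \<Longrightarrow> F t \<in> borel_measurable M"
    and cont: "\<And>x. continuous_on S (\<lambda>t. F t x)"
    and w: "integrable M w" and bound: "\<And>t x. t \<in> S \<Longrightarrow> \<bar>F t x\<bar> \<le> w x"
  shows "continuous_on S (\<lambda>t. \<integral>x. F t x \<partial>M)"
  unfolding continuous_on_sequentially comp_def
proof (intro allI ballI impI, elim conjE)
  fix X :: "nat \<Rightarrow> 'b" and a assume a: "a \<in> S" and X: "\<forall>n. X n \<in> S" "X \<longlonglongrightarrow> a"
  show "(\<lambda>n. \<integral>x. F (X n) x \<partial>M) \<longlonglongrightarrow> (\<integral>x. F a x \<partial>M)"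
  proof (rule integral_dominated_convergence[where w=w])
    show "AE x in M. (\<lambda>n. F (X n) x) \<longlonglongrightarrow> F a x"
      using cont[unfolded continuous_on_sequentially comp_def] a X by (intro AE_I2) blast
  qed (use a X w meas bound in auto)
qed

text \<open>The flux is quadratic in its first field. Replacing one occurrence at a time leaves a
  factor \<open>f x - g x\<close> in each of two terms, and Cauchy-Schwarz applies to both.\<close>

lemma (in mollifier) flux_diff_left:
  assumes f: "L2_field P f" and g: "L2_field P g" and h: "L2_field P h"
  shows "\<bar>flux P k f h - flux P k g h\<bar> \<le> C * sqrt unit_vol * sqrt (sq_norm P h) *
    ((sqrt (sq_norm P f) + sqrt (sq_norm P g)) * sqrt (sq_norm P (\<lambda>x. f x - g x)))"
proof -
  let ?B = "C * sqrt unit_vol * sqrt (sq_norm P h)"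
  let ?d = "\<lambda>x. f x - g x"
  have d: "L2_field P ?d" by (rule L2_field_diff[OF f g])
  note n = L2_field_integrable_norm_mult[OF d f] L2_field_integrable_norm_mult[OF d g]
  have le: "\<bar>f x \<bullet> smear (\<lambda>y. k y \<bullet> f x) h x - g x \<bullet> smear (\<lambda>y. k y \<bullet> g x) h x\<bar> \<le> ?B * (norm (?d x) * norm (f x) + norm (?d x) * norm (g x))" for x
  proof -
    have lin: "smear (\<lambda>y. k y \<bullet> f x) h x = smear (\<lambda>y. k y \<bullet> g x) h x + smear (\<lambda>y. k y \<bullet> ?d x) h x"
      using smear_integrable[OF kernel_k h, of "g x" x] smear_integrable[OF kernel_k h, of "?d x" x]
      by (simp add: smear_def inner_diff_right scaleR_diff_left flip: Bochner_Integration.integral_add)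
    have "f x \<bullet> smear (\<lambda>y. k y \<bullet> f x) h x - g x \<bullet> smear (\<lambda>y. k y \<bullet> g x) h x 
       = ?d x \<bullet> smear (\<lambda>y. k y \<bullet> f x) h x + g x \<bullet> smear (\<lambda>y. k y \<bullet> ?d x) h x"
      by (simp add: lin inner_diff_left inner_add_right)
    also have "\<bar>\<dots>\<bar> \<le> norm (?d x) * (C * norm (f x) * sqrt unit_vol * sqrt (sq_norm P h)) + norm (g x) * (C * norm (?d x) * sqrt unit_vol * sqrt (sq_norm P h))"
      by (intro order_trans[OF abs_triangle_ineq add_mono] order_trans[OF Cauchy_Schwarz_ineq2 mult_left_mono[OF norm_smear_le[OF kernel_k h]]]) simp_all
    also have "\<dots> = ?B * (norm (?d x) * norm (f x) + norm (?d x) * norm (g x))" by (simp add: algebra_simps)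
    finally show ?thesis .
  qed
  have B: "0 \<le> ?B" using bounded_kernel_nonneg[OF kernel_K] by simp
  have "\<bar>flux P k f h - flux P k g h\<bar> = \<bar>\<integral>x. f x \<bullet> smear (\<lambda>y. k y \<bullet> f x) h x - g x \<bullet> smear (\<lambda>y. k y \<bullet> g x) h x \<partial>cell_measure P\<bar>"
    using flux_integrable[OF f h] flux_integrable[OF g h] by (simp add: flux_def abs_minus_commute)
  also have "\<dots> \<le> (\<integral>x. \<bar>f x \<bullet> smear (\<lambda>y. k y \<bullet> f x) h x - g x \<bullet> smear (\<lambda>y. k y \<bullet> g x) h x\<bar> \<partial>cell_measure P)"
    by (rule integral_abs_bound)
  also have "\<dots> \<le> (\<integral>x. ?B * (norm (?d x) * norm (f x) + norm (?d x) * norm (g x)) \<partial>cell_measure P)"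
    by (intro integral_mono le integrable_abs Bochner_Integration.integrable_diff flux_integrable f g h integrable_mult_right Bochner_Integration.integrable_add n)
  also have "\<dots> = ?B * ((\<integral>x. norm (?d x) * norm (f x) \<partial>cell_measure P) + (\<integral>x. norm (?d x) * norm (g x) \<partial>cell_measure P))"
    using n by simp
  also have "\<dots> \<le> ?B * (sqrt (sq_norm P ?d) * sqrt (sq_norm P f) + sqrt (sq_norm P ?d) * sqrt (sq_norm P g))"
    by (intro mult_left_mono add_mono L2_field_CS_norm d f g B)
  finally show ?thesis by (simp add: algebra_simps)
qed

section \<open>The mollifying sequence and continuity of smeared solutions in time\<close>

definition moll_seq :: "nat \<Rightarrow> real^3 \<Rightarrow> real" where
  "moll_seq n = moll (1 / real (Suc n))"

lemma moll_seq_mollifier: "mollifier (moll_seq n) (moll_grad (1 / real (Suc n))) 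
    (64 / (1 / real (Suc n) * measure lborel (cball (0::real^3) (1 / real (Suc n)))))"
  unfolding moll_seq_def by (rule mollifier_moll) auto

lemma moll_seq_kernel: "bounded_kernel (64 / (1 / real (Suc n) * measure lborel (cball (0::real^3) (1 / real (Suc n))))) (moll_seq n)"
  by (rule mollifier.kernel_K[OF moll_seq_mollifier])

lemma moll_seq_integral: "(\<integral>y. moll_seq n y \<partial>lborel) = 1"
  unfolding moll_seq_def by (rule moll_integral) simp

lemma moll_seq_nonneg: "0 \<le> moll_seq n y"
  unfolding moll_seq_def by (rule moll_nonneg) simp

lemma smear_moll_seq_tendsto:
  assumes "solenoidal P f"
  shows "(\<lambda>n. sq_norm P (\<lambda>x. smear (moll_seq n) f x - f x)) \<longlonglongrightarrow> 0"
proof (rule smear_minus_self_tendsto[OF solenoidal_L2[OF assms] solenoidal_translation_tendsto[OF assms] moll_seq_kernel moll_seq_nonneg moll_seq_integral])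
  show "moll_seq n y \<noteq> 0 \<Longrightarrow> norm y \<le> 1 / real (Suc n)" for n y
    unfolding moll_seq_def by (rule moll_support) auto
  show "(\<lambda>n. 1 / real (Suc n)) \<longlonglongrightarrow> 0" by (rule LIMSEQ_Suc[OF lim_1_over_n])
qed

lemma sq_norm_smear_moll_seq_le: "L2_field P f \<Longrightarrow> sq_norm P (smear (moll_seq n) f) \<le> sq_norm P f"
  using sq_norm_smear_le[OF moll_seq_kernel, of P f n] moll_seq_integral[of n] moll_seq_nonneg[of n] by simp

text \<open>What is extracted from a weak Euler solution: the equation for time-independent test
  fields of the form \<open>smear K \<phi>\<close>, with the nonlinear term written as a flux. The
  integrability premise reflects \<open>weak_terms_exist\<close>; it is discharged later by
  measurability and boundedness of the flux in time.\<close>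

locale weak_solution =
  fixes P :: "3 set" and T :: real and v :: "real \<Rightarrow> real^3 \<Rightarrow> real^3"
  assumes T: "T > 0"
    and sol: "\<And>t. t \<in> {0..T} \<Longrightarrow> solenoidal P (v t)"
    and weakc: "\<And>\<phi>. L2_field P \<phi> \<Longrightarrow> continuous_on {0..T} (\<lambda>t. \<integral>x. v t x \<bullet> \<phi> x \<partial>cell_measure P)"
    and weak: "\<And>K k C \<phi> t. mollifier K k C \<Longrightarrow> \<phi> \<in> test_fields_sigma P \<Longrightarrow> t \<in> {0..T} \<Longrightarrow>
        integrable (lebesgue_on {0..t}) (\<lambda>\<tau>. flux P k (v \<tau>) \<phi>) \<Longrightarrow>
        (\<integral>x. v t x \<bullet> smear K \<phi> x \<partial>cell_measure P) - (\<integral>x. v 0 x \<bullet> smear K \<phi> x \<partial>cell_measure P)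
          = (LINT \<tau>|lebesgue_on {0..t}. flux P k (v \<tau>) \<phi>)"
begin

lemmas L2 = solenoidal_L2[OF sol]

text \<open>Each pairing is continuous on a compact interval, hence bounded, and uniform boundedness
  applies.\<close>

lemma bounded_energy: "\<exists>M\<ge>0. \<forall>t\<in>{0..T}. sq_norm P (v t) \<le> M"
proof -
  have "\<exists>M. \<forall>t\<in>{0..T}. sq_norm P (v t) \<le> M"
  proof (rule L2_uniform_boundedness[OF L2])
    fix \<phi> assume "L2_field P \<phi>"
    from continuous_on_compact_bound[OF compact_Icc weakc[OF this]]
    show "\<exists>B. \<forall>t\<in>{0..T}. \<bar>\<integral>x. v t x \<bullet> \<phi> x \<partial>cell_measure P\<bar> \<le> B" by (metis real_norm_def)
  qed
  then obtain M where "\<forall>t\<in>{0..T}. sq_norm P (v t) \<le> M" by blast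
  then show ?thesis by (intro exI[of _ "max M 0"]) auto
qed

definition M where "M = (SOME M. M \<ge> 0 \<and> (\<forall>t\<in>{0..T}. sq_norm P (v t) \<le> M))"

lemma M: "M \<ge> 0" "\<And>t. t \<in> {0..T} \<Longrightarrow> sq_norm P (v t) \<le> M"
  using someI_ex[of "\<lambda>M. M \<ge> 0 \<and> (\<forall>t\<in>{0..T}. sq_norm P (v t) \<le> M)"] bounded_energy
  unfolding M_def by auto

lemma smear_time_continuous:
  assumes "bounded_kernel C \<kappa>"
  shows "continuous_on {0..T} (\<lambda>t. smear \<kappa> (v t) x)"
  unfolding continuous_on_componentwise[of "{0..T}" "\<lambda>t. smear \<kappa> (v t) x"]
proof
  fix e :: "real^3"
  obtain \<phi> where \<phi>: "L2_field P \<phi>" 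
    "\<And>f. L2_field P f \<Longrightarrow> smear \<kappa> f x \<bullet> e = (\<integral>z. f z \<bullet> \<phi> z \<partial>cell_measure P)" 
    by (rule smear_as_pairing[OF assms, where P=P and x=x and e=e]) blast
  show "continuous_on {0..T} (\<lambda>t. smear \<kappa> (v t) x \<bullet> e)"
    by (subst continuous_on_cong[OF refl \<phi>(2)[OF L2]]) (auto intro: weakc[OF \<phi>(1)])
qed

end

locale mollified_solution = weak_solution P T v + mollifier K k C for P T v K k C
begin

text \<open>Two times are kept apart: \<open>\<tau>\<close> is the variable of integration,
  \<open>s\<close> the time at which the test field is frozen.\<close>

definition G where "G s \<tau> = flux P k (v \<tau>) (v s)"

lemma bound_flux:
  assumes "\<tau> \<in> {0..T}" "L2_field P g"
  shows "\<bar>flux P k (v \<tau>) g\<bar> \<le> C * sqrt unit_vol * sqrt (sq_norm P g) * M"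
  by (rule order_trans[OF flux_le[OF L2[OF assms(1)] assms(2)] mult_left_mono[OF M(2)[OF assms(1)]]])
    (use bounded_kernel_nonneg[OF kernel_K] in simp)

text \<open>The flux is quadratic in \<open>v \<tau>\<close>, so weak continuity does not make it
  continuous in \<open>\<tau>\<close>. With \<open>v \<tau>\<close> mollified it is continuous, and
  removing the mollification gives a pointwise limit of continuous functions of time.\<close>

lemma flux_test_measurable:
  assumes \<phi>: "\<phi> \<in> test_fields_sigma P"
  shows "(\<lambda>\<tau>. flux P k (v \<tau>) \<phi>) \<in> borel_measurable (lebesgue_on {0..T})"
proof (rule borel_measurable_LIMSEQ_metric)
  let ?f = "\<lambda>n \<tau>. smear (moll_seq n) (v \<tau>)"
  note L\<phi> = test_fields_sigma_L2[OF \<phi>]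
  have [measurable]: "\<phi> \<in> borel_measurable borel" by (rule L2_fieldD(2)[OF L\<phi>])
  have per: "periodic P \<phi>" by (rule L2_fieldD(1)[OF L\<phi>])
  have C0: "0 \<le> C" by (rule bounded_kernel_nonneg[OF kernel_K])
  \<comment> \<open>The majorant in space. For fixed \<open>n\<close> the mollified fields are
    bounded by one constant at all times, so integrability has to come from the test field, averaged
    here over unit balls.\<close>
  define \<Phi> where "\<Phi> x = (\<integral>y. indicator (cball 0 1) y * norm (\<phi> (x + y)) \<partial>lborel)" for x
  have int1: "integrable (cell_measure P) \<Phi>"
    unfolding \<Phi>_def
  proof (rule cell_pair_integrable_outer)
    show "integrable (cell_measure P \<Otimes>\<^sub>M lborel) (\<lambda>(x, y). indicator (cball 0 1) y * norm (\<phi> (x + y)))"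
    proof (rule integrable_cell_pair[where w="\<lambda>x. norm (\<phi> x)"])
      show "integrable (cell_measure P) (\<lambda>x. norm (\<phi> x))"
        using \<phi> by (auto simp: test_fields_sigma_def intro: test_fields_L2)
      show "periodic P (\<lambda>x. norm (\<phi> x))" using per by (simp add: periodic_def)
    qed (auto simp: indicator_def)
  qed
  show "(\<lambda>\<tau>. flux P k (?f n \<tau>) \<phi>) \<in> borel_measurable (lebesgue_on {0..T})" for n
  proof (rule continuous_imp_measurable_on_sets_lebesgue)
    define Cn where "Cn = 64 / (1 / real (Suc n) * measure lborel (cball (0::real^3) (1 / real (Suc n))))"
    have kn: "bounded_kernel Cn (moll_seq n)" unfolding Cn_def by (rule moll_seq_kernel)
    define Q where "Q = Cn * sqrt unit_vol * sqrt M"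
    have Q: "norm (?f n \<tau> x) \<le> Q" if "\<tau> \<in> {0..T}" for \<tau> x
      unfolding Q_def
      by (rule order_trans[OF norm_smear_le[OF kn L2[OF that]]]) 
        (use M(2)[OF that] bounded_kernel_nonneg[OF kn] in \<open>auto intro!: mult_left_mono\<close>)
    have "continuous_on {0..T} (\<lambda>\<tau>. \<integral>x. ?f n \<tau> x \<bullet> smear (\<lambda>y. k y \<bullet> ?f n \<tau> x) \<phi> x \<partial>cell_measure P)"
    proof (rule continuous_on_integral_dominated[where w="\<lambda>x. Q * (C * Q) * \<Phi> x"])
      show "integrable (cell_measure P) (\<lambda>x. Q * (C * Q) * \<Phi> x)" using int1 by (rule integrable_mult_right)
    next
      fix \<tau> assume \<tau>: "\<tau> \<in> {0..T}"
      show "(\<lambda>x. ?f n \<tau> x \<bullet> smear (\<lambda>y. k y \<bullet> ?f n \<tau> x) \<phi> x) \<in> borel_measurable (cell_measure P)"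
        using flux_integrand_measurable[OF smear_measurable[OF bounded_kernel_measurable[OF kn] L2_fieldD(2)[OF L2[OF \<tau>]]], of \<phi>] by simp
      fix x
      have "norm (smear (\<lambda>y. k y \<bullet> ?f n \<tau> x) \<phi> x) \<le> (\<integral>y. (C * Q) * (indicator (cball 0 1) y * norm (\<phi> (x + y))) \<partial>lborel)"
        unfolding smear_def[of "\<lambda>y. k y \<bullet> ?f n \<tau> x"]
      proof (rule order_trans[OF integral_norm_bound integral_mono])
        show "integrable lborel (\<lambda>y. norm ((k y \<bullet> ?f n \<tau> x) *\<^sub>R \<phi> (x + y)))" 
          by (rule integrable_norm[OF smear_integrable[OF kernel_k L\<phi>]])
        have "bounded_kernel 1 (indicator (cball 0 1))" by (simp add: bounded_kernel_def)
        from integrable_norm[OF smear_integrable[OF this L\<phi>, of x]]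
        show "integrable lborel (\<lambda>y. (C * Q) * (indicator (cball 0 1) y * norm (\<phi> (x + y))))"
          by (intro integrable_mult_right) simp
        fix y
        have "\<bar>k y \<bullet> ?f n \<tau> x\<bar> \<le> (C * indicator (cball 0 1) y) * Q"
          using C0 by (intro order_trans[OF Cauchy_Schwarz_ineq2] mult_mono k_bound Q \<tau>) auto
        then have "\<bar>k y \<bullet> ?f n \<tau> x\<bar> * norm (\<phi> (x + y)) \<le> (C * indicator (cball 0 1) y) * Q * norm (\<phi> (x + y))"
          by (intro mult_right_mono) auto
        then show "norm ((k y \<bullet> ?f n \<tau> x) *\<^sub>R \<phi> (x + y)) \<le> (C * Q) * (indicator (cball 0 1) y * norm (\<phi> (x + y)))"
          by (simp add: mult_ac)
      qed
      also have "\<dots> = C * Q * \<Phi> x" by (simp add: \<Phi>_def)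
      finally have le: "norm (smear (\<lambda>y. k y \<bullet> ?f n \<tau> x) \<phi> x) \<le> C * Q * \<Phi> x" .
      have Q0: "0 \<le> Q" using Q[OF \<tau>, of x] norm_ge_zero order_trans by blast
      have "\<bar>?f n \<tau> x \<bullet> smear (\<lambda>y. k y \<bullet> ?f n \<tau> x) \<phi> x\<bar> \<le> Q * (C * Q * \<Phi> x)"
        by (rule order_trans[OF Cauchy_Schwarz_ineq2 mult_mono[OF Q[OF \<tau>] le Q0]]) simp
      then show "\<bar>?f n \<tau> x \<bullet> smear (\<lambda>y. k y \<bullet> ?f n \<tau> x) \<phi> x\<bar> \<le> Q * (C * Q) * \<Phi> x"
        by (simp add: mult.assoc)
    next
      fix x
      have fc: "continuous_on {0..T} (\<lambda>\<tau>. ?f n \<tau> x)" by (rule smear_time_continuous[OF kn])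
      \<comment> \<open>Linearity in \<open>a\<close> separates the dependence on time into finitely
        many continuous coefficients.\<close>
      have eq: "smear (\<lambda>y. k y \<bullet> a) \<phi> x = (\<Sum>i\<in>UNIV. a $ i *\<^sub>R smear (\<lambda>y. k y \<bullet> axis i 1) \<phi> x)" for a
      proof -
        have "(k y \<bullet> a) *\<^sub>R \<phi> (x + y) = (\<Sum>i\<in>UNIV. a $ i *\<^sub>R ((k y \<bullet> axis i 1) *\<^sub>R \<phi> (x + y)))" for y
        proof -
          have "k y \<bullet> a = (\<Sum>i\<in>UNIV. a $ i * (k y \<bullet> axis i 1))"
            unfolding inner_axis by (simp add: inner_vec_def mult.commute)
          then show ?thesis by (simp add: scaleR_sum_left)
        qed
        note e = this
        have int: "integrable lborel (\<lambda>y. a $ i *\<^sub>R ((k y \<bullet> axis i 1) *\<^sub>R \<phi> (x + y)))" for i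
          by (intro integrable_scaleR_right smear_integrable[OF kernel_k L\<phi>])
        have "smear (\<lambda>y. k y \<bullet> a) \<phi> x = (\<integral>y. (\<Sum>i\<in>UNIV. a $ i *\<^sub>R ((k y \<bullet> axis i 1) *\<^sub>R \<phi> (x + y))) \<partial>lborel)"
          unfolding smear_def by (rule Bochner_Integration.integral_cong[OF refl e])
        also have "\<dots> = (\<Sum>i\<in>UNIV. (\<integral>y. a $ i *\<^sub>R ((k y \<bullet> axis i 1) *\<^sub>R \<phi> (x + y)) \<partial>lborel))"
          by (rule Bochner_Integration.integral_sum[OF int])
        also have "\<dots> = (\<Sum>i\<in>UNIV. a $ i *\<^sub>R smear (\<lambda>y. k y \<bullet> axis i 1) \<phi> x)"
          unfolding smear_def by (rule sum.cong[OF refl integral_scaleR_right])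
        finally show ?thesis .
      qed
      show "continuous_on {0..T} (\<lambda>\<tau>. ?f n \<tau> x \<bullet> smear (\<lambda>y. k y \<bullet> ?f n \<tau> x) \<phi> x)"
      proof (rule continuous_on_eq)
        show "continuous_on {0..T} (\<lambda>\<tau>. ?f n \<tau> x \<bullet> (\<Sum>i\<in>UNIV. ?f n \<tau> x $ i *\<^sub>R smear (\<lambda>y. k y \<bullet> axis i 1) \<phi> x))"
          by (intro continuous_intros fc)
      qed (rule arg_cong[OF eq[symmetric]])
    qed
    then show "continuous_on {0..T} (\<lambda>\<tau>. flux P k (?f n \<tau>) \<phi>)"
      unfolding flux_def by (intro continuous_intros)
  qed simp
  fix \<tau> assume "\<tau> \<in> space (lebesgue_on {0..T})"
  then have \<tau>: "\<tau> \<in> {0..T}" by simp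
  note f = L2_field_smear[OF moll_seq_kernel L2[OF \<tau>]]
  show "(\<lambda>n. flux P k (?f n \<tau>) \<phi>) \<longlonglongrightarrow> flux P k (v \<tau>) \<phi>"
  proof (rule Lim_transform[OF tendsto_const], rule Lim_null_comparison)
    let ?B = "C * sqrt unit_vol * sqrt (sq_norm P \<phi>)"
    show "\<forall>\<^sub>F n in sequentially. norm (flux P k (?f n \<tau>) \<phi> - flux P k (v \<tau>) \<phi>) 
        \<le> ?B * ((sqrt M + sqrt M) * sqrt (sq_norm P (\<lambda>x. ?f n \<tau> x - v \<tau> x)))"
    proof (intro always_eventually allI)
      fix n
      have "sqrt (sq_norm P (?f n \<tau>)) \<le> sqrt M" "sqrt (sq_norm P (v \<tau>)) \<le> sqrt M"
        using order_trans[OF sq_norm_smear_moll_seq_le[OF L2[OF \<tau>]] M(2)[OF \<tau>]] M(2)[OF \<tau>] by auto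
      then show "norm (flux P k (?f n \<tau>) \<phi> - flux P k (v \<tau>) \<phi>) 
        \<le> ?B * ((sqrt M + sqrt M) * sqrt (sq_norm P (\<lambda>x. ?f n \<tau> x - v \<tau> x)))"
        unfolding real_norm_def
        by (intro order_trans[OF flux_diff_left[OF f L2[OF \<tau>] L\<phi>]] mult_left_mono mult_right_mono add_mono) (auto simp: C0)
    qed
    have "(\<lambda>n. ?B * ((sqrt M + sqrt M) * sqrt (sq_norm P (\<lambda>x. ?f n \<tau> x - v \<tau> x)))) \<longlonglongrightarrow> ?B * ((sqrt M + sqrt M) * sqrt 0)"
      by (intro tendsto_intros smear_moll_seq_tendsto sol \<tau>)
    then show "(\<lambda>n. ?B * ((sqrt M + sqrt M) * sqrt (sq_norm P (\<lambda>x. ?f n \<tau> x - v \<tau> x)))) \<longlonglongrightarrow> 0" by simp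
  qed
qed

end


section \<open>The energy balance of the mollified field\<close>

text \<open>All time integrals are moved to the measure on \<open>{0..T}\<close>, so that one
  measure serves every \<open>t\<close>, every partition and every limit.\<close>

lemma integral_lebesgue_on_sub:
  fixes f :: "real \<Rightarrow> real"
  assumes "t \<le> T"
  shows "(LINT \<tau>|lebesgue_on {0..t}. f \<tau>) = (LINT \<tau>|lebesgue_on {0..T}. indicator {0..t} \<tau> * f \<tau>)"
    and "integrable (lebesgue_on {0..t}) f \<longleftrightarrow> integrable (lebesgue_on {0..T}) (\<lambda>\<tau>. indicator {0..t} \<tau> * f \<tau>)"
proof -
  have eq: "indicator {0..T} \<tau> * (indicator {0..t} \<tau> * f \<tau>) = indicator {0..t} \<tau> * f \<tau>" for \<tau>
    using assms by (auto simp: indicator_def)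
  show "(LINT \<tau>|lebesgue_on {0..t}. f \<tau>) = (LINT \<tau>|lebesgue_on {0..T}. indicator {0..t} \<tau> * f \<tau>)"
    by (simp add: integral_restrict_space eq)
  show "integrable (lebesgue_on {0..t}) f \<longleftrightarrow> integrable (lebesgue_on {0..T}) (\<lambda>\<tau>. indicator {0..t} \<tau> * f \<tau>)"
    by (simp add: integrable_restrict_space eq)
qed

lemma integrable_lebesgue_on_Icc_bounded:
  fixes f :: "real \<Rightarrow> real"
  assumes "f \<in> borel_measurable (lebesgue_on {0..T})" "\<And>\<tau>. \<tau> \<in> {0..T} \<Longrightarrow> \<bar>f \<tau>\<bar> \<le> B"
  shows "integrable (lebesgue_on {0..T}) f"
proof -
  have "finite_measure (lebesgue_on {0..T})" by (rule finite_measure_lebesgue_on) simp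
  then show ?thesis
    by (rule finite_measure.integrable_const_bound[where B=B]) (use assms in \<open>auto intro: AE_I2\<close>)
qed

lemma indicator_measurable_lebesgue_on:
  "A \<in> sets borel \<Longrightarrow> (indicator A :: real \<Rightarrow> real) \<in> borel_measurable (lebesgue_on S)"
  by (intro measurable_restrict_space1 borel_measurable_indicator) auto

lemma integrable_indicator_mult_lebesgue_on:
  fixes f :: "real \<Rightarrow> real"
  assumes f: "integrable (lebesgue_on S) f" and A: "A \<in> sets borel"
  shows "integrable (lebesgue_on S) (\<lambda>\<tau>. indicator A \<tau> * f \<tau>)"
proof (rule Bochner_Integration.integrable_bound[OF f])
  show "(\<lambda>\<tau>. indicator A \<tau> * f \<tau>) \<in> borel_measurable (lebesgue_on S)"
    by (intro borel_measurable_times indicator_measurable_lebesgue_on A borel_measurable_integrable[OF f])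
qed (auto intro!: AE_I2 simp: indicator_def)

context mollified_solution
begin

abbreviation time_measure where "time_measure \<equiv> lebesgue_on {0..T}"

text \<open>On the diagonal this is the mollified energy; off the diagonal one time can vary while
  the other is frozen.\<close>

definition cross where "cross t s = (\<integral>x. v t x \<bullet> smear K (v s) x \<partial>cell_measure P)"

lemma cross_sym:
  assumes "t \<in> {0..T}" "s \<in> {0..T}"
  shows "cross t s = cross s t"
  unfolding cross_def smear_symmetric[OF kernel_K K_even L2[OF assms(1)] L2[OF assms(2)]] 
  by (simp add: inner_commute)

lemma weak_identity_test:
  assumes \<phi>: "\<phi> \<in> test_fields_sigma P" and t: "t \<in> {0..T}"
  shows "(\<integral>x. v t x \<bullet> smear K \<phi> x \<partial>cell_measure P) - (\<integral>x. v 0 x \<bullet> smear K \<phi> x \<partial>cell_measure P)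
          = (LINT \<tau>|time_measure. indicator {0..t} \<tau> * flux P k (v \<tau>) \<phi>)"
proof -
  have "integrable time_measure (\<lambda>\<tau>. flux P k (v \<tau>) \<phi>)"
    by (rule integrable_lebesgue_on_Icc_bounded[OF flux_test_measurable[OF \<phi>] bound_flux[OF _ test_fields_sigma_L2[OF \<phi>]]])
  then have "integrable time_measure (\<lambda>\<tau>. indicator {0..t} \<tau> * flux P k (v \<tau>) \<phi>)"
    by (rule integrable_indicator_mult_lebesgue_on) simp
  then have "integrable (lebesgue_on {0..t}) (\<lambda>\<tau>. flux P k (v \<tau>) \<phi>)"
    using integral_lebesgue_on_sub(2)[of t T] t by simp
  from weak[OF mollifier_axioms \<phi> t this] show ?thesis
    using integral_lebesgue_on_sub(1)[of t T] t by simp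
qed

text \<open>The equation tested with the mollified \<open>v s\<close>. Approximating
  \<open>v s\<close> by test fields in L^2 is harmless, since the pairings are continuous in the
  test field and the flux is so uniformly in \<open>\<tau>\<close>.\<close>

lemma G_measurable_identity:
  assumes s: "s \<in> {0..T}"
  shows "G s \<in> borel_measurable time_measure"
    and "t \<in> {0..T} \<Longrightarrow> cross t s - cross 0 s = (LINT \<tau>|time_measure. indicator {0..t} \<tau> * G s \<tau>)"
proof -
  from solenoidal_approx[OF sol[OF s]] obtain \<phi> where \<phi>: "\<And>n::nat. \<phi> n \<in> test_fields_sigma P" 
    and lim: "(\<lambda>n. sq_norm P (\<lambda>x. v s x - \<phi> n x)) \<longlonglongrightarrow> 0" by blast
  note L\<phi> = test_fields_sigma_L2[OF \<phi>]
  note Ls = L2[OF s]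
  let ?B = "\<lambda>n. C * sqrt unit_vol * sqrt (sq_norm P (\<lambda>x. v s x - \<phi> n x)) * M"
  have lim_sqrt: "(\<lambda>n. c * sqrt (sq_norm P (\<lambda>x. v s x - \<phi> n x)) * d) \<longlonglongrightarrow> 0" for c d
  proof -
    have "(\<lambda>n. c * sqrt (sq_norm P (\<lambda>x. v s x - \<phi> n x)) * d) \<longlonglongrightarrow> c * sqrt 0 * d"
      by (intro tendsto_intros lim)
    then show ?thesis by simp
  qed
  have le: "\<bar>G s \<tau> - flux P k (v \<tau>) (\<phi> n)\<bar> \<le> ?B n" if "\<tau> \<in> {0..T}" for \<tau> n
    unfolding G_def flux_diff[OF L2[OF that] Ls L\<phi>]
    by (rule bound_flux[OF that L2_field_diff[OF Ls L\<phi>]])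
  have conv: "(\<lambda>n. flux P k (v \<tau>) (\<phi> n)) \<longlonglongrightarrow> G s \<tau>" if "\<tau> \<in> {0..T}" for \<tau>
  proof (rule Lim_transform2[OF tendsto_const], rule Lim_null_comparison)
    show "\<forall>\<^sub>F n in sequentially. norm (G s \<tau> - flux P k (v \<tau>) (\<phi> n)) \<le> ?B n"
      using le[OF that] by (intro always_eventually) simp
  qed (rule lim_sqrt)
  show meas: "G s \<in> borel_measurable time_measure"
    by (rule borel_measurable_LIMSEQ_metric[OF flux_test_measurable[OF \<phi>]]) (use conv in simp)
  assume t: "t \<in> {0..T}"
  obtain B where B: "\<And>n. \<bar>?B n\<bar> \<le> B"
    using convergent_imp_Bseq[OF convergentI[OF lim_sqrt[of "C * sqrt unit_vol" M]]] unfolding Bseq_def by (metis real_norm_def)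
  have "(\<lambda>n. LINT \<tau>|time_measure. indicator {0..t} \<tau> * flux P k (v \<tau>) (\<phi> n)) \<longlonglongrightarrow> (LINT \<tau>|time_measure. indicator {0..t} \<tau> * G s \<tau>)"
  proof (rule integral_dominated_convergence[where w="\<lambda>\<tau>. \<bar>G s \<tau>\<bar> + B"])
    have ind: "(indicator {0..t} :: real \<Rightarrow> real) \<in> borel_measurable time_measure"
      by (rule indicator_measurable_lebesgue_on) simp
    show "(\<lambda>\<tau>. indicator {0..t} \<tau> * flux P k (v \<tau>) (\<phi> n)) \<in> borel_measurable time_measure" for n
      by (intro borel_measurable_times ind flux_test_measurable \<phi>)
    show "(\<lambda>\<tau>. indicator {0..t} \<tau> * G s \<tau>) \<in> borel_measurable time_measure" 
      by (intro borel_measurable_times ind meas)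
    have "integrable time_measure (G s)"
      unfolding G_def by (rule integrable_lebesgue_on_Icc_bounded[OF meas[unfolded G_def] bound_flux[OF _ Ls]])
    moreover have "integrable time_measure (\<lambda>_. B)"
      by (rule integrable_lebesgue_on_Icc_bounded[where B="\<bar>B\<bar>"]) auto
    ultimately show "integrable time_measure (\<lambda>\<tau>. \<bar>G s \<tau>\<bar> + B)"
      by (intro Bochner_Integration.integrable_add integrable_abs)
    show "AE \<tau> in time_measure. (\<lambda>n. indicator {0..t} \<tau> * flux P k (v \<tau>) (\<phi> n)) \<longlonglongrightarrow> indicator {0..t} \<tau> * G s \<tau>"
      by (intro AE_I2 tendsto_intros conv) simp
    show "AE \<tau> in time_measure. norm (indicator {0..t} \<tau> * flux P k (v \<tau>) (\<phi> n)) \<le> \<bar>G s \<tau>\<bar> + B" for n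
    proof (rule AE_I2)
      fix \<tau> assume "\<tau> \<in> space time_measure"
      then have "\<bar>flux P k (v \<tau>) (\<phi> n)\<bar> \<le> \<bar>G s \<tau>\<bar> + B"
        using le[of \<tau> n] B[of n] by simp
      moreover have "norm (indicator {0..t} \<tau> * flux P k (v \<tau>) (\<phi> n)) \<le> \<bar>flux P k (v \<tau>) (\<phi> n)\<bar>"
        by (auto simp: indicator_def)
      ultimately show "norm (indicator {0..t} \<tau> * flux P k (v \<tau>) (\<phi> n)) \<le> \<bar>G s \<tau>\<bar> + B" by linarith
    qed
  qed
  moreover have pconv: "(\<lambda>n. \<integral>x. v r x \<bullet> smear K (\<phi> n) x \<partial>cell_measure P) \<longlonglongrightarrow> cross r s" if r: "r \<in> {0..T}" for r
  proof (rule Lim_transform2[OF tendsto_const], rule Lim_null_comparison)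
    note Lr = L2[OF r]
    let ?I = "\<integral>y. \<bar>K y\<bar> \<partial>lborel"
    have I0: "0 \<le> ?I" by simp
    show "\<forall>\<^sub>F n in sequentially. norm (cross r s - (\<integral>x. v r x \<bullet> smear K (\<phi> n) x \<partial>cell_measure P)) 
       \<le> (sqrt (sq_norm P (v r)) * ?I) * sqrt (sq_norm P (\<lambda>x. v s x - \<phi> n x)) * 1"
    proof (intro always_eventually allI)
      fix n
      note d = L2_field_diff[OF Ls L\<phi>[of n]]
      have "cross r s - (\<integral>x. v r x \<bullet> smear K (\<phi> n) x \<partial>cell_measure P) = (\<integral>x. v r x \<bullet> smear K (\<lambda>x. v s x - \<phi> n x) x \<partial>cell_measure P)"
        using L2_field_integrable_inner[OF Lr L2_field_smear[OF kernel_K Ls]] L2_field_integrable_inner[OF Lr L2_field_smear[OF kernel_K L\<phi>]]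
        by (simp add: cross_def smear_diff[OF kernel_K Ls L\<phi>] inner_diff_right)
      also have "\<bar>\<dots>\<bar> \<le> sqrt (sq_norm P (v r)) * sqrt (sq_norm P (smear K (\<lambda>x. v s x - \<phi> n x)))"
        by (rule L2_field_CS[OF Lr L2_field_smear[OF kernel_K d]])
      also have "\<dots> \<le> sqrt (sq_norm P (v r)) * (?I * sqrt (sq_norm P (\<lambda>x. v s x - \<phi> n x)))"
      proof (rule mult_left_mono)
        have "sqrt (sq_norm P (smear K (\<lambda>x. v s x - \<phi> n x))) \<le> sqrt (?I\<^sup>2 * sq_norm P (\<lambda>x. v s x - \<phi> n x))"
          by (rule real_sqrt_le_mono[OF sq_norm_smear_le[OF kernel_K d]])
        also have "\<dots> = ?I * sqrt (sq_norm P (\<lambda>x. v s x - \<phi> n x))"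
          unfolding real_sqrt_mult using I0 by simp
        finally show "sqrt (sq_norm P (smear K (\<lambda>x. v s x - \<phi> n x))) \<le> ?I * sqrt (sq_norm P (\<lambda>x. v s x - \<phi> n x))" .
      qed simp
      finally show "norm (cross r s - (\<integral>x. v r x \<bullet> smear K (\<phi> n) x \<partial>cell_measure P)) 
       \<le> (sqrt (sq_norm P (v r)) * ?I) * sqrt (sq_norm P (\<lambda>x. v s x - \<phi> n x)) * 1"
        by (simp add: mult.assoc)
    qed
  qed (rule lim_sqrt)
  have "(\<lambda>n. LINT \<tau>|time_measure. indicator {0..t} \<tau> * flux P k (v \<tau>) (\<phi> n)) \<longlonglongrightarrow> cross t s - cross 0 s"
    unfolding weak_identity_test[OF \<phi> t, symmetric]
    by (intro tendsto_diff pconv t) (use T in simp)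
  ultimately show "cross t s - cross 0 s = (LINT \<tau>|time_measure. indicator {0..t} \<tau> * G s \<tau>)"
    using LIMSEQ_unique by blast
qed

lemma G_bound:
  assumes "s \<in> {0..T}" "\<tau> \<in> {0..T}"
  shows "\<bar>G s \<tau>\<bar> \<le> C * sqrt unit_vol * sqrt M * M"
  unfolding G_def
  by (rule order_trans[OF bound_flux[OF assms(2) L2[OF assms(1)]]])
    (use M bounded_kernel_nonneg[OF kernel_K] assms in \<open>auto intro!: mult_right_mono mult_left_mono\<close>)

lemma G_integrable: "s \<in> {0..T} \<Longrightarrow> integrable time_measure (G s)"
  by (rule integrable_lebesgue_on_Icc_bounded[OF G_measurable_identity(1) G_bound]) 

text \<open>In \<open>s\<close>, unlike in \<open>\<tau>\<close>, the flux is linear, so weak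
  continuity and the uniform energy bound suffice.\<close>

lemma G_continuous:
  assumes \<tau>: "\<tau> \<in> {0..T}"
  shows "continuous_on {0..T} (\<lambda>s. G s \<tau>)"
proof -
  have "continuous_on {0..T} (\<lambda>s. \<integral>x. v \<tau> x \<bullet> smear (\<lambda>y. k y \<bullet> v \<tau> x) (v s) x \<partial>cell_measure P)"
  proof (rule continuous_on_integral_dominated[where w="\<lambda>x. C * sqrt unit_vol * sqrt M * (norm (v \<tau> x))\<^sup>2"])
    show "integrable (cell_measure P) (\<lambda>x. C * sqrt unit_vol * sqrt M * (norm (v \<tau> x))\<^sup>2)"
      using L2_fieldD(3)[OF L2[OF \<tau>]] by (rule integrable_mult_right)
    show "(\<lambda>x. v \<tau> x \<bullet> smear (\<lambda>y. k y \<bullet> v \<tau> x) (v s) x) \<in> borel_measurable (cell_measure P)" if "s \<in> {0..T}" for s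
      using flux_integrand_measurable[OF L2_fieldD(2)[OF L2[OF \<tau>]] L2_fieldD(2)[OF L2[OF that]]] by simp
    show "continuous_on {0..T} (\<lambda>s. v \<tau> x \<bullet> smear (\<lambda>y. k y \<bullet> v \<tau> x) (v s) x)" for x
      by (intro continuous_intros smear_time_continuous[OF kernel_k])
    show "\<bar>v \<tau> x \<bullet> smear (\<lambda>y. k y \<bullet> v \<tau> x) (v s) x\<bar> \<le> C * sqrt unit_vol * sqrt M * (norm (v \<tau> x))\<^sup>2" if "s \<in> {0..T}" for s x
      by (rule order_trans[OF flux_integrand_le[OF L2[OF that]]])
        (use M(2)[OF that] bounded_kernel_nonneg[OF kernel_K] in \<open>auto intro!: mult_right_mono mult_left_mono\<close>)
  qed
  then show ?thesis unfolding G_def flux_def by (intro continuous_intros)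
qed

text \<open>By symmetry of \<open>cross\<close> the diagonal increment is the increment in the first
  argument with the second frozen at \<open>b\<close>, plus the one with the second frozen at
  \<open>a\<close>. The half-open interval is the difference of \<open>{0..b}\<close> and
  \<open>{0..a}\<close>, and such intervals tile without overlap.\<close>

lemma energy_increment:
  assumes "0 \<le> a" "a \<le> b" "b \<le> T"
  shows "cross b b - cross a a = (LINT \<tau>|time_measure. indicator {a<..b} \<tau> * (G a \<tau> + G b \<tau>))"
proof -
  have ab: "a \<in> {0..T}" "b \<in> {0..T}" using assms by auto
  have 1: "integrable time_measure (\<lambda>\<tau>. indicator A \<tau> * G s \<tau>)" if "A \<in> sets borel" "s \<in> {0..T}" for A s
    by (rule integrable_indicator_mult_lebesgue_on[OF G_integrable[OF that(2)] that(1)])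
  have d: "cross b s - cross a s = (LINT \<tau>|time_measure. indicator {a<..b} \<tau> * G s \<tau>)" if s: "s \<in> {0..T}" for s
  proof -
    have "cross b s - cross a s = (LINT \<tau>|time_measure. indicator {0..b} \<tau> * G s \<tau>) - (LINT \<tau>|time_measure. indicator {0..a} \<tau> * G s \<tau>)"
      using G_measurable_identity(2)[OF s ab(1)] G_measurable_identity(2)[OF s ab(2)] by simp
    also have "\<dots> = (LINT \<tau>|time_measure. indicator {0..b} \<tau> * G s \<tau> - indicator {0..a} \<tau> * G s \<tau>)"
      by (rule Bochner_Integration.integral_diff[symmetric]) (auto intro: 1 s)
    also have "\<dots> = (LINT \<tau>|time_measure. indicator {a<..b} \<tau> * G s \<tau>)"
      using assms by (intro Bochner_Integration.integral_cong) (auto simp: indicator_def)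
    finally show ?thesis .
  qed
  have "cross b b - cross a a = (cross b b - cross a b) + (cross b a - cross a a)"
    using cross_sym[OF ab] by simp
  also have "\<dots> = (LINT \<tau>|time_measure. indicator {a<..b} \<tau> * (G a \<tau> + G b \<tau>))"
    unfolding d[OF ab(1)] d[OF ab(2)] using 1[OF _ ab(1)] 1[OF _ ab(2)] by (simp add: distrib_left)
  finally show ?thesis .
qed

text \<open>Summing the increments over a partition into \<open>n\<close> equal pieces and letting \<open>n\<close> tend to
  infinity.\<close>

lemma energy_balance:
  assumes t: "0 < t" "t \<le> T"
  shows "integrable time_measure (\<lambda>\<tau>. indicator {0<..t} \<tau> * G \<tau> \<tau>)"
    and "cross t t - cross 0 0 = 2 * (LINT \<tau>|time_measure. indicator {0<..t} \<tau> * G \<tau> \<tau>)"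
proof -
  define p where "p n j = t * real j / real (Suc n)" for n j :: nat
  have p: "p n 0 = 0" "p n (Suc n) = t" for n by (simp_all add: p_def)
  have pmono: "p n i \<le> p n j" if "i \<le> j" for n i j
    unfolding p_def using that t by (intro divide_right_mono mult_left_mono) auto
  have p0: "0 \<le> p n j" for n j unfolding p_def using t by simp
  have pT: "p n j \<in> {0..T}" if "j \<le> Suc n" for n j using p0[of n j] pmono[OF that, of n] p(2)[of n] t by simp
  define h where "h n \<tau> = (\<Sum>j<Suc n. indicator {p n j<..p n (Suc j)} \<tau> * (G (p n j) \<tau> + G (p n (Suc j)) \<tau>))" for n \<tau>
  have int: "integrable time_measure (\<lambda>\<tau>. indicator {p n j<..p n (Suc j)} \<tau> * (G (p n j) \<tau> + G (p n (Suc j)) \<tau>))" if "j < Suc n" for n j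
    by (rule integrable_indicator_mult_lebesgue_on[OF Bochner_Integration.integrable_add[OF G_integrable G_integrable]]) 
      (use that pT in auto)
  have tele: "cross (p n m) (p n m) - cross 0 0 = (\<Sum>j<m. cross (p n (Suc j)) (p n (Suc j)) - cross (p n j) (p n j))" for n m
    using sum_lessThan_telescope[of "\<lambda>j. cross (p n j) (p n j)" m] by (simp add: p)
  have sum: "cross t t - cross 0 0 = (LINT \<tau>|time_measure. h n \<tau>)" for n
  proof -
    have "cross t t - cross 0 0 = (\<Sum>j<Suc n. cross (p n (Suc j)) (p n (Suc j)) - cross (p n j) (p n j))"
      using tele[of n "Suc n"] by (simp only: p(2))
    also have "\<dots> = (\<Sum>j<Suc n. LINT \<tau>|time_measure. indicator {p n j<..p n (Suc j)} \<tau> * (G (p n j) \<tau> + G (p n (Suc j)) \<tau>))"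
    proof (rule sum.cong[OF refl])
      fix j assume "j \<in> {..<Suc n}"
      then have "p n (Suc j) \<le> T" using pT[of "Suc j" n] by simp
      then show "cross (p n (Suc j)) (p n (Suc j)) - cross (p n j) (p n j) = (LINT \<tau>|time_measure. indicator {p n j<..p n (Suc j)} \<tau> * (G (p n j) \<tau> + G (p n (Suc j)) \<tau>))"
        by (intro energy_increment p0 pmono) auto
    qed
    also have "\<dots> = (LINT \<tau>|time_measure. h n \<tau>)"
      unfolding h_def by (rule Bochner_Integration.integral_sum[symmetric]) (use int in auto)
    finally show ?thesis .
  qed
  \<comment> \<open>The half-open pieces cover \<open>{0<..t}\<close> disjointly, so a single
    summand survives at each \<open>\<tau>\<close>.\<close>
  have hk: "\<exists>j<Suc n. p n j < \<tau> \<and> \<tau> \<le> p n (Suc j) \<and> h n \<tau> = G (p n j) \<tau> + G (p n (Suc j)) \<tau>" if \<tau>: "0 < \<tau>" "\<tau> \<le> t" for n \<tau>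
  proof -
    \<comment> \<open>The ceiling minus 1, because the pieces are closed on the right.\<close>
    define j where "j = nat (\<lceil>\<tau> * real (Suc n) / t\<rceil> - 1)"
    have pos: "0 < \<tau> * real (Suc n) / t" using \<tau> t by simp
    then have c1: "\<lceil>\<tau> * real (Suc n) / t\<rceil> \<ge> 1" by linarith
    have iff: "p n i < \<tau> \<and> \<tau> \<le> p n (Suc i) \<longleftrightarrow> i = j" for i
    proof -
      have "p n i < \<tau> \<and> \<tau> \<le> p n (Suc i) \<longleftrightarrow> real i < \<tau> * real (Suc n) / t \<and> \<tau> * real (Suc n) / t \<le> real i + 1"
        using t unfolding p_def by (simp add: field_simps del: of_nat_Suc) (simp add: algebra_simps)
      also have "\<dots> \<longleftrightarrow> \<lceil>\<tau> * real (Suc n) / t\<rceil> = int i + 1"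
        unfolding ceiling_eq_iff by simp
      also have "\<dots> \<longleftrightarrow> i = j" using c1 by (auto simp: j_def)
      finally show ?thesis .
    qed
    then have j: "p n j < \<tau>" "\<tau> \<le> p n (Suc j)" by auto
    have jn: "j < Suc n"
    proof (rule ccontr)
      assume "\<not> j < Suc n"
      then have "t \<le> p n j" using pmono[of "Suc n" j n] p(2)[of n] by simp
      then show False using j \<tau> by simp
    qed
    have "h n \<tau> = (\<Sum>i<Suc n. if i = j then G (p n i) \<tau> + G (p n (Suc i)) \<tau> else 0)"
      unfolding h_def using iff by (intro sum.cong refl) (auto simp: indicator_def)
    also have "\<dots> = G (p n j) \<tau> + G (p n (Suc j)) \<tau>" using jn by (simp add: sum.delta del: sum.lessThan_Suc)
    finally show ?thesis using j jn by blast
  qed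
  have h0: "h n \<tau> = 0" if "\<not> (0 < \<tau> \<and> \<tau> \<le> t)" for n \<tau>
    unfolding h_def
  proof (rule sum.neutral, intro ballI)
    fix j assume "j \<in> {..<Suc n}"
    then have "p n (Suc j) \<le> t" using pmono[of "Suc j" "Suc n" n] p(2)[of n] by simp
    then show "indicator {p n j<..p n (Suc j)} \<tau> * (G (p n j) \<tau> + G (p n (Suc j)) \<tau>) = 0"
      using that p0[of n j] by (auto simp: indicator_def)
  qed
  \<comment> \<open>Both end points of the piece containing \<open>\<tau>\<close> tend to
    \<open>\<tau>\<close>. The two fluxes in the surviving summand have the same limit, which is the
    origin of the factor 2.\<close>
  have lim: "(\<lambda>n. h n \<tau>) \<longlonglongrightarrow> 2 * (indicator {0<..t} \<tau> * G \<tau> \<tau>)" if \<tau>T: "\<tau> \<in> {0..T}" for \<tau>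
  proof (cases "0 < \<tau> \<and> \<tau> \<le> t")
    case True
    from hk True obtain j where j: "\<And>n. j n < Suc n" "\<And>n. p n (j n) < \<tau>" "\<And>n. \<tau> \<le> p n (Suc (j n))" 
      "\<And>n. h n \<tau> = G (p n (j n)) \<tau> + G (p n (Suc (j n))) \<tau>" by metis
    have step: "p n (Suc i) = p n i + t / real (Suc n)" for n i unfolding p_def of_nat_Suc[of i] by (simp only: distrib_left add_divide_distrib mult_1_right add.commute)
    have l0: "(\<lambda>n. t / real (Suc n)) \<longlonglongrightarrow> 0"
      using tendsto_mult[OF tendsto_const[of t] LIMSEQ_Suc[OF lim_1_over_n]] by simp
    have a: "(\<lambda>n. p n (j n)) \<longlonglongrightarrow> \<tau>"
    proof (rule real_tendsto_sandwich[of "\<lambda>n. \<tau> - t / real (Suc n)" _ _ "\<lambda>n. \<tau>"])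
      show "\<forall>\<^sub>F n in sequentially. \<tau> - t / real (Suc n) \<le> p n (j n)"
        using j(3) step by (intro always_eventually) (simp add: algebra_simps del: of_nat_Suc)
      show "\<forall>\<^sub>F n in sequentially. p n (j n) \<le> \<tau>" using j(2) by (intro always_eventually allI less_imp_le)
      show "(\<lambda>n. \<tau> - t / real (Suc n)) \<longlonglongrightarrow> \<tau>" using tendsto_diff[OF tendsto_const[of \<tau>] l0] by simp
    qed simp
    have b: "(\<lambda>n. p n (Suc (j n))) \<longlonglongrightarrow> \<tau>"
      unfolding step using tendsto_add[OF a l0] by simp
    have Gc: "(\<lambda>n. G (X n) \<tau>) \<longlonglongrightarrow> G \<tau> \<tau>" if "X \<longlonglongrightarrow> \<tau>" "\<And>n. X n \<in> {0..T}" for X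
      using continuous_on_tendsto_compose[OF G_continuous[OF \<tau>T] that(1) \<tau>T] that(2) by simp
    have "(\<lambda>n. h n \<tau>) \<longlonglongrightarrow> G \<tau> \<tau> + G \<tau> \<tau>"
      unfolding j(4) by (intro tendsto_add Gc a b pT) (use j(1) in \<open>auto simp: less_Suc_eq_le le_SucI\<close>)
    then show ?thesis using True by simp
  next
    case False
    have "indicator {0<..t} \<tau> = (0 :: real)" using False by (auto simp: indicator_def)
    then show ?thesis by (simp add: h0[OF False])
  qed
  have hint: "integrable time_measure (h n)" for n
    unfolding h_def by (rule Bochner_Integration.integrable_sum) (use int in auto)
  have hb: "\<bar>h n \<tau>\<bar> \<le> 2 * (C * sqrt unit_vol * sqrt M * M)" if \<tau>: "\<tau> \<in> {0..T}" for n \<tau>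
  proof (cases "0 < \<tau> \<and> \<tau> \<le> t")
    case True
    then obtain j where j: "j < Suc n" "h n \<tau> = G (p n j) \<tau> + G (p n (Suc j)) \<tau>" using hk by blast
    then have "p n j \<in> {0..T}" "p n (Suc j) \<in> {0..T}" using pT[of j n] pT[of "Suc j" n] by simp_all
    from G_bound[OF this(1) \<tau>] G_bound[OF this(2) \<tau>] show ?thesis unfolding j(2) by linarith
  next
    case False
    then show ?thesis using G_bound[OF \<tau> \<tau>] by (simp add: h0)
  qed
  \<comment> \<open>This is where measurability of the diagonal \<open>G \<tau> \<tau>\<close> comes
    from: it is a limit of step sums in which the first time is frozen on each piece.\<close>
  have m: "(\<lambda>\<tau>. 2 * (indicator {0<..t} \<tau> * G \<tau> \<tau>)) \<in> borel_measurable time_measure"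
    by (rule borel_measurable_LIMSEQ_metric[of h]) (use hint lim in \<open>auto simp: borel_measurable_integrable\<close>)
  have *: "integrable time_measure (\<lambda>\<tau>. 2 * (indicator {0<..t} \<tau> * G \<tau> \<tau>))"
    "(\<lambda>n. LINT \<tau>|time_measure. h n \<tau>) \<longlonglongrightarrow> (LINT \<tau>|time_measure. 2 * (indicator {0<..t} \<tau> * G \<tau> \<tau>))"
  proof -
    have w: "integrable time_measure (\<lambda>_. 2 * (C * sqrt unit_vol * sqrt M * M))"
      by (rule integrable_lebesgue_on_Icc_bounded) auto
    have hm: "h n \<in> borel_measurable time_measure" for n using hint by (rule borel_measurable_integrable)
    have 1: "AE \<tau> in time_measure. (\<lambda>n. h n \<tau>) \<longlonglongrightarrow> 2 * (indicator {0<..t} \<tau> * G \<tau> \<tau>)"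
      using lim by (intro AE_I2) simp
    have 2: "AE \<tau> in time_measure. norm (h n \<tau>) \<le> 2 * (C * sqrt unit_vol * sqrt M * M)" for n
      using hb by (intro AE_I2) simp
    show "integrable time_measure (\<lambda>\<tau>. 2 * (indicator {0<..t} \<tau> * G \<tau> \<tau>))"
      "(\<lambda>n. LINT \<tau>|time_measure. h n \<tau>) \<longlonglongrightarrow> (LINT \<tau>|time_measure. 2 * (indicator {0<..t} \<tau> * G \<tau> \<tau>))"
      using integrable_dominated_convergence[OF m hm w 1 2] integral_dominated_convergence[OF m hm w 1 2] by auto
  qed
  then show "integrable time_measure (\<lambda>\<tau>. indicator {0<..t} \<tau> * G \<tau> \<tau>)" by simp
  have "(\<lambda>n. cross t t - cross 0 0) \<longlonglongrightarrow> (LINT \<tau>|time_measure. 2 * (indicator {0<..t} \<tau> * G \<tau> \<tau>))"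
    using *(2) by (simp only: sum[symmetric])
  then have "cross t t - cross 0 0 = (LINT \<tau>|time_measure. 2 * (indicator {0<..t} \<tau> * G \<tau> \<tau>))"
    by (simp add: LIMSEQ_const_iff)
  then show "cross t t - cross 0 0 = 2 * (LINT \<tau>|time_measure. indicator {0<..t} \<tau> * G \<tau> \<tau>)" by simp
qed

end


section \<open>Vanishing of the flux\<close>

lemma integrable_cell_cball: "integrable (cell_measure P) (\<lambda>x. indicator (cball (0::real^3) r) x :: real)"
proof -
  have "emeasure (cell_measure P) (cball 0 r) = (\<integral>\<^sup>+x. indicator (cell P) x * indicator (cball 0 r) x \<partial>lborel)"
    unfolding cell_measure_def by (rule emeasure_density) auto
  also have "\<dots> \<le> (\<integral>\<^sup>+x. indicator (cball (0::real^3) r) x \<partial>lborel)"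
    by (intro nn_integral_mono) (auto simp: indicator_def)
  also have "\<dots> = emeasure lborel (cball (0::real^3) r)" by (rule nn_integral_indicator) simp
  also have "\<dots> < \<infinity>" by (rule emeasure_compact_finite) simp
  finally show ?thesis by (intro integrable_real_indicator) auto
qed

lemma integral_cball_norm_le:
  assumes f: "L2_field P f"
  shows "integrable (cell_measure P) (\<lambda>x. indicator (cball 0 r) x * norm (f x))"
    and "(\<integral>x. indicator (cball 0 r) x * norm (f x) \<partial>cell_measure P) 
      \<le> sqrt (\<integral>x. indicator (cball (0::real^3) r) x \<partial>cell_measure P) * sqrt (sq_norm P f)"
proof -
  note [measurable] = L2_fieldD(2)[OF f]
  have sq: "(indicator (cball (0::real^3) r) x :: real)\<^sup>2 = indicator (cball 0 r) x" for x by (simp add: indicator_def)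
  have i: "integrable (cell_measure P) (\<lambda>x. (indicator (cball (0::real^3) r) x :: real)\<^sup>2)"
    unfolding sq by (rule integrable_cell_cball)
  show "integrable (cell_measure P) (\<lambda>x. indicator (cball 0 r) x * norm (f x))"
    by (rule integrable_mult_square[OF _ _ i L2_fieldD(3)[OF f]]) measurable
  have "(\<integral>x. \<bar>indicator (cball 0 r) x * norm (f x)\<bar> \<partial>cell_measure P) 
      \<le> sqrt (\<integral>x. (indicator (cball (0::real^3) r) x)\<^sup>2 \<partial>cell_measure P) * sqrt (\<integral>x. (norm (f x))\<^sup>2 \<partial>cell_measure P)"
    by (rule Cauchy_Schwarz_integral[OF _ _ i L2_fieldD(3)[OF f]]) measurable
  then show "(\<integral>x. indicator (cball 0 r) x * norm (f x) \<partial>cell_measure P) 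
      \<le> sqrt (\<integral>x. indicator (cball (0::real^3) r) x \<partial>cell_measure P) * sqrt (sq_norm P f)"
    unfolding sq sq_norm_def by (simp add: abs_mult)
qed

text \<open>Truncation makes the cube Lipschitz, so convergence in L^2 suffices for truncated cubic
  increments. The factor 3 counts the terms of the quadratic cofactor in the difference of
  cubes.\<close>

lemma min_cube_diff_le:
  assumes "0 \<le> (a::real)" "0 \<le> b" "0 \<le> r"
  shows "\<bar>min a r ^ 3 - min b r ^ 3\<bar> \<le> 3 * r\<^sup>2 * \<bar>a - b\<bar>"
proof -
  let ?a = "min a r" and ?b = "min b r"
  have "?a ^ 3 - ?b ^ 3 = (?a - ?b) * (?a\<^sup>2 + ?a * ?b + ?b\<^sup>2)"
    by (simp add: power2_eq_square power3_eq_cube algebra_simps)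
  also have "\<bar>\<dots>\<bar> \<le> \<bar>a - b\<bar> * (r\<^sup>2 + r * r + r\<^sup>2)"
    unfolding abs_mult
  proof (rule mult_mono)
    have "0 \<le> ?a" "?a \<le> r" "0 \<le> ?b" "?b \<le> r" using assms by auto
    then have "?a\<^sup>2 \<le> r\<^sup>2" "?b\<^sup>2 \<le> r\<^sup>2" "?a * ?b \<le> r * r" "0 \<le> ?a\<^sup>2 + ?a * ?b + ?b\<^sup>2"
      using assms by (auto intro!: power_mono mult_mono)
    then show "\<bar>?a\<^sup>2 + ?a * ?b + ?b\<^sup>2\<bar> \<le> r\<^sup>2 + r * r + r\<^sup>2" by linarith
  qed (auto simp: min_def)
  finally show ?thesis by (simp add: power2_eq_square algebra_simps)
qed

section \<open>Continuity of the mollified solution in time and space, and measurability of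
  increments\<close>

lemma (in mollifier) K_Lipschitz: "\<bar>K (y - h) - K y\<bar> \<le> C * norm h"
proof -
  have "norm (K (y - h) - K y) \<le> C * norm (y - h - y)"
  proof (rule differentiable_bound[of UNIV K "\<lambda>y h. k y \<bullet> h"])
    show "(K has_derivative (\<lambda>h. k x \<bullet> h)) (at x within UNIV)" for x using K_deriv by simp
    show "onorm (\<lambda>h. k x \<bullet> h) \<le> C" for x
    proof (rule onorm_le)
      fix h
      have "\<bar>k x \<bullet> h\<bar> \<le> norm (k x) * norm h" by (rule Cauchy_Schwarz_ineq2)
      also have "\<dots> \<le> C * norm h"
        using k_bound[of x] bounded_kernel_nonneg[OF kernel_K] 
        by (intro mult_right_mono) (cases "norm x \<le> 1"; simp)+
      finally show "norm (k x \<bullet> h) \<le> C * norm h" by simp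
    qed
  qed auto
  then show ?thesis by simp
qed

text \<open>The shift is moved from the field to the kernel: the difference between the kernel and
  its translate is itself a bounded kernel with constant \<open>C * norm h\<close>. Support in the
  ball of radius 1/2 and shifts of length at most 1/2 keep it in the unit ball.\<close>

lemma (in mollifier) smear_shift_le:
  assumes f: "L2_field P f" and h: "norm h \<le> 1/2" and supp: "\<And>y. K y \<noteq> 0 \<Longrightarrow> norm y \<le> 1/2"
  shows "norm (smear K f (x + h) - smear K f x) \<le> C * norm h * sqrt unit_vol * sqrt (sq_norm P f)"
proof -
  note [measurable] = L2_fieldD(2)[OF f]
  have k1: "bounded_kernel (C * norm h) (\<lambda>y. K (y - h) - K y)"
    unfolding bounded_kernel_def
  proof (intro conjI allI)
    fix y
    show "\<bar>K (y - h) - K y\<bar> \<le> C * norm h * indicator (cball 0 1) y"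
    proof (cases "norm y \<le> 1")
      case True then show ?thesis using K_Lipschitz[of y h] by simp
    next
      case False
      then have "1/2 < norm y" "1/2 < norm (y - h)" using h norm_triangle_ineq2[of y h] by auto
      then have "K y = 0" "K (y - h) = 0" using supp[of y] supp[of "y - h"] by fastforce+
      then show ?thesis using bounded_kernel_nonneg[OF kernel_K] by simp
    qed
  qed measurable
  have "smear K f (x + h) = (\<integral>y. K (y - h) *\<^sub>R f (x + y) \<partial>distr lborel borel ((+) h))"
    unfolding smear_def by (subst integral_distr) (auto simp: algebra_simps)
  then have e: "smear K f (x + h) = (\<integral>y. K (y - h) *\<^sub>R f (x + y) \<partial>lborel)"
    by (simp add: lborel_distr_plus)
  have i: "integrable lborel (\<lambda>y. K (y - h) *\<^sub>R f (x + y))"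
    using Bochner_Integration.integrable_add[OF smear_integrable[OF k1 f, of x] smear_integrable[OF kernel_K f, of x]]
    by (simp add: scaleR_diff_left)
  have "smear K f (x + h) - smear K f x = smear (\<lambda>y. K (y - h) - K y) f x"
    unfolding e using i smear_integrable[OF kernel_K f, of x] by (simp add: smear_def scaleR_diff_left)
  with norm_smear_le[OF k1 f, of x] show ?thesis by simp
qed

context weak_solution
begin

text \<open>\<open>Suc n\<close> makes the kernel radius at most 1/2, as
  \<open>smear_shift_le\<close> requires.\<close>

abbreviation smooth_v where "smooth_v n \<tau> \<equiv> smear (moll_seq (Suc n)) (v \<tau>)"

text \<open>Continuity in time at each point combines with a local Lipschitz bound in space that is
  uniform in time by the energy bound.\<close>

lemma smooth_v_jointly_continuous:
  "continuous_on ({0..T} \<times> UNIV) (\<lambda>z. smooth_v n (fst z) (x + snd z))"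
  unfolding continuous_on_sequentially comp_def
proof (intro allI ballI impI, elim conjE)
  fix Z :: "nat \<Rightarrow> real \<times> (real^3)" and a 
  assume a: "a \<in> {0..T} \<times> UNIV" and Z: "\<forall>m. Z m \<in> {0..T} \<times> UNIV" "Z \<longlonglongrightarrow> a"
  define Cn where "Cn = 64 / (1 / real (Suc (Suc n)) * measure lborel (cball (0::real^3) (1 / real (Suc (Suc n)))))"
  interpret m: mollifier "moll_seq (Suc n)" "moll_grad (1 / real (Suc (Suc n)))" Cn
    unfolding Cn_def by (rule moll_seq_mollifier)
  have C0: "0 \<le> Cn" by (rule bounded_kernel_nonneg[OF m.kernel_K])
  have supp: "norm y \<le> 1/2" if "moll_seq (Suc n) y \<noteq> 0" for y
  proof -
    have "norm y \<le> 1 / real (Suc (Suc n))"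
      using that unfolding moll_seq_def by (intro moll_support) auto
    also have "\<dots> \<le> 1/2" by (simp add: divide_simps)
    finally show ?thesis .
  qed
  have Zf: "fst (Z m) \<in> {0..T}" for m using Z(1) by (auto simp: mem_Times_iff)
  have lf: "(\<lambda>m. fst (Z m)) \<longlonglongrightarrow> fst a" and ls: "(\<lambda>m. snd (Z m)) \<longlonglongrightarrow> snd a" 
    using Z(2) by (auto intro: tendsto_fst tendsto_snd)
  have 1: "(\<lambda>m. smooth_v n (fst (Z m)) (x + snd a)) \<longlonglongrightarrow> smooth_v n (fst a) (x + snd a)"
    using continuous_on_tendsto_compose[OF smear_time_continuous[OF m.kernel_K] lf] a Zf by (auto simp: mem_Times_iff)
  let ?h = "\<lambda>m. snd (Z m) - snd a"
  have lh: "?h \<longlonglongrightarrow> 0" using tendsto_diff[OF ls tendsto_const[of "snd a"]] by simp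
  have 2: "(\<lambda>m. smooth_v n (fst (Z m)) (x + snd (Z m)) - smooth_v n (fst (Z m)) (x + snd a)) \<longlonglongrightarrow> 0"
  proof (rule Lim_null_comparison)
    have "\<forall>\<^sub>F m in sequentially. norm (?h m) < 1/2"
      using order_tendstoD(2)[OF tendsto_norm[OF lh], of "1/2"] by simp
    then show "\<forall>\<^sub>F m in sequentially. norm (smooth_v n (fst (Z m)) (x + snd (Z m)) - smooth_v n (fst (Z m)) (x + snd a)) 
        \<le> Cn * norm (?h m) * sqrt unit_vol * sqrt M"
    proof eventually_elim
      case (elim m)
      have "norm (smooth_v n (fst (Z m)) (x + snd a + ?h m) - smooth_v n (fst (Z m)) (x + snd a)) 
          \<le> Cn * norm (?h m) * sqrt unit_vol * sqrt (sq_norm P (v (fst (Z m))))"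
        by (rule m.smear_shift_le[OF L2[OF Zf] _ supp]) (use elim in simp)
      also have "\<dots> \<le> Cn * norm (?h m) * sqrt unit_vol * sqrt M"
        using M(2)[OF Zf] C0 by (intro mult_left_mono) auto
      finally show ?case by simp
    qed
    have "(\<lambda>m. Cn * norm (?h m) * sqrt unit_vol * sqrt M) \<longlonglongrightarrow> Cn * norm (0 :: real^3) * sqrt unit_vol * sqrt M"
      by (intro tendsto_intros lh)
    then show "(\<lambda>m. Cn * norm (?h m) * sqrt unit_vol * sqrt M) \<longlonglongrightarrow> 0" by simp
  qed
  show "(\<lambda>m. smooth_v n (fst (Z m)) (x + snd (Z m))) \<longlonglongrightarrow> smooth_v n (fst a) (x + snd a)"
    using tendsto_add[OF 2 1] by simp
qed

text \<open>The functions \<open>v \<tau>\<close> are representatives chosen separately for each time, so joint measurability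
  in time and space is only available after integration in space.\<close>

lemma increment_measurable:
  "(\<lambda>(\<tau>, y). \<integral>\<^sup>+x. ennreal (norm (v \<tau> (x + y) - v \<tau> x) ^ 3) \<partial>cell_measure P)
     \<in> borel_measurable (lebesgue_on {0..T} \<Otimes>\<^sub>M lborel)"
proof -
  let ?M = "lebesgue_on {0..T} \<Otimes>\<^sub>M (lborel :: (real^3) measure)"
  let ?I = "\<lambda>R x. indicator (cball (0::real^3) (real R)) x :: real"
  \<comment> \<open>Cutting off in space and truncating the increment at \<open>R\<close> provides
    an integrable majorant. \<open>H\<close> below is the same functional without
    mollification.\<close>
  define F where "F R n z = (\<integral>x. ?I R x * min (norm (smooth_v n (fst z) (x + snd z) - smooth_v n (fst z) x)) (real R) ^ 3 \<partial>cell_measure P)" 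
    for R :: nat and n and z :: "real \<times> (real^3)"
  define H where "H R z = (\<integral>x. ?I R x * min (norm (v (fst z) (x + snd z) - v (fst z) x)) (real R) ^ 3 \<partial>cell_measure P)" 
    for R :: nat and z :: "real \<times> (real^3)"
  have spM: "fst z \<in> {0..T}" if "z \<in> space ?M" for z using that by (auto simp: space_pair_measure)
  \<comment> \<open>Continuity gives Borel measurability on the strip, whereas \<open>?M\<close>
    carries the Lebesgue sets in time. The identity map bridges the two.\<close>
  have id: "(\<lambda>z. z) \<in> ?M \<rightarrow>\<^sub>M restrict_space borel ({0..T} \<times> UNIV)"
  proof (rule measurable_restrict_space2)
    show "(\<lambda>z. z) \<in> space ?M \<rightarrow> {0..T} \<times> UNIV" by (auto simp: space_pair_measure)
    have 1: "(\<lambda>\<tau>. \<tau>) \<in> borel_measurable (lebesgue_on {0..T})"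
      by (rule continuous_imp_measurable_on_sets_lebesgue) auto
    have "(\<lambda>z. (fst z, snd z)) \<in> ?M \<rightarrow>\<^sub>M borel \<Otimes>\<^sub>M borel"
      by (intro measurable_Pair measurable_compose[OF measurable_fst 1] measurable_compose[OF measurable_snd]) simp
    then show "(\<lambda>z. z) \<in> ?M \<rightarrow>\<^sub>M borel" by (simp add: borel_prod)
  qed
  have Fm: "F R n \<in> borel_measurable ?M" for R n
  proof -
    have "continuous_on ({0..T} \<times> UNIV) (F R n)"
      unfolding F_def
    proof (rule continuous_on_integral_dominated[where w="\<lambda>x. real R ^ 3 * ?I R x"])
      show "integrable (cell_measure P) (\<lambda>x. real R ^ 3 * ?I R x)" by (intro integrable_mult_right integrable_cell_cball)
    next
      fix z :: "real \<times> (real^3)" assume "z \<in> {0..T} \<times> UNIV"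
      then have t: "fst z \<in> {0..T}" by auto
      have [measurable]: "smooth_v n (fst z) \<in> borel_measurable borel"
        by (rule L2_fieldD(2)[OF L2_field_smear[OF moll_seq_kernel L2[OF t]]])
      show "(\<lambda>x. ?I R x * min (norm (smooth_v n (fst z) (x + snd z) - smooth_v n (fst z) x)) (real R) ^ 3) \<in> borel_measurable (cell_measure P)"
        by measurable
      fix x
      show "\<bar>?I R x * min (norm (smooth_v n (fst z) (x + snd z) - smooth_v n (fst z) x)) (real R) ^ 3\<bar> \<le> real R ^ 3 * ?I R x"
        by (auto simp: indicator_def intro!: power_mono)
    next
      fix x
      show "continuous_on ({0..T} \<times> UNIV) (\<lambda>z. ?I R x * min (norm (smooth_v n (fst z) (x + snd z) - smooth_v n (fst z) x)) (real R) ^ 3)"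
      proof -
        have "continuous_on ({0..T} \<times> UNIV) (\<lambda>z. smooth_v n (fst z) x)"
          by (rule continuous_on_compose2[OF smear_time_continuous[OF moll_seq_kernel] continuous_on_fst[OF continuous_on_id]]) auto
        then show ?thesis by (intro continuous_intros smooth_v_jointly_continuous)
      qed
    qed
    then have "F R n \<in> borel_measurable (restrict_space borel ({0..T} \<times> UNIV))"
      by (rule borel_measurable_continuous_on_restrict)
    from measurable_compose[OF id this] show ?thesis by simp
  qed
  \<comment> \<open>For fixed \<open>R\<close> the mollification is removed: the truncated cube is
    Lipschitz, and on the ball the L^1 error is bounded by the L^2 error.\<close>
  have FH: "(\<lambda>n. F R n z) \<longlonglongrightarrow> H R z" if z: "z \<in> space ?M" for R z
  proof (rule Lim_transform2[OF tendsto_const], rule Lim_null_comparison)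
    note t = spM[OF z]
    let ?f = "v (fst z)" and ?y = "snd z"
    let ?e = "\<lambda>n x. smooth_v n (fst z) x - ?f x"
    note L = L2[OF t] L2_field_smear[OF moll_seq_kernel L2[OF t]]
    note [measurable] = L2_fieldD(2)[OF L(1)] L2_fieldD(2)[OF L(2)]
    define B where "B = 3 * (real R)\<^sup>2 * (2 * sqrt (\<integral>x. ?I R x \<partial>cell_measure P))"
    have Le: "L2_field P (?e n)" for n by (intro L2_field_diff L)
    show "\<forall>\<^sub>F n in sequentially. norm (H R z - F R n z) \<le> B * sqrt (sq_norm P (?e n))"
    proof (intro always_eventually allI)
      fix n
      let ?a = "\<lambda>x. norm (?f (x + ?y) - ?f x)" and ?b = "\<lambda>x. norm (smooth_v n (fst z) (x + ?y) - smooth_v n (fst z) x)"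
      have int: "integrable (cell_measure P) (\<lambda>x. ?I R x * min (g x) (real R) ^ 3)" 
        if [measurable]: "g \<in> borel_measurable borel" and "\<And>x. 0 \<le> g x" for g :: "real^3 \<Rightarrow> real"
        by (rule Bochner_Integration.integrable_bound[OF integrable_mult_right[OF integrable_cell_cball[of P "real R"], of "real R ^ 3"]])
          (use that in \<open>auto intro!: AE_I2 power_mono simp: indicator_def\<close>)
      have i1: "integrable (cell_measure P) (\<lambda>x. ?I R x * min (?a x) (real R) ^ 3)" by (rule int) auto
      have i2: "integrable (cell_measure P) (\<lambda>x. ?I R x * min (?b x) (real R) ^ 3)" by (rule int) auto
      let ?V = "\<integral>x. ?I R x \<partial>cell_measure P"
      have c1: "integrable (cell_measure P) (\<lambda>x. ?I R x * norm (?e n (x + ?y)))"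
        "(\<integral>x. ?I R x * norm (?e n (x + ?y)) \<partial>cell_measure P) \<le> sqrt ?V * sqrt (sq_norm P (?e n))"
        using integral_cball_norm_le[OF L2_field_shift[OF Le[of n], of ?y], of "real R"] unfolding sq_norm_shift[OF Le[of n]]
        by blast+
      have c2: "integrable (cell_measure P) (\<lambda>x. ?I R x * norm (?e n x))"
        "(\<integral>x. ?I R x * norm (?e n x) \<partial>cell_measure P) \<le> sqrt ?V * sqrt (sq_norm P (?e n))"
        using integral_cball_norm_le[OF Le[of n], of "real R"] by blast+
      have "H R z - F R n z = (\<integral>x. ?I R x * min (?a x) (real R) ^ 3 - ?I R x * min (?b x) (real R) ^ 3 \<partial>cell_measure P)"
        unfolding H_def F_def by (rule Bochner_Integration.integral_diff[OF i1 i2, symmetric])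
      then have "\<bar>H R z - F R n z\<bar> = \<bar>\<integral>x. ?I R x * min (?a x) (real R) ^ 3 - ?I R x * min (?b x) (real R) ^ 3 \<partial>cell_measure P\<bar>"
        by (rule arg_cong)
      also have "\<dots> \<le> (\<integral>x. \<bar>?I R x * min (?a x) (real R) ^ 3 - ?I R x * min (?b x) (real R) ^ 3\<bar> \<partial>cell_measure P)"
        by (rule integral_abs_bound)
      also have "\<dots> \<le> (\<integral>x. 3 * (real R)\<^sup>2 * (?I R x * norm (?e n (x + ?y)) + ?I R x * norm (?e n x)) \<partial>cell_measure P)"
      proof (rule integral_mono)
        show "integrable (cell_measure P) (\<lambda>x. \<bar>?I R x * min (?a x) (real R) ^ 3 - ?I R x * min (?b x) (real R) ^ 3\<bar>)"
          by (rule integrable_abs[OF Bochner_Integration.integrable_diff[OF i1 i2]])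
        show "integrable (cell_measure P) (\<lambda>x. 3 * (real R)\<^sup>2 * (?I R x * norm (?e n (x + ?y)) + ?I R x * norm (?e n x)))"
          by (rule integrable_mult_right[OF Bochner_Integration.integrable_add[OF c1(1) c2(1)]])
        fix x
        have "\<bar>min (?a x) (real R) ^ 3 - min (?b x) (real R) ^ 3\<bar> \<le> 3 * (real R)\<^sup>2 * \<bar>?a x - ?b x\<bar>"
          by (rule min_cube_diff_le) auto
        also have "\<bar>?a x - ?b x\<bar> \<le> norm ((?f (x + ?y) - ?f x) - (smooth_v n (fst z) (x + ?y) - smooth_v n (fst z) x))"
          by (rule norm_triangle_ineq3)
        also have "\<dots> = norm (?e n x - ?e n (x + ?y))" by (simp add: algebra_simps)
        also have "\<dots> \<le> norm (?e n (x + ?y)) + norm (?e n x)" using norm_triangle_ineq4[of "?e n x" "?e n (x + ?y)"] by simp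
        finally have "\<bar>min (?a x) (real R) ^ 3 - min (?b x) (real R) ^ 3\<bar> \<le> 3 * (real R)\<^sup>2 * (norm (?e n (x + ?y)) + norm (?e n x))"
          by (simp add: mult_left_mono)
        then show "\<bar>?I R x * min (?a x) (real R) ^ 3 - ?I R x * min (?b x) (real R) ^ 3\<bar> \<le> 3 * (real R)\<^sup>2 * (?I R x * norm (?e n (x + ?y)) + ?I R x * norm (?e n x))"
          by (auto simp: indicator_def)
      qed
      also have "\<dots> = 3 * (real R)\<^sup>2 * ((\<integral>x. ?I R x * norm (?e n (x + ?y)) \<partial>cell_measure P) + (\<integral>x. ?I R x * norm (?e n x) \<partial>cell_measure P))"
        using c1(1) c2(1) by simp
      also have "\<dots> \<le> 3 * (real R)\<^sup>2 * (sqrt (\<integral>x. ?I R x \<partial>cell_measure P) * sqrt (sq_norm P (?e n)) + sqrt (\<integral>x. ?I R x \<partial>cell_measure P) * sqrt (sq_norm P (?e n)))"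
        by (intro mult_left_mono add_mono c1(2) c2(2)) simp
      also have "\<dots> = B * sqrt (sq_norm P (?e n))" by (simp add: B_def algebra_simps)
      finally show "norm (H R z - F R n z) \<le> B * sqrt (sq_norm P (?e n))" by simp
    qed
    have "(\<lambda>n. B * sqrt (sq_norm P (?e n))) \<longlonglongrightarrow> B * sqrt 0"
      by (intro tendsto_intros LIMSEQ_Suc[OF smear_moll_seq_tendsto[OF sol[OF t]]])
    then show "(\<lambda>n. B * sqrt (sq_norm P (?e n))) \<longlonglongrightarrow> 0" by simp
  qed
  have Hm: "H R \<in> borel_measurable ?M" for R
    by (rule borel_measurable_LIMSEQ_metric[OF Fm FH])
  \<comment> \<open>Monotone convergence in \<open>R\<close> removes cutoff and truncation
    together.\<close>
  have "(\<lambda>z. \<integral>\<^sup>+x. ennreal (norm (v (fst z) (x + snd z) - v (fst z) x) ^ 3) \<partial>cell_measure P) \<in> borel_measurable ?M"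
  proof (rule borel_measurable_LIMSEQ_order)
    show "(\<lambda>z. ennreal (H R z)) \<in> borel_measurable ?M" for R using Hm[of R] by simp
    fix z assume z: "z \<in> space ?M"
    note t = spM[OF z]
    let ?a = "\<lambda>x. norm (v (fst z) (x + snd z) - v (fst z) x)"
    have [measurable]: "v (fst z) \<in> borel_measurable borel" by (rule L2_fieldD(2)[OF L2[OF t]])
    have eq: "ennreal (H R z) = (\<integral>\<^sup>+x. ennreal (?I R x * min (?a x) (real R) ^ 3) \<partial>cell_measure P)" for R
      unfolding H_def
    proof (rule nn_integral_eq_integral[symmetric])
      show "integrable (cell_measure P) (\<lambda>x. ?I R x * min (?a x) (real R) ^ 3)"
        by (rule Bochner_Integration.integrable_bound[OF integrable_mult_right[OF integrable_cell_cball[of P "real R"], of "real R ^ 3"]])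
          (auto intro!: AE_I2 power_mono simp: indicator_def)
    qed auto
    show "(\<lambda>R. ennreal (H R z)) \<longlonglongrightarrow> (\<integral>\<^sup>+x. ennreal (?a x ^ 3) \<partial>cell_measure P)"
      unfolding eq
    proof (rule nn_integral_LIMSEQ)
      have "?I R x * min (?a x) (real R) ^ 3 \<le> ?I S x * min (?a x) (real S) ^ 3" if "R \<le> S" for R S :: nat and x
        using that by (intro mult_mono power_mono) (auto simp: indicator_def min_le_iff_disj)
      then show "incseq (\<lambda>R x. ennreal (?I R x * min (?a x) (real R) ^ 3))"
        by (auto simp: incseq_def le_fun_def intro!: ennreal_leI)
      show "(\<lambda>R. ennreal (?I R x * min (?a x) (real R) ^ 3)) \<longlonglongrightarrow> ennreal (?a x ^ 3)" for x
      proof (rule tendsto_eventually)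
        obtain N :: nat where "max (norm x) (?a x) \<le> real N" using real_arch_simple by blast
        then show "\<forall>\<^sub>F R in sequentially. ennreal (?I R x * min (?a x) (real R) ^ 3) = ennreal (?a x ^ 3)"
          by (intro eventually_sequentiallyI[of N]) (auto simp: min_def)
      qed
    qed measurable
  qed
  then show ?thesis by (simp add: split_beta')
qed

text \<open>With increments at most \<open>\<eta> * norm y\<close>, the gradient bound integrates
  over the ball of radius \<open>\<epsilon>\<close> to 64 times \<open>\<eta>\<close>. The factor
  1/4 of the flux identity and the factor 2 of the energy balance leave 32 times
  \<open>\<eta>\<close>, whatever the radius below \<open>\<delta>\<close>. The mollified energies
  tend to the true ones, and \<open>\<eta>\<close> is arbitrary.\<close>

lemma energy_constant:
  assumes cubic: "AE \<tau> in lebesgue_on {0..T}. integrable (cell_measure P) (\<lambda>x. norm (v \<tau> x) ^ 3)"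
    and small: "\<And>\<eta>. 0 < \<eta> \<Longrightarrow> \<exists>\<delta>>0. \<forall>y. 0 < norm y \<and> norm y < \<delta> \<longrightarrow>
      (\<integral>\<^sup>+\<tau>. (\<integral>\<^sup>+x. ennreal (norm (v \<tau> (x + y) - v \<tau> x) ^ 3) \<partial>cell_measure P) \<partial>lebesgue_on {0..T}) \<le> ennreal (\<eta> * norm y)"
    and t: "t \<in> {0..T}"
  shows "sq_norm P (v t) = sq_norm P (v 0)"
proof (cases "t = 0")
  case False
  then have t': "0 < t" "t \<le> T" using t by auto
  let ?N = "\<lambda>\<tau> y. \<integral>\<^sup>+x. ennreal (norm (v \<tau> (x + y) - v \<tau> x) ^ 3) \<partial>cell_measure P"
  let ?c = "\<lambda>n t. mollified_solution.cross P v (moll_seq n) t t"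
  have fin: "finite_measure (lebesgue_on {0..T})" by (rule finite_measure_lebesgue_on) simp
  interpret pr: pair_sigma_finite "lebesgue_on {0..T}" "lborel :: (real^3) measure"
    using finite_measure.axioms(1)[OF fin] by (simp add: pair_sigma_finite_def sigma_finite_lborel)
  have le: "\<exists>n0. \<forall>n\<ge>n0. \<bar>?c n t - ?c n 0\<bar> \<le> 32 * \<eta>" if \<eta>: "0 < \<eta>" for \<eta>
  proof -
    from small[OF \<eta>] obtain \<delta> where \<delta>: "\<delta> > 0" 
      "\<And>y. 0 < norm y \<Longrightarrow> norm y < \<delta> \<Longrightarrow> (\<integral>\<^sup>+\<tau>. ?N \<tau> y \<partial>lebesgue_on {0..T}) \<le> ennreal (\<eta> * norm y)" by blast
    obtain n0 where n0: "1 / real (Suc n0) < \<delta>" using nat_approx_posE[OF \<delta>(1)] by metis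
    have "\<bar>?c n t - ?c n 0\<bar> \<le> 32 * \<eta>" if n: "n \<ge> n0" for n
    proof -
      define \<epsilon> where "\<epsilon> = 1 / real (Suc n)"
      have "\<epsilon> \<le> 1 / real (Suc n0)" unfolding \<epsilon>_def using n by (intro divide_left_mono) auto
      then have \<epsilon>: "0 < \<epsilon>" "\<epsilon> < \<delta>" using n0 by (simp_all add: \<epsilon>_def)
      define V where "V = measure lborel (cball (0::real^3) \<epsilon>)"
      have V: "V > 0" unfolding V_def by (rule bump_mass_ge(2)[OF \<epsilon>(1)])
      interpret m: mollified_solution P T v "moll_seq n" "moll_grad \<epsilon>" "64 / (\<epsilon> * V)"
        using moll_seq_mollifier[of n] weak_solution_axioms
        by (simp add: mollified_solution_def \<epsilon>_def V_def)
      have AEb: "AE \<tau> in lebesgue_on {0..T}. ennreal (norm (indicator {0<..t} \<tau> * m.G \<tau> \<tau>)) \<le> (1/4) * (\<integral>\<^sup>+y. ennreal (norm (moll_grad \<epsilon> y)) * ?N \<tau> y \<partial>lborel)"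
        using cubic AE_space
      proof eventually_elim
        case (elim \<tau>)
        then have \<tau>: "\<tau> \<in> {0..T}" by simp
        have "ennreal (norm (indicator {0<..t} \<tau> * m.G \<tau> \<tau>)) \<le> ennreal (1/4) * ennreal (4 * \<bar>m.G \<tau> \<tau>\<bar>)"
          by (subst ennreal_mult[symmetric]) (auto simp: indicator_def intro!: ennreal_leI)
        also have "\<dots> \<le> ennreal (1/4) * (\<integral>\<^sup>+y. ennreal (norm (moll_grad \<epsilon> y)) * ?N \<tau> y \<partial>lborel)"
          unfolding m.G_def by (intro mult_left_mono m.flux_self_le sol \<tau> elim(1)) simp
        finally show ?case by (simp add: ennreal_divide_numeral flip: ennreal_1)
      qed
      have gm [measurable]: "moll_grad \<epsilon> \<in> borel_measurable lborel" using m.k_measurable by simp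
      have "ennreal (norm (LINT \<tau>|lebesgue_on {0..T}. indicator {0<..t} \<tau> * m.G \<tau> \<tau>)) 
          \<le> (\<integral>\<^sup>+\<tau>. ennreal (norm (indicator {0<..t} \<tau> * m.G \<tau> \<tau>)) \<partial>lebesgue_on {0..T})"
        by (rule integral_norm_bound_ennreal[OF m.energy_balance(1)[OF t']])
      also have "\<dots> \<le> (\<integral>\<^sup>+\<tau>. (1/4) * (\<integral>\<^sup>+y. ennreal (norm (moll_grad \<epsilon> y)) * ?N \<tau> y \<partial>lborel) \<partial>lebesgue_on {0..T})"
        by (rule nn_integral_mono_AE[OF AEb])
      also have "\<dots> = (1/4) * (\<integral>\<^sup>+\<tau>. (\<integral>\<^sup>+y. ennreal (norm (moll_grad \<epsilon> y)) * ?N \<tau> y \<partial>lborel) \<partial>lebesgue_on {0..T})"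
      proof (rule nn_integral_cmult)
        have "(\<lambda>(\<tau>, y). ennreal (norm (moll_grad \<epsilon> y)) * ?N \<tau> y) \<in> borel_measurable (lebesgue_on {0..T} \<Otimes>\<^sub>M lborel)"
          using increment_measurable unfolding split_beta' by measurable
        then show "(\<lambda>\<tau>. \<integral>\<^sup>+y. ennreal (norm (moll_grad \<epsilon> y)) * ?N \<tau> y \<partial>lborel) \<in> borel_measurable (lebesgue_on {0..T})"
          by (rule lborel.borel_measurable_nn_integral)
      qed
      \<comment> \<open>Tonelli only in \<open>\<tau>\<close> and \<open>y\<close>, with the
        integral over \<open>x\<close> kept inside: this is the joint measurability that
        \<open>increment_measurable\<close> provides.\<close>
      also have "(\<integral>\<^sup>+\<tau>. (\<integral>\<^sup>+y. ennreal (norm (moll_grad \<epsilon> y)) * ?N \<tau> y \<partial>lborel) \<partial>lebesgue_on {0..T})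
          = (\<integral>\<^sup>+y. (\<integral>\<^sup>+\<tau>. ennreal (norm (moll_grad \<epsilon> y)) * ?N \<tau> y \<partial>lebesgue_on {0..T}) \<partial>lborel)"
      proof (rule pr.Fubini'[symmetric])
        show "(\<lambda>(\<tau>, y). ennreal (norm (moll_grad \<epsilon> y)) * ?N \<tau> y) \<in> borel_measurable (lebesgue_on {0..T} \<Otimes>\<^sub>M lborel)"
          using increment_measurable unfolding split_beta' by measurable
      qed
      also have "\<dots> \<le> (\<integral>\<^sup>+y. ennreal (64 * \<eta> / V) * indicator (cball (0::real^3) \<epsilon>) y \<partial>lborel)"
      proof (rule nn_integral_mono)
        fix y :: "real^3"
        have "(\<lambda>\<tau>. ?N \<tau> y) \<in> borel_measurable (lebesgue_on {0..T})"
          using measurable_compose[OF measurable_Pair2'[of y lborel "lebesgue_on {0..T}"] increment_measurable] by simp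
        then have eq: "(\<integral>\<^sup>+\<tau>. ennreal (norm (moll_grad \<epsilon> y)) * ?N \<tau> y \<partial>lebesgue_on {0..T}) = ennreal (norm (moll_grad \<epsilon> y)) * (\<integral>\<^sup>+\<tau>. ?N \<tau> y \<partial>lebesgue_on {0..T})"
          by (rule nn_integral_cmult)
        \<comment> \<open>At \<open>y = 0\<close> the smallness hypothesis says nothing, but there
          the increment is 0.\<close>
        have S: "(\<integral>\<^sup>+\<tau>. ?N \<tau> y \<partial>lebesgue_on {0..T}) \<le> ennreal (\<eta> * \<epsilon>)" if y: "norm y \<le> \<epsilon>"
        proof (cases "y = 0")
          case False
          then have "(\<integral>\<^sup>+\<tau>. ?N \<tau> y \<partial>lebesgue_on {0..T}) \<le> ennreal (\<eta> * norm y)"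
            using y \<epsilon> by (intro \<delta>(2)) auto
          also have "\<dots> \<le> ennreal (\<eta> * \<epsilon>)" using y \<eta> by (intro ennreal_leI mult_left_mono) auto
          finally show ?thesis .
        qed simp
        have "norm (moll_grad \<epsilon> y) \<le> 64 / (\<epsilon> * V) * indicator (cball 0 \<epsilon>) y"
          unfolding V_def by (rule norm_moll_grad_le[OF \<epsilon>(1)])
        then have g: "ennreal (norm (moll_grad \<epsilon> y)) \<le> ennreal (64 / (\<epsilon> * V) * indicator (cball 0 \<epsilon>) y)"
          by (rule ennreal_leI)
        show "(\<integral>\<^sup>+\<tau>. ennreal (norm (moll_grad \<epsilon> y)) * ?N \<tau> y \<partial>lebesgue_on {0..T}) \<le> ennreal (64 * \<eta> / V) * indicator (cball 0 \<epsilon>) y"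
        proof (cases "norm y \<le> \<epsilon>")
          case True
          have "ennreal (norm (moll_grad \<epsilon> y)) * (\<integral>\<^sup>+\<tau>. ?N \<tau> y \<partial>lebesgue_on {0..T}) \<le> ennreal (64 / (\<epsilon> * V)) * ennreal (\<eta> * \<epsilon>)"
            using g True by (intro mult_mono S) auto
          also have "\<dots> = ennreal (64 / (\<epsilon> * V) * (\<eta> * \<epsilon>))" using \<epsilon> V \<eta> by (intro ennreal_mult[symmetric]) auto
          also have "64 / (\<epsilon> * V) * (\<eta> * \<epsilon>) = 64 * \<eta> / V" using \<epsilon> by simp
          finally show ?thesis using True unfolding eq by simp
        next
          case False
          then have "ennreal (norm (moll_grad \<epsilon> y)) = 0" using g by simp
          then show ?thesis unfolding eq by simp
        qed
      qed
      also have "\<dots> = ennreal (64 * \<eta>)"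
      proof -
        have "emeasure lborel (cball (0::real^3) \<epsilon>) = ennreal V"
          unfolding V_def using emeasure_compact_finite[of "cball (0::real^3) \<epsilon>"] by (intro emeasure_eq_ennreal_measure) auto
        then show ?thesis using V \<eta> by (simp add: nn_integral_cmult flip: ennreal_mult)
      qed
      finally have "ennreal (norm (LINT \<tau>|lebesgue_on {0..T}. indicator {0<..t} \<tau> * m.G \<tau> \<tau>)) \<le> (1/4) * ennreal (64 * \<eta>)"
        by (simp add: mult_left_mono)
      also have "(1/4) * ennreal (64 * \<eta>) = ennreal (16 * \<eta>)"
      proof -
        have "(1/4 :: ennreal) = ennreal (1/4)" by (simp add: ennreal_divide_numeral flip: ennreal_1)
        then show ?thesis using \<eta> by (simp flip: ennreal_mult)
      qed
      finally have "\<bar>LINT \<tau>|lebesgue_on {0..T}. indicator {0<..t} \<tau> * m.G \<tau> \<tau>\<bar> \<le> 16 * \<eta>"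
        using \<eta> by (simp add: ennreal_le_iff)
      then show ?thesis using m.energy_balance(2)[OF t'] by (simp add: abs_mult)
    qed
    then show ?thesis by blast
  qed
  have lim: "(\<lambda>n. ?c n s) \<longlonglongrightarrow> sq_norm P (v s)" if s: "s \<in> {0..T}" for s
  proof (rule Lim_transform[OF tendsto_const], rule Lim_null_comparison)
    note Ls = L2[OF s]
    show "\<forall>\<^sub>F n in sequentially. norm (?c n s - sq_norm P (v s)) \<le> sqrt (sq_norm P (v s)) * sqrt (sq_norm P (\<lambda>x. smear (moll_seq n) (v s) x - v s x))"
    proof (intro always_eventually allI)
      fix n
      note Lm = L2_field_smear[OF moll_seq_kernel[of n] Ls]
      interpret m: mollified_solution P T v "moll_seq n" "moll_grad (1 / real (Suc n))" "64 / (1 / real (Suc n) * measure lborel (cball (0::real^3) (1 / real (Suc n))))"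
        using moll_seq_mollifier[of n] weak_solution_axioms by (simp add: mollified_solution_def)
      have "?c n s - sq_norm P (v s) = (\<integral>x. v s x \<bullet> (smear (moll_seq n) (v s) x - v s x) \<partial>cell_measure P)"
        using L2_field_integrable_inner[OF Ls Lm] L2_field_integrable_inner[OF Ls Ls]
        by (simp add: m.cross_def sq_norm_def inner_diff_right power2_norm_eq_inner)
      also have "\<bar>\<dots>\<bar> \<le> sqrt (sq_norm P (v s)) * sqrt (sq_norm P (\<lambda>x. smear (moll_seq n) (v s) x - v s x))"
        by (rule L2_field_CS[OF Ls L2_field_diff[OF Lm Ls]])
      finally show "norm (?c n s - sq_norm P (v s)) \<le> sqrt (sq_norm P (v s)) * sqrt (sq_norm P (\<lambda>x. smear (moll_seq n) (v s) x - v s x))"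
        by simp
    qed
    have "(\<lambda>n. sqrt (sq_norm P (v s)) * sqrt (sq_norm P (\<lambda>x. smear (moll_seq n) (v s) x - v s x))) \<longlonglongrightarrow> sqrt (sq_norm P (v s)) * sqrt 0"
      by (intro tendsto_intros smear_moll_seq_tendsto sol s)
    then show "(\<lambda>n. sqrt (sq_norm P (v s)) * sqrt (sq_norm P (\<lambda>x. smear (moll_seq n) (v s) x - v s x))) \<longlonglongrightarrow> 0" by simp
  qed
  have "(\<lambda>n. ?c n t - ?c n 0) \<longlonglongrightarrow> 0"
  proof (rule LIMSEQ_I)
    fix r :: real assume "0 < r"
    from le[of "r / 64"] this obtain n0 where "\<And>n. n \<ge> n0 \<Longrightarrow> \<bar>?c n t - ?c n 0\<bar> \<le> 32 * (r / 64)" by auto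
    with \<open>0 < r\<close> show "\<exists>n0. \<forall>n\<ge>n0. norm (?c n t - ?c n 0 - 0) < r" by (intro exI[of _ n0]) fastforce
  qed
  moreover have "(\<lambda>n. ?c n t - ?c n 0) \<longlonglongrightarrow> sq_norm P (v t) - sq_norm P (v 0)"
    by (intro tendsto_diff lim t) (use T in simp)
  ultimately show ?thesis using LIMSEQ_unique by fastforce
qed simp

end


section \<open>Borel representatives\<close>

text \<open>The bridge from the completed measure of the definitions to the Borel cell measure:
  agreement almost everywhere with a Borel function already makes \<open>F\<close> Lebesgue
  measurable.\<close>

lemma
  fixes F F' :: "real^3 \<Rightarrow> 'b::euclidean_space"
  assumes [measurable]: "F' \<in> borel_measurable borel" and eq: "AE x in lebesgue. F x = F' x"
  shows D_measure_integral_eq: "(LINT x|D_measure P. F x) = (\<integral>x. F' x \<partial>cell_measure P)"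
    and D_measure_integrable_iff: "integrable (D_measure P) F \<longleftrightarrow> integrable (cell_measure P) F'"
proof -
  have F'm: "F' \<in> borel_measurable lebesgue" by (intro measurable_completion) simp
  have Fm: "F \<in> borel_measurable lebesgue"
    by (rule borel_measurable_AE[OF F'm]) (use eq in auto)
  have cell: "cell P \<in> sets lebesgue" using sets_cell by (intro sets_completionI_sets) simp
  have m: "(\<lambda>x. indicator (cell P) x *\<^sub>R F x) \<in> borel_measurable lebesgue"
    "(\<lambda>x. indicator (cell P) x *\<^sub>R F' x) \<in> borel_measurable lebesgue"
    by (intro borel_measurable_scaleR borel_measurable_indicator cell Fm F'm)+
  have m': "(\<lambda>x. indicator (cell P) x *\<^sub>R F' x) \<in> borel_measurable lborel"
    by measurable
  have ae: "AE x in lebesgue. indicator (cell P) x *\<^sub>R F x = indicator (cell P) x *\<^sub>R F' x"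
    using eq by eventually_elim simp
  have dens: "cell_measure P = density lborel (\<lambda>x. ennreal (indicator (cell P) x))"
    by (simp add: cell_measure_def ennreal_indicator)
  have "(LINT x|D_measure P. F x) = (LINT x|lebesgue. indicator (cell P) x *\<^sub>R F x)"
    unfolding D_measure_def using cell by (intro integral_restrict_space) simp
  also have "\<dots> = (LINT x|lebesgue. indicator (cell P) x *\<^sub>R F' x)"
    by (rule integral_cong_AE[OF m ae])
  also have "\<dots> = (LINT x|lborel. indicator (cell P) x *\<^sub>R F' x)"
    by (rule integral_completion[OF m'])
  also have "\<dots> = (\<integral>x. F' x \<partial>cell_measure P)"
    unfolding dens by (subst integral_density) auto
  finally show "(LINT x|D_measure P. F x) = (\<integral>x. F' x \<partial>cell_measure P)" .
  have "integrable (D_measure P) F \<longleftrightarrow> integrable lebesgue (\<lambda>x. indicator (cell P) x *\<^sub>R F x)"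
    unfolding D_measure_def using cell by (intro integrable_restrict_space) simp
  also have "\<dots> \<longleftrightarrow> integrable lebesgue (\<lambda>x. indicator (cell P) x *\<^sub>R F' x)"
    by (rule integrable_cong_AE[OF m ae])
  also have "\<dots> \<longleftrightarrow> integrable lborel (\<lambda>x. indicator (cell P) x *\<^sub>R F' x)"
    by (rule integrable_completion[OF m'])
  also have "\<dots> \<longleftrightarrow> integrable (cell_measure P) F'"
    unfolding dens by (subst integrable_density) auto
  finally show "integrable (D_measure P) F \<longleftrightarrow> integrable (cell_measure P) F'" .
qed

text \<open>A Borel version found on the cell is extended by reduction. The exceptional set lies in
  countably many lattice translates of one null set, so the extension is correct almost everywhere
  on the whole space and not just on the cell.\<close>

lemma periodic_borel_representative:
  fixes f :: "real^3 \<Rightarrow> real^3"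
  assumes per: "periodic P f" and m: "f \<in> borel_measurable (D_measure P)"
  obtains g where "periodic P g" "g \<in> borel_measurable borel" "AE x in lebesgue. f x = g x"
proof -
  have cell: "cell P \<in> sets lebesgue" using sets_cell by (intro sets_completionI_sets) simp
  let ?F = "\<lambda>x. indicator (cell P) x *\<^sub>R f x"
  have F: "?F \<in> borel_measurable lebesgue"
    using m cell unfolding D_measure_def by (subst (asm) borel_measurable_restrict_space_iff) auto
  have ex: "\<exists>h\<in>borel_measurable lborel. AE x in lborel. ?F x $ i = h x" for i
  proof (rule completion_ex_borel_measurable_real)
    have "(\<lambda>z::real^3. z $ i) \<in> borel_measurable borel" by measurable
    from measurable_compose[OF F this] show "(\<lambda>x. ?F x $ i) \<in> borel_measurable lebesgue" .
  qed
  then obtain h where h: "\<And>i. h i \<in> borel_measurable lborel" "\<And>i. AE x in lborel. ?F x $ i = h i x"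
    using choice[OF allI, of "\<lambda>i h. h \<in> borel_measurable lborel \<and> (AE x in lborel. ?F x $ i = h x)"] ex
    unfolding Bex_def by blast
  define g0 :: "real^3 \<Rightarrow> real^3" where "g0 x = (\<Sum>i\<in>UNIV. h i x *\<^sub>R axis i 1)" for x
  have g0i: "g0 x $ i = h i x" for x i
    by (simp add: g0_def axis_def if_distrib[of "\<lambda>z. _ * z"] cong: if_cong)
  have [measurable]: "g0 \<in> borel_measurable borel"
    unfolding g0_def using h(1) by simp
  have "AE x in lborel. \<forall>i\<in>UNIV. ?F x $ i = h i x"
    by (rule AE_finite_allI[OF finite h(2)])
  then have "AE x in lebesgue. ?F x = g0 x"
    by (intro AE_completion) (auto simp: vec_eq_iff g0i)
  then obtain N where N: "negligible N" "{x. ?F x \<noteq> g0 x} \<subseteq> N"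
    unfolding eventually_ae_filter_negligible by blast
  define g where "g x = g0 (reduce P x)" for x
  have "AE x in lebesgue. f x = g x"
    unfolding eventually_ae_filter_negligible
  proof (intro exI conjI)
    show "negligible (\<Union>((\<lambda>l. (+) l ` N) ` period_lattice P))"
      using countable_period_lattice N(1) by (intro negligible_countable_Union) (auto intro: negligible_translation)
    show "{x. f x \<noteq> g x} \<subseteq> \<Union>((\<lambda>l. (+) l ` N) ` period_lattice P)"
    proof
      fix x assume "x \<in> {x. f x \<noteq> g x}"
      then have "f (reduce P x) \<noteq> g0 (reduce P x)" using periodic_reduce[OF per] by (simp add: g_def)
      then have "reduce P x \<in> N" using N(2) reduce_in_cell[of P x] by (auto simp: indicator_def)
      moreover have "x - reduce P x \<in> period_lattice P" using reduce_eq_iff[of x "x - reduce P x" P] by simp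
      ultimately show "x \<in> \<Union>((\<lambda>l. (+) l ` N) ` period_lattice P)"
        by (intro UN_I[of "x - reduce P x"] image_eqI[of _ _ "reduce P x"]) auto
    qed
  qed
  moreover have "periodic P g" unfolding g_def by (rule periodic_comp_reduce)
  moreover have "g \<in> borel_measurable borel" unfolding g_def by measurable
  ultimately show thesis by (rule that[rotated 2])
qed

lemma AE_lebesgue_shift:
  fixes y :: "'a::euclidean_space"
  assumes "AE x in lebesgue. Q x"
  shows "AE x in lebesgue. Q (x + y)"
proof -
  from assms obtain N where N: "negligible N" "{x. \<not> Q x} \<subseteq> N"
    unfolding eventually_ae_filter_negligible by blast
  have "{x. \<not> Q (x + y)} \<subseteq> (+) (- y) ` N"
    using N(2) by (auto intro!: image_eqI[of _ _ "_ + y"])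
  then show ?thesis
    unfolding eventually_ae_filter_negligible using negligible_translation[OF N(1)] by blast
qed

lemma Lp_norm_power:
  assumes "0 < p"
  shows "Lp_norm P p f ^ p = (LINT x|D_measure P. norm (f x) ^ p)"
  unfolding Lp_norm_def using assms by (intro real_root_pow_pos2) auto

text \<open>\<open>gradient\<close> puts the direction of differentiation in the second index, so
  contraction with \<open>tensor a a\<close> differentiates along \<open>a\<close> and pairs the
  result with \<open>a\<close>.\<close>

lemma tensor_inner_gradient:
  assumes "smooth_on UNIV \<psi>"
  shows "tensor a a \<bullet> gradient \<psi> x = a \<bullet> frechet_derivative \<psi> (at x) a"
proof -
  have lin: "linear (frechet_derivative \<psi> (at x))"
    by (rule has_derivative_linear[OF smooth_on_UNIV_derivative(1)[OF assms]])
  have "a = (\<Sum>j\<in>UNIV. a $ j *\<^sub>R axis j 1)"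
    by (simp add: vec_eq_iff axis_def if_distrib[of "\<lambda>z. _ * z"] cong: if_cong)
  then have "frechet_derivative \<psi> (at x) a = frechet_derivative \<psi> (at x) (\<Sum>j\<in>UNIV. a $ j *\<^sub>R axis j 1)"
    by (rule arg_cong)
  also have "\<dots> = (\<Sum>j\<in>UNIV. frechet_derivative \<psi> (at x) (a $ j *\<^sub>R axis j 1))"
    by (rule linear_sum[OF lin])
  also have "\<dots> = (\<Sum>j\<in>UNIV. a $ j *\<^sub>R frechet_derivative \<psi> (at x) (axis j 1))"
    by (simp only: linear_scale[OF lin])
  finally show ?thesis
    by (simp add: inner_vec_def tensor_def gradient_def partial_deriv_def sum_distrib_left mult_ac)
qed

lemma norm_diff_cube_le: "norm (a - b) ^ 3 \<le> 8 * (norm a ^ 3 + norm (b::'a::real_normed_vector) ^ 3)"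
proof -
  have "norm (a - b) ^ 3 \<le> (2 * max (norm a) (norm b)) ^ 3"
    using norm_triangle_ineq4[of a b] by (intro power_mono) auto
  also have "\<dots> \<le> 8 * (norm a ^ 3 + norm b ^ 3)"
    by (auto simp: max_def power_mult_distrib)
  finally show ?thesis .
qed

section \<open>Transfer of the hypotheses on \<open>u\<close> to Borel representatives
  \<open>v\<close>\<close>

context
  fixes T :: real and P :: "3 set" and u v :: "real \<Rightarrow> real^3 \<Rightarrow> real^3"
  assumes T: "T > 0" and weak: "weak_Euler_solution P T u"
    and v: "\<And>t. t \<in> {0..T} \<Longrightarrow> periodic P (v t)" "\<And>t. t \<in> {0..T} \<Longrightarrow> v t \<in> borel_measurable borel"
      "\<And>t. t \<in> {0..T} \<Longrightarrow> AE x in lebesgue. u t x = v t x"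
begin

lemma representative_sq_norm:
  assumes t: "t \<in> {0..T}" and [measurable]: "\<phi> \<in> borel_measurable borel"
  shows "(Lp_norm P 2 (\<lambda>x. u t x - \<phi> x))\<^sup>2 = sq_norm P (\<lambda>x. v t x - \<phi> x)"
proof -
  note [measurable] = v(2)[OF t]
  have ae: "AE x in lebesgue. (norm (u t x - \<phi> x))\<^sup>2 = (norm (v t x - \<phi> x))\<^sup>2"
    using v(3)[OF t] by eventually_elim simp
  show ?thesis unfolding sq_norm_def
    by (subst Lp_norm_power, simp, rule D_measure_integral_eq[OF _ ae]) simp
qed

lemma representative_solenoidal:
  assumes t: "t \<in> {0..T}"
  shows "solenoidal P (v t)"
proof -
  note [measurable] = v(2)[OF t]
  have uH: "u t \<in> H_sigma P" using weak t by (simp add: weak_Euler_solution_def Cw_H_sigma_def)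
  have ae: "AE x in lebesgue. (norm (u t x))\<^sup>2 = (norm (v t x))\<^sup>2"
    using v(3)[OF t] by eventually_elim simp
  have "integrable (D_measure P) (\<lambda>x. (norm (u t x))\<^sup>2)" using uH by (simp add: H_sigma_def Lp_def)
  then have L2: "L2_field P (v t)"
    using D_measure_integrable_iff[OF _ ae, of P] v(1)[OF t] by (simp add: L2_field_def)
  have "\<exists>\<phi>\<in>test_fields_sigma P. sq_norm P (\<lambda>x. v t x - \<phi> x) < e" if "0 < e" for e
  proof -
    have "0 < sqrt e" using that by simp
    then have "\<exists>\<phi>\<in>test_fields_sigma P. Lp_norm P 2 (\<lambda>x. u t x - \<phi> x) < sqrt e"
      using uH unfolding H_sigma_def by blast
    then obtain \<phi> where \<phi>: "\<phi> \<in> test_fields_sigma P" "Lp_norm P 2 (\<lambda>x. u t x - \<phi> x) < sqrt e" ..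
    have "0 \<le> Lp_norm P 2 (\<lambda>x. u t x - \<phi> x)" by (simp add: Lp_norm_def)
    then have "(Lp_norm P 2 (\<lambda>x. u t x - \<phi> x))\<^sup>2 < (sqrt e)\<^sup>2" using \<phi>(2) by (intro power_strict_mono) auto
    then have "sq_norm P (\<lambda>x. v t x - \<phi> x) < e"
      using that by (simp add: representative_sq_norm[OF t L2_fieldD(2)[OF test_fields_sigma_L2[OF \<phi>(1)]]])
    then show ?thesis using \<phi>(1) by blast
  qed
  then show ?thesis using L2 by (simp add: solenoidal_def)
qed

lemma representative_pairing:
  assumes t: "t \<in> {0..T}" and [measurable]: "\<phi> \<in> borel_measurable borel"
  shows "pairing P (u t) \<phi> = (\<integral>x. v t x \<bullet> \<phi> x \<partial>cell_measure P)"
proof -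
  note [measurable] = v(2)[OF t]
  have ae: "AE x in lebesgue. u t x \<bullet> \<phi> x = v t x \<bullet> \<phi> x"
    using v(3)[OF t] by eventually_elim simp
  show ?thesis unfolding pairing_def by (rule D_measure_integral_eq[OF _ ae]) simp
qed

lemma representative_weak_solution: "weak_solution P T v"
proof
  show "0 < T" by (rule T)
  show "solenoidal P (v t)" if "t \<in> {0..T}" for t by (rule representative_solenoidal[OF that])
next
  fix \<phi> assume L: "L2_field P \<phi>"
  note [measurable] = L2_fieldD(2)[OF L]
  have "\<phi> \<in> borel_measurable (D_measure P)"
    unfolding D_measure_def by (intro measurable_restrict_space1 measurable_completion) simp
  moreover have "integrable (D_measure P) (\<lambda>x. (norm (\<phi> x))\<^sup>2)"
    using D_measure_integrable_iff[of "\<lambda>x. (norm (\<phi> x))\<^sup>2" "\<lambda>x. (norm (\<phi> x))\<^sup>2" P] L2_fieldD(3)[OF L] by simp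
  ultimately have "\<phi> \<in> Lp P 2" using L2_fieldD(1)[OF L] by (simp add: Lp_def)
  then have "continuous_on {0..T} (\<lambda>t. pairing P (u t) \<phi>)"
    using weak by (simp add: weak_Euler_solution_def Cw_H_sigma_def)
  then show "continuous_on {0..T} (\<lambda>t. \<integral>x. v t x \<bullet> \<phi> x \<partial>cell_measure P)"
    by (rule continuous_on_eq) (simp add: representative_pairing)
next
  fix K k C \<phi> t
  assume "mollifier K k C" and \<phi>: "\<phi> \<in> test_fields_sigma P" and t: "t \<in> {0..T}"
    and int: "integrable (lebesgue_on {0..t}) (\<lambda>\<tau>. flux P k (v \<tau>) \<phi>)"
  interpret mollifier K k C by fact
  let ?\<psi> = "smear K \<phi>"
  have \<psi>: "?\<psi> \<in> test_fields_sigma P" by (rule smear_test_fields_sigma[OF \<phi>])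
  have s\<phi>: "smooth_on UNIV \<phi>" and s\<psi>: "smooth_on UNIV ?\<psi>"
    using \<phi> \<psi> by (auto simp: test_fields_sigma_def test_fields_def)
  have \<psi>T: "(\<lambda>_. ?\<psi>) \<in> Schwartz_sigma_T P T" by (rule test_fields_time_independent[OF \<psi>])
  \<comment> \<open>\<open>0 < T\<close> makes the derivative within the interval unique also at the
    end points, so its value is 0 for a constant curve and the time term of the equation drops
    out.\<close>
  have td: "time_deriv T (\<lambda>_. ?\<psi>) \<tau> x = 0" if "\<tau> \<in> {0..t}" for \<tau> x
  proof -
    have "vector_derivative (\<lambda>s. ?\<psi> x) (at \<tau> within cbox 0 T) = 0"
      by (rule vector_derivative_within_cbox) (use T t that in auto)
    then show ?thesis by (simp add: time_deriv_def)
  qed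
  have pg: "pairing P (\<lambda>x. tensor (u \<tau> x) (u \<tau> x)) (gradient ?\<psi>) = flux P k (v \<tau>) \<phi>" if "\<tau> \<in> {0..t}" for \<tau>
  proof -
    have \<tau>: "\<tau> \<in> {0..T}" using that t by simp
    have ae: "AE x in lebesgue. tensor (u \<tau> x) (u \<tau> x) \<bullet> gradient ?\<psi> x = - (v \<tau> x \<bullet> smear (\<lambda>y. k y \<bullet> v \<tau> x) \<phi> x)"
      using v(3)[OF \<tau>] 
      by eventually_elim (simp add: tensor_inner_gradient[OF s\<psi>] frechet_derivative_smear(2)[OF s\<phi>])
    have "pairing P (\<lambda>x. tensor (u \<tau> x) (u \<tau> x)) (gradient ?\<psi>) = (\<integral>x. - (v \<tau> x \<bullet> smear (\<lambda>y. k y \<bullet> v \<tau> x) \<phi> x) \<partial>cell_measure P)"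
      unfolding pairing_def
      by (rule D_measure_integral_eq[OF _ ae])
        (intro borel_measurable_uminus flux_integrand_measurable v(2)[OF \<tau>] L2_fieldD(2)[OF test_fields_sigma_L2[OF \<phi>]])
    then show ?thesis by (simp add: flux_def)
  qed
  have sp: "space (lebesgue_on {0..t}) = {0..t}" by simp
  have p0: "pairing P (u \<tau>) (time_deriv T (\<lambda>_. ?\<psi>) \<tau>) = 0" if "\<tau> \<in> {0..t}" for \<tau>
    using td[OF that] by (simp add: pairing_def)
  \<comment> \<open>The guard of the weak formulation: the time terms are 0, and the nonlinear term
    is integrable by the assumed integrability of the flux.\<close>
  have "weak_terms_exist P T u (\<lambda>_. ?\<psi>) t"
    unfolding weak_terms_exist_def
  proof (intro conjI)
    show "AE \<tau> in lebesgue_on {0..t}. integrable (D_measure P) (\<lambda>x. u \<tau> x \<bullet> time_deriv T (\<lambda>_. ?\<psi>) \<tau> x)"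
      by (rule AE_I2) (simp add: td)
    have "integrable (lebesgue_on {0..t}) (\<lambda>\<tau>. pairing P (u \<tau>) (time_deriv T (\<lambda>_. ?\<psi>) \<tau>)) \<longleftrightarrow> integrable (lebesgue_on {0..t}) (\<lambda>_. 0 :: real)"
      by (rule Bochner_Integration.integrable_cong[OF refl]) (simp add: p0)
    then show "integrable (lebesgue_on {0..t}) (\<lambda>\<tau>. pairing P (u \<tau>) (time_deriv T (\<lambda>_. ?\<psi>) \<tau>))" by simp
    have "integrable (lebesgue_on {0..t}) (\<lambda>\<tau>. pairing P (\<lambda>x. tensor (u \<tau> x) (u \<tau> x)) (gradient ?\<psi>)) \<longleftrightarrow> integrable (lebesgue_on {0..t}) (\<lambda>\<tau>. flux P k (v \<tau>) \<phi>)"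
      by (rule Bochner_Integration.integrable_cong[OF refl]) (simp add: pg)
    then show "integrable (lebesgue_on {0..t}) (\<lambda>\<tau>. pairing P (\<lambda>x. tensor (u \<tau> x) (u \<tau> x)) (gradient ?\<psi>))"
      using int by simp
  qed
  with weak t \<psi>T have eq: "pairing P (u t) ?\<psi> - pairing P (u 0) ?\<psi>
        - (LINT \<tau>|lebesgue_on {0..t}. pairing P (u \<tau>) (time_deriv T (\<lambda>_. ?\<psi>) \<tau>))
      = (LINT \<tau>|lebesgue_on {0..t}. pairing P (\<lambda>x. tensor (u \<tau> x) (u \<tau> x)) (gradient ?\<psi>))"
    unfolding weak_Euler_solution_def by blast
  have z: "(LINT \<tau>|lebesgue_on {0..t}. pairing P (u \<tau>) (time_deriv T (\<lambda>_. ?\<psi>) \<tau>)) = (LINT \<tau>|lebesgue_on {0..t}. 0)"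
    by (rule Bochner_Integration.integral_cong[OF refl]) (simp add: p0)
  have f: "(LINT \<tau>|lebesgue_on {0..t}. pairing P (\<lambda>x. tensor (u \<tau> x) (u \<tau> x)) (gradient ?\<psi>)) = (LINT \<tau>|lebesgue_on {0..t}. flux P k (v \<tau>) \<phi>)"
    by (rule Bochner_Integration.integral_cong[OF refl]) (simp add: pg)
  note b = L2_fieldD(2)[OF test_fields_sigma_L2[OF \<psi>]]
  have "0 \<in> {0..T}" using T by simp
  from representative_pairing[OF this b] representative_pairing[OF t b] eq z f
  show "(\<integral>x. v t x \<bullet> ?\<psi> x \<partial>cell_measure P) - (\<integral>x. v 0 x \<bullet> ?\<psi> x \<partial>cell_measure P) = (LINT \<tau>|lebesgue_on {0..t}. flux P k (v \<tau>) \<phi>)"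
    by simp
qed

lemma representative_cubic:
  assumes t: "t \<in> {0..T}" and ut: "u t \<in> Lp P 3"
  shows "integrable (cell_measure P) (\<lambda>x. norm (v t x) ^ 3)"
    and "Lp_norm P 3 (u t) ^ 3 = (\<integral>x. norm (v t x) ^ 3 \<partial>cell_measure P)"
proof -
  note [measurable] = v(2)[OF t]
  have ae: "AE x in lebesgue. norm (u t x) ^ 3 = norm (v t x) ^ 3"
    using v(3)[OF t] by eventually_elim simp
  show "integrable (cell_measure P) (\<lambda>x. norm (v t x) ^ 3)"
    using ut D_measure_integrable_iff[OF _ ae, of P] by (simp add: Lp_def)
  show "Lp_norm P 3 (u t) ^ 3 = (\<integral>x. norm (v t x) ^ 3 \<partial>cell_measure P)"
    by (subst Lp_norm_power, simp, rule D_measure_integral_eq[OF _ ae]) simp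
qed

text \<open>The right side consists of Bochner integrals, which are 0 by default when they fail to
  exist. The L^3 bound makes the inner integral exist for almost every time and the outer one exist
  as well, so smallness of this number bounds the true integral on the left.\<close>

lemma representative_increment:
  assumes u3: "u \<in> Bochner_Lp P 3 3 T"
  shows "(\<integral>\<^sup>+t. (\<integral>\<^sup>+x. ennreal (norm (v t (x + y) - v t x) ^ 3) \<partial>cell_measure P) \<partial>lebesgue_on {0..T})
    = ennreal (LINT t|lebesgue_on {0..T}. LINT x|D_measure P. norm (u t (x + y) - u t x) ^ 3)"
proof -
  interpret weak_solution P T v by (rule representative_weak_solution)
  let ?N = "\<lambda>t. \<integral>\<^sup>+x. ennreal (norm (v t (x + y) - v t x) ^ 3) \<partial>cell_measure P"
  let ?I = "\<lambda>t. \<integral>x. norm (v t (x + y) - v t x) ^ 3 \<partial>cell_measure P"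
  have uI: "(LINT x|D_measure P. norm (u t (x + y) - u t x) ^ 3) = ?I t" if t: "t \<in> {0..T}" for t
  proof -
    note [measurable] = v(2)[OF t]
    have ae: "AE x in lebesgue. norm (u t (x + y) - u t x) ^ 3 = norm (v t (x + y) - v t x) ^ 3"
      using v(3)[OF t] AE_lebesgue_shift[OF v(3)[OF t], of y] by eventually_elim simp
    show ?thesis by (rule D_measure_integral_eq[OF _ ae]) measurable
  qed
  have L3: "AE t in lebesgue_on {0..T}. u t \<in> Lp P 3"
    and L33: "integrable (lebesgue_on {0..T}) (\<lambda>t. Lp_norm P 3 (u t) ^ 3)"
    using u3 by (auto simp: Bochner_Lp_def)
  \<comment> \<open>16 = 8 + 8: \<open>norm_diff_cube_le\<close> costs a factor 8 on each of two
    terms, and these have equal integrals by translation invariance.\<close>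
  have fin: "AE t in lebesgue_on {0..T}. ?N t = ennreal (?I t) \<and> ?I t \<le> 16 * Lp_norm P 3 (u t) ^ 3"
    using L3 AE_space
  proof eventually_elim
    case (elim t)
    then have t: "t \<in> {0..T}" by simp
    note [measurable] = v(2)[OF t]
    note c = representative_cubic[OF t elim(1)]
    have per: "periodic P (\<lambda>x. norm (v t x) ^ 3)" using v(1)[OF t] by (simp add: periodic_def)
    have c': "integrable (cell_measure P) (\<lambda>x. norm (v t (x + y)) ^ 3)"
      using integrable_cell_shift[OF _ per, of y] c(1) by simp
    have w: "integrable (cell_measure P) (\<lambda>x. 8 * (norm (v t (x + y)) ^ 3 + norm (v t x) ^ 3))"
      by (rule integrable_mult_right[OF Bochner_Integration.integrable_add[OF c' c(1)]])
    have int: "integrable (cell_measure P) (\<lambda>x. norm (v t (x + y) - v t x) ^ 3)"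
    proof (rule Bochner_Integration.integrable_bound[OF w])
      show "AE x in cell_measure P. norm (norm (v t (x + y) - v t x) ^ 3) \<le> norm (8 * (norm (v t (x + y)) ^ 3 + norm (v t x) ^ 3))"
      proof (rule AE_I2)
        fix x
        show "norm (norm (v t (x + y) - v t x) ^ 3) \<le> norm (8 * (norm (v t (x + y)) ^ 3 + norm (v t x) ^ 3))"
          using norm_diff_cube_le[of "v t (x + y)" "v t x"] by simp
      qed
    qed measurable
    have "?I t \<le> (\<integral>x. 8 * (norm (v t (x + y)) ^ 3 + norm (v t x) ^ 3) \<partial>cell_measure P)"
      by (rule integral_mono[OF int w norm_diff_cube_le])
    also have "\<dots> = 16 * Lp_norm P 3 (u t) ^ 3"
      using c' c(1) integral_cell_shift[OF _ per, of y] by (simp add: c(2))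
    finally show ?case using nn_integral_eq_integral[OF int] by simp
  qed
  have Nm: "?N \<in> borel_measurable (lebesgue_on {0..T})"
    using measurable_compose[OF measurable_Pair2'[of y lborel "lebesgue_on {0..T}"] increment_measurable] by simp
  have Im: "?I \<in> borel_measurable (lebesgue_on {0..T})"
  proof (rule measurable_cong[THEN iffD1])
    show "(\<lambda>t. enn2real (?N t)) \<in> borel_measurable (lebesgue_on {0..T})" using Nm by simp
    fix t assume "t \<in> space (lebesgue_on {0..T})"
    then have t: "t \<in> {0..T}" by simp
    note [measurable] = v(2)[OF t]
    show "enn2real (?N t) = ?I t" by (subst integral_eq_nn_integral) auto
  qed
  have Iint: "integrable (lebesgue_on {0..T}) ?I"
  proof (rule Bochner_Integration.integrable_bound[OF integrable_mult_right[OF L33, of 16] Im])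
    show "AE t in lebesgue_on {0..T}. norm (?I t) \<le> norm (16 * Lp_norm P 3 (u t) ^ 3)"
      using fin by eventually_elim auto
  qed
  have "(\<integral>\<^sup>+t. ?N t \<partial>lebesgue_on {0..T}) = (\<integral>\<^sup>+t. ennreal (?I t) \<partial>lebesgue_on {0..T})"
    by (rule nn_integral_cong_AE) (use fin in eventually_elim, simp)
  also have "\<dots> = ennreal (LINT t|lebesgue_on {0..T}. ?I t)"
    by (rule nn_integral_eq_integral[OF Iint]) simp
  also have "(LINT t|lebesgue_on {0..T}. ?I t) = (LINT t|lebesgue_on {0..T}. LINT x|D_measure P. norm (u t (x + y) - u t x) ^ 3)"
    by (rule Bochner_Integration.integral_cong[OF refl]) (simp add: uI)
  finally show ?thesis .
qed

end

theorem theorem9: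
  fixes T :: real and P :: "3 set" and u :: "real \<Rightarrow> real^3 \<Rightarrow> real^3"
  assumes "T > 0"
    and "P \<in> {{}, UNIV, {1}, {1, 2}}"
    and "weak_Euler_solution P T u"
    and "u \<in> Bochner_Lp P 3 3 T"
    and "((\<lambda>y. 1 / norm y *
            (LINT t|lebesgue_on {0..T}. LINT x|D_measure P. norm (u t (x + y) - u t x) ^ 3))
          \<longlongrightarrow> 0) (at 0)"
  shows "energy_conserved P T u"
proof -
  \<comment> \<open>The representative is chosen for each time separately, so \<open>v\<close>
    inherits no joint measurability.\<close>
  have "\<forall>t\<in>{0..T}. \<exists>g. periodic P g \<and> g \<in> borel_measurable borel \<and> (AE x in lebesgue. u t x = g x)"
  proof
    fix t assume "t \<in> {0..T}"
    then have "u t \<in> Lp P 2" using assms(3) by (simp add: weak_Euler_solution_def Cw_H_sigma_def H_sigma_def)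
    then show "\<exists>g. periodic P g \<and> g \<in> borel_measurable borel \<and> (AE x in lebesgue. u t x = g x)" using periodic_borel_representative[of P "u t"] unfolding Lp_def by blast
  qed
  from bchoice[OF this] obtain v where v: "\<And>t. t \<in> {0..T} \<Longrightarrow> periodic P (v t)" "\<And>t. t \<in> {0..T} \<Longrightarrow> v t \<in> borel_measurable borel"
      "\<And>t. t \<in> {0..T} \<Longrightarrow> AE x in lebesgue. u t x = v t x"
    by blast
  interpret weak_solution P T v
    by (rule representative_weak_solution[OF assms(1,3) v])
  have cubic: "AE t in lebesgue_on {0..T}. integrable (cell_measure P) (\<lambda>x. norm (v t x) ^ 3)"
  proof -
    have "AE t in lebesgue_on {0..T}. u t \<in> Lp P 3" using assms(4) by (simp add: Bochner_Lp_def)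
    then show ?thesis using AE_space
    proof eventually_elim
      case (elim t)
      then have "t \<in> {0..T}" by simp
      from representative_cubic(1)[OF assms(1,3) v this elim(1)] show ?case .
    qed
  qed
  let ?X = "\<lambda>y. LINT t|lebesgue_on {0..T}. LINT x|D_measure P. norm (u t (x + y) - u t x) ^ 3"
  have small: "\<exists>\<delta>>0. \<forall>y. 0 < norm y \<and> norm y < \<delta> \<longrightarrow>
      (\<integral>\<^sup>+t. (\<integral>\<^sup>+x. ennreal (norm (v t (x + y) - v t x) ^ 3) \<partial>cell_measure P) \<partial>lebesgue_on {0..T}) \<le> ennreal (\<eta> * norm y)"
    if "0 < \<eta>" for \<eta>
  proof -
    from LIM_D[OF assms(5) that] obtain \<delta> where \<delta>: "\<delta> > 0" 
      "\<And>y. y \<noteq> 0 \<Longrightarrow> norm y < \<delta> \<Longrightarrow> norm (1 / norm y * ?X y) < \<eta>" by auto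
    have "(\<integral>\<^sup>+t. (\<integral>\<^sup>+x. ennreal (norm (v t (x + y) - v t x) ^ 3) \<partial>cell_measure P) \<partial>lebesgue_on {0..T}) \<le> ennreal (\<eta> * norm y)"
      if y: "0 < norm y" "norm y < \<delta>" for y
    proof -
      have "1 / norm y * ?X y < \<eta>" using \<delta>(2)[of y] y by auto
      then have "?X y \<le> \<eta> * norm y" using y(1) by (simp add: field_simps)
      moreover have "(\<integral>\<^sup>+t. (\<integral>\<^sup>+x. ennreal (norm (v t (x + y) - v t x) ^ 3) \<partial>cell_measure P) \<partial>lebesgue_on {0..T}) = ennreal (?X y)"
        by (rule representative_increment[OF assms(1,3) v assms(4)])
      ultimately show ?thesis by (simp add: ennreal_leI)
    qed
    then show ?thesis using \<delta>(1) by blast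
  qed
  have "Lp_norm P 2 (u t) = sqrt (sq_norm P (v t))" if "t \<in> {0..T}" for t
  proof -
    have "(Lp_norm P 2 (u t))\<^sup>2 = sq_norm P (v t)"
      using representative_sq_norm[OF assms(1,3) v that, of "\<lambda>_. 0"] by simp
    moreover have "0 \<le> Lp_norm P 2 (u t)" by (simp add: Lp_norm_def)
    ultimately show ?thesis by (metis real_sqrt_unique)
  qed
  moreover have "sq_norm P (v t) = sq_norm P (v 0)" if "t \<in> {0..T}" for t
    by (rule energy_constant[OF cubic _ that]) (rule small)
  moreover have "0 \<in> {0..T}" using assms(1) by simp
  ultimately show ?thesis by (metis energy_conserved_def)
qed

end
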